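(* Let $N\in\mathbb N$ and let $\lambda_1,\dots,\lambda_N\in[0,1]$. For any asymptotically independent sequences $\phi_1,\dots,\phi_N:\mathbb N\to\mathbb Z$, the set of all $T\in\mathrm{Aut}([0,1],\mathcal B,\mu)$ for which there exists a strictly increasing sequence $(n_k)_{k\in\mathbb N}$ in $\mathbb N$ such that for every $j\in\{1,\dots,N\}$ and all $A,B\in\mathcal B$, $$\lim_{k\to\infty}\mu(A\cap T^{-\phi_j(n_k)}B)=(1-\lambda_j)\mu(A\cap B)+\lambda_j\mu(A)\mu(B),$$ is a dense $G_\delta$ subset of $\mathrm{Aut}([0,1],\mathcal B,\mu)$.
   Context: $\mathbb N=\{1,2,\dots\}$. $\mathcal B$ is the Borel $\sigma$-algebra of $[0,1]$ and $\mu$ is Lebesgue measure. $\mathrm{Aut}([0,1],\mathcal B,\mu)$ is the set of invertible $\mu$-preserving transformations $T:[0,1]\to[0,1]$ (as usual identified when they agree $\mu$-a.e.), endowed with the weak topology: $T_n\to T$ if and only if $\|T_nf-Tf\|_{L^2}\to0$ for each $f\in L^2(\mu)$, where $Tf=f\circ T$. This topology is completely metrizable. Sequences $\phi_1,\dots,\phi_N:\mathbb N\to\mathbb Z$ are asymptotically (linearly) independent if for every $(a_1,\dots,a_N)\in\mathbb Z^N\setminus\{\vec 0\}$, $\lim_{n\to\infty}\left|\sum_{j=1}^Na_j\phi_j(n)\right|=\infty$. *)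

theory Defs
  imports "HOL-Analysis.Analysis"
begin

definition unit_leb :: "real measure" where
  "unit_leb = restrict_space lborel {0..1}"

text \<open>
  Invertible measure-preserving transformations of \<open>[0,1]\<close>: Borel bijections with Borel inverse.
  Representatives are total functions on the reals; their values outside \<open>[0,1]\<close> play no role.
\<close>

definition inv_mpt :: "(real \<Rightarrow> real) set" where
  "inv_mpt = {T. bij_betw T {0..1} {0..1} \<and>
     T \<in> measurable unit_leb unit_leb \<and>
     inv_into {0..1} T \<in> measurable unit_leb unit_leb \<and>
     distr unit_leb unit_leb T = unit_leb}"

definition ae_eq :: "((real \<Rightarrow> real) \<times> (real \<Rightarrow> real)) set" where
  "ae_eq = {(S, T). S \<in> inv_mpt \<and> T \<in> inv_mpt \<and> (AE x in unit_leb. S x = T x)}"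

abbreviation aut_class :: "(real \<Rightarrow> real) \<Rightarrow> (real \<Rightarrow> real) set" where
  "aut_class T \<equiv> ae_eq `` {T}"

definition Aut :: "(real \<Rightarrow> real) set set" where
  "Aut = inv_mpt // ae_eq"

definition L2 :: "(real \<Rightarrow> real) set" where
  "L2 = {f \<in> borel_measurable unit_leb. integrable unit_leb (\<lambda>x. (f x)\<^sup>2)}"

definition L2_norm :: "(real \<Rightarrow> real) \<Rightarrow> real" where
  "L2_norm f = sqrt (integral\<^sup>L unit_leb (\<lambda>x. (f x)\<^sup>2))"

text \<open>
  The weak topology is the initial topology of the maps \<open>T \<mapsto> f \<circ> T\<close> into \<open>L\<^sup>2\<close>, for \<open>f\<close> in \<open>L\<^sup>2\<close>
  (real-valued \<open>f\<close> give the same topology as complex-valued ones, by splitting into real and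
  imaginary parts). Lemma \<open>limitin_weak_topology\<close> below describes its convergent sequences.
\<close>

definition weak_topology :: "(real \<Rightarrow> real) set topology" where
  "weak_topology = topology_generated_by
     {aut_class ` {S \<in> inv_mpt. L2_norm (\<lambda>x. f (S x) - f (T x)) < e} | T f e.
        T \<in> inv_mpt \<and> f \<in> L2 \<and> e > 0}"

definition iter_int :: "(real \<Rightarrow> real) \<Rightarrow> int \<Rightarrow> real \<Rightarrow> real" where
  "iter_int T m =
     (if 0 \<le> m then T ^^ nat m else inv_into {0..1} T ^^ nat (- m))"

text \<open>The set \<open>T\<^sup>-\<^sup>m B\<close> is the preimage of \<open>B\<close> under the \<open>m\<close>-th power of \<open>T\<close>.\<close>

definition pullback :: "(real \<Rightarrow> real) \<Rightarrow> int \<Rightarrow> real set \<Rightarrow> real set" where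
  "pullback T m B = {x \<in> {0..1}. iter_int T m x \<in> B}"

text \<open>
  Sequences indexed by \<open>{1, 2, \<dots>}\<close> are functions on \<open>nat\<close> whose value at \<open>0\<close> is never used.
\<close>

definition asymp_independent :: "nat \<Rightarrow> (nat \<Rightarrow> nat \<Rightarrow> int) \<Rightarrow> bool" where
  "asymp_independent N \<phi> \<longleftrightarrow>
     (\<forall>a :: nat \<Rightarrow> int. (\<exists>j\<in>{1..N}. a j \<noteq> 0) \<longrightarrow>
        filterlim (\<lambda>n. \<bar>\<Sum>j\<in>{1..N}. a j * \<phi> j n\<bar>) at_top sequentially)"

definition mixing_along :: "nat \<Rightarrow> (nat \<Rightarrow> real) \<Rightarrow> (nat \<Rightarrow> nat \<Rightarrow> int) \<Rightarrow> (real \<Rightarrow> real) \<Rightarrow> bool" where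
  "mixing_along N lam \<phi> T \<longleftrightarrow>
     (\<exists>n :: nat \<Rightarrow> nat. strict_mono_on {1..} n \<and> n ` {1..} \<subseteq> {1..} \<and>
       (\<forall>j\<in>{1..N}. \<forall>A\<in>sets unit_leb. \<forall>B\<in>sets unit_leb.
          (\<lambda>k. measure unit_leb (A \<inter> pullback T (\<phi> j (n k)) B))
            \<longlonglongrightarrow> (1 - lam j) * measure unit_leb (A \<inter> B)
                 + lam j * measure unit_leb A * measure unit_leb B))"

definition mixing_classes :: "nat \<Rightarrow> (nat \<Rightarrow> real) \<Rightarrow> (nat \<Rightarrow> nat \<Rightarrow> int) \<Rightarrow> (real \<Rightarrow> real) set set" where
  "mixing_classes N lam \<phi> = aut_class ` {T \<in> inv_mpt. mixing_along N lam \<phi> T}"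

lemma space_unit_leb [simp]: "space unit_leb = {0..1}"
  by (simp add: unit_leb_def space_restrict_space)

lemma equiv_ae_eq: "equiv inv_mpt ae_eq"
  unfolding equiv_def
proof (intro conjI)
  show "refl_on inv_mpt ae_eq" by (auto simp: refl_on_def ae_eq_def)
  show "sym ae_eq" by (auto simp: sym_def ae_eq_def eq_commute)
  show "trans ae_eq"
    unfolding trans_def ae_eq_def by (auto elim: AE_mp)
  show "ae_eq \<subseteq> inv_mpt \<times> inv_mpt" by (auto simp: ae_eq_def)
qed

lemma Aut_eq: "Aut = aut_class ` inv_mpt"
  by (auto simp: Aut_def quotient_def)

lemma topspace_weak_topology [simp]: "topspace weak_topology = Aut"
proof -
  have zero: "(\<lambda>x. 0) \<in> L2" "L2_norm (\<lambda>x. 0) < 1" by (simp_all add: L2_def L2_norm_def)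
  then show ?thesis
    unfolding weak_topology_def topology_generated_by_topspace Aut_eq
  proof (intro equalityI subsetI)
    fix c assume "c \<in> aut_class ` inv_mpt"
    then obtain T where "T \<in> inv_mpt" "c = aut_class T" by blast
    with zero show "c \<in> \<Union> {aut_class ` {S \<in> inv_mpt. L2_norm (\<lambda>x. f (S x) - f (T x)) < e} | T f e.
        T \<in> inv_mpt \<and> f \<in> L2 \<and> e > 0}"
      by (intro UnionI[of "aut_class ` {S \<in> inv_mpt. L2_norm (\<lambda>x. 0 - 0) < 1}"] CollectI
            exI[of _ T] exI[of _ "\<lambda>x. 0"] exI[of _ 1] conjI imageI) simp_all
  qed blast
qed

lemma L2_comp:
  assumes "f \<in> L2" "T \<in> inv_mpt"
  shows "(\<lambda>x. f (T x)) \<in> L2"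
proof -
  have T: "T \<in> measurable unit_leb unit_leb" "distr unit_leb unit_leb T = unit_leb"
    using assms by (auto simp: inv_mpt_def)
  have f: "f \<in> borel_measurable unit_leb" "integrable unit_leb (\<lambda>x. (f x)\<^sup>2)"
    using assms by (auto simp: L2_def)
  have "integrable unit_leb (\<lambda>x. (f (T x))\<^sup>2)"
    using integrable_distr[of T unit_leb unit_leb "\<lambda>x. (f x)\<^sup>2"] T f by simp
  then show ?thesis
    using T f by (auto simp: L2_def intro: measurable_compose)
qed

lemma L2_mult_integrable:
  assumes "f \<in> L2" "g \<in> L2"
  shows "integrable unit_leb (\<lambda>x. f x * g x)"
proof (rule Bochner_Integration.integrable_bound)
  show "integrable unit_leb (\<lambda>x. (f x)\<^sup>2 + (g x)\<^sup>2)"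
    using assms by (auto simp: L2_def)
  show "(\<lambda>x. f x * g x) \<in> borel_measurable unit_leb"
    using assms by (auto simp: L2_def)
  have "\<bar>a * b\<bar> \<le> a\<^sup>2 + b\<^sup>2" for a b :: real
  proof -
    have "0 \<le> (\<bar>a\<bar> - \<bar>b\<bar>)\<^sup>2" by simp
    then have "2 * \<bar>a * b\<bar> \<le> a\<^sup>2 + b\<^sup>2" by (simp add: power2_diff abs_mult)
    moreover have "0 \<le> \<bar>a * b\<bar>" by simp
    ultimately show ?thesis by linarith
  qed
  then show "AE x in unit_leb. norm (f x * g x) \<le> norm ((f x)\<^sup>2 + (g x)\<^sup>2)"
    by simp
qed

lemma L2_diff:
  assumes "f \<in> L2" "g \<in> L2"
  shows "(\<lambda>x. f x - g x) \<in> L2"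
  using assms L2_mult_integrable[OF assms]
  by (auto simp: L2_def power2_diff mult.assoc)

lemma L2_triangle:
  assumes "f \<in> L2" "g \<in> L2"
  shows "L2_norm (\<lambda>x. f x + g x) \<le> L2_norm f + L2_norm g"
proof -
  define F where "F = integral\<^sup>L unit_leb (\<lambda>x. (f x)\<^sup>2)"
  define G where "G = integral\<^sup>L unit_leb (\<lambda>x. (g x)\<^sup>2)"
  define H where "H = integral\<^sup>L unit_leb (\<lambda>x. f x * g x)"
  note I = L2_mult_integrable[OF assms]
  have fi: "integrable unit_leb (\<lambda>x. (f x)\<^sup>2)" "integrable unit_leb (\<lambda>x. (g x)\<^sup>2)"
    using assms by (auto simp: L2_def)
  have FG: "F \<ge> 0" "G \<ge> 0" by (simp_all add: F_def G_def)
  have quad: "0 \<le> s\<^sup>2 * F - 2 * s * t * H + t\<^sup>2 * G" for s t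
  proof -
    have "0 \<le> integral\<^sup>L unit_leb (\<lambda>x. (s * f x - t * g x)\<^sup>2)" by simp
    also have "(\<lambda>x. (s * f x - t * g x)\<^sup>2) =
        (\<lambda>x. s\<^sup>2 * (f x)\<^sup>2 - (2 * s * t) * (f x * g x) + t\<^sup>2 * (g x)\<^sup>2)"
      by (auto simp: power2_eq_square algebra_simps)
    also have "integral\<^sup>L unit_leb \<dots> = s\<^sup>2 * F - 2 * s * t * H + t\<^sup>2 * G"
      using fi I by (simp add: F_def G_def H_def)
    finally show ?thesis .
  qed
  have "H \<le> sqrt F * sqrt G"
  proof (cases "F = 0 \<or> G = 0")
    case True
    have "H \<le> 0"
    proof (rule ccontr)
      assume "\<not> H \<le> 0"
      then have H: "H > 0" by simp
      show False
      proof (cases "F = 0")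
        case True
        have "(G + 1) / H * H = G + 1" using H by simp
        then show False using quad[of "(G + 1) / H" 1] True FG H
          by (simp add: mult.assoc)
      next
        case False
        then have "G = 0" using \<open>F = 0 \<or> G = 0\<close> by simp
        have "(F + 1) / H * H = F + 1" using H by simp
        then show False using quad[of 1 "(F + 1) / H"] \<open>G = 0\<close> FG H
          by (simp add: mult.assoc)
      qed
    qed
    then show ?thesis using True by auto
  next
    case False
    then have pos: "sqrt F > 0" "sqrt G > 0" using FG by auto
    have e: "sqrt F * sqrt F = F" "sqrt G * sqrt G = G" using FG by auto
    have "0 \<le> (sqrt G)\<^sup>2 * F - 2 * sqrt G * sqrt F * H + (sqrt F)\<^sup>2 * G"
      using quad .
    also have "\<dots> = 2 * (sqrt F * sqrt G) * (sqrt F * sqrt G - H)"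
      using e FG by (simp add: algebra_simps)
    finally show ?thesis
      using mult_pos_pos[OF pos] by (simp add: zero_le_mult_iff del: real_sqrt_gt_0_iff)
  qed
  then have "F + 2 * H + G \<le> (sqrt F + sqrt G)\<^sup>2"
    using FG by (simp add: power2_sum)
  moreover have "integral\<^sup>L unit_leb (\<lambda>x. (f x + g x)\<^sup>2) = F + 2 * H + G"
    using fi I by (simp add: F_def G_def H_def power2_sum mult.assoc)
  ultimately show ?thesis
    using FG by (simp add: L2_norm_def flip: F_def G_def) (simp add: real_le_lsqrt)
qed

lemma L2_norm_ae_eq:
  assumes "(S, S') \<in> ae_eq" "T \<in> inv_mpt" "f \<in> L2"
  shows "L2_norm (\<lambda>x. f (S x) - f (T x)) = L2_norm (\<lambda>x. f (S' x) - f (T x))"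
proof -
  have S: "S \<in> inv_mpt" "S' \<in> inv_mpt" "AE x in unit_leb. S x = S' x"
    using assms by (auto simp: ae_eq_def)
  have "(\<lambda>x. f (S x) - f (T x)) \<in> L2" "(\<lambda>x. f (S' x) - f (T x)) \<in> L2"
    using S assms by (auto intro: L2_diff L2_comp)
  then show ?thesis
    unfolding L2_norm_def using S
    by (intro arg_cong[where f = sqrt] integral_cong_AE) (auto simp: L2_def)
qed

lemma aut_class_in_ball_iff:
  assumes "S \<in> inv_mpt" "T \<in> inv_mpt" "f \<in> L2"
  shows "aut_class S \<in> aut_class ` {S \<in> inv_mpt. L2_norm (\<lambda>x. f (S x) - f (T x)) < e} \<longleftrightarrow>
         L2_norm (\<lambda>x. f (S x) - f (T x)) < e"
proof
  assume "aut_class S \<in> aut_class ` {S \<in> inv_mpt. L2_norm (\<lambda>x. f (S x) - f (T x)) < e}"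
  then obtain S' where S': "S' \<in> inv_mpt" "L2_norm (\<lambda>x. f (S' x) - f (T x)) < e"
    "aut_class S = aut_class S'" by auto
  then have "(S, S') \<in> ae_eq"
    using eq_equiv_class_iff[OF equiv_ae_eq] assms by blast
  then show "L2_norm (\<lambda>x. f (S x) - f (T x)) < e"
    using S' L2_norm_ae_eq assms by metis
next
  assume "L2_norm (\<lambda>x. f (S x) - f (T x)) < e"
  then show "aut_class S \<in> aut_class ` {S \<in> inv_mpt. L2_norm (\<lambda>x. f (S x) - f (T x)) < e}"
    by (intro imageI CollectI conjI assms)
qed

lemma limitin_weak_topology:
  assumes "\<And>n. T n \<in> inv_mpt" "S \<in> inv_mpt"
  shows "limitin weak_topology (\<lambda>n. aut_class (T n)) (aut_class S) sequentially \<longleftrightarrow>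
    (\<forall>f\<in>L2. (\<lambda>n. L2_norm (\<lambda>x. f (T n x) - f (S x))) \<longlonglongrightarrow> 0)" (is "?L \<longleftrightarrow> ?R")
proof
  assume L: ?L
  show ?R
  proof
    fix f assume f: "f \<in> L2"
    show "(\<lambda>n. L2_norm (\<lambda>x. f (T n x) - f (S x))) \<longlonglongrightarrow> 0"
    proof (rule tendstoI)
      fix e :: real assume e: "e > 0"
      let ?U = "aut_class ` {R \<in> inv_mpt. L2_norm (\<lambda>x. f (R x) - f (S x)) < e}"
      have "openin weak_topology ?U"
        unfolding weak_topology_def
        by (rule topology_generated_by_Basis) (use f e assms in blast)
      moreover have "aut_class S \<in> ?U"
        using assms f e by (subst aut_class_in_ball_iff) (auto simp: L2_norm_def)
      ultimately have "\<forall>\<^sub>F n in sequentially. aut_class (T n) \<in> ?U"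
        using L by (auto simp: limitin_def)
      then show "\<forall>\<^sub>F n in sequentially. dist (L2_norm (\<lambda>x. f (T n x) - f (S x))) 0 < e"
        by (rule eventually_mono)
          (subst (asm) aut_class_in_ball_iff, use assms f in \<open>auto simp: L2_norm_def\<close>)
    qed
  qed
next
  assume R: ?R
  have *: "\<forall>\<^sub>F n in sequentially. aut_class (T n) \<in> U"
    if "generate_topology_on {aut_class ` {S \<in> inv_mpt. L2_norm (\<lambda>x. f (S x) - f (T x)) < e} | T f e.
        T \<in> inv_mpt \<and> f \<in> L2 \<and> e > 0} U" "aut_class S \<in> U" for U
    using that
  proof induction
    case (Basis U)
    then obtain T0 f e where U: "T0 \<in> inv_mpt" "f \<in> L2" "e > 0"
      "U = aut_class ` {S \<in> inv_mpt. L2_norm (\<lambda>x. f (S x) - f (T0 x)) < e}" by blast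
    then have d: "L2_norm (\<lambda>x. f (S x) - f (T0 x)) < e"
      using Basis.prems aut_class_in_ball_iff[OF assms(2) U(1,2), of e] by simp
    have "(\<lambda>n. L2_norm (\<lambda>x. f (T n x) - f (S x))) \<longlonglongrightarrow> 0" using R U by blast
    then have "\<forall>\<^sub>F n in sequentially.
        L2_norm (\<lambda>x. f (T n x) - f (S x)) < e - L2_norm (\<lambda>x. f (S x) - f (T0 x))"
      using d by (intro order_tendstoD) auto
    then show ?case
    proof (rule eventually_mono)
      fix n
      assume n: "L2_norm (\<lambda>x. f (T n x) - f (S x)) < e - L2_norm (\<lambda>x. f (S x) - f (T0 x))"
      have "L2_norm (\<lambda>x. (f (T n x) - f (S x)) + (f (S x) - f (T0 x))) \<le>
          L2_norm (\<lambda>x. f (T n x) - f (S x)) + L2_norm (\<lambda>x. f (S x) - f (T0 x))"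
        by (rule L2_triangle[OF L2_diff[OF L2_comp[OF U(2) assms(1)] L2_comp[OF U(2) assms(2)]]
              L2_diff[OF L2_comp[OF U(2) assms(2)] L2_comp[OF U(2) U(1)]]])
      then have "L2_norm (\<lambda>x. f (T n x) - f (T0 x)) < e" using n by simp
      then show "aut_class (T n) \<in> U"
        unfolding U(4) by (intro imageI CollectI conjI assms)
    qed
  next
    case (UN K)
    then obtain V where "V \<in> K" "aut_class S \<in> V" by blast
    with UN.IH have "\<forall>\<^sub>F n in sequentially. aut_class (T n) \<in> V" by blast
    then show ?case by (rule eventually_mono) (use \<open>V \<in> K\<close> in blast)
  qed (auto intro: eventually_conj)
  show ?L
    unfolding limitin_def
  proof (intro conjI allI impI)
    show "aut_class S \<in> topspace weak_topology" using assms by (auto simp: Aut_eq)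
    fix U assume "openin weak_topology U \<and> aut_class S \<in> U"
    then show "\<forall>\<^sub>F n in sequentially. aut_class (T n) \<in> U"
      using * by (auto simp: weak_topology_def openin_topology_generated_by_iff)
  qed
qed

end

theory Submission
  imports Defs "HOL-Combinatorics.Cycles"
begin

text \<open>
  For a fixed time \<open>n\<close>, the correlations \<open>\<mu>(A \<inter> T\<^sup>-\<^sup>m B)\<close> with \<open>m = \<phi>\<^sub>j(n)\<close> depend on \<open>T\<close>
  continuously in the weak topology. Call \<open>mixing_level k\<close> the set of those \<open>T\<close> which, at some
  time \<open>n > k\<close>, have all these correlations within \<open>1/(k+1)\<close> of the mixture
  \<open>(1-\<lambda>\<^sub>j) \<mu>(A \<inter> B) + \<lambda>\<^sub>j \<mu>(A) \<mu>(B)\<close>, for the first \<open>k+1\<close> dyadic sets \<open>A\<close>, \<open>B\<close> of an enumeration.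
  Each level is open, and because dyadic sets are dense in the measure algebra, the set in
  question is the intersection of the levels (\<open>mixing_classes_eq_Inter\<close>). So it is a \<open>G\<^sub>\<delta>\<close>, and by
  Baire's theorem its density follows once each level is dense
  (\<open>weak_dense_Inter\<close>, \<open>mixing_level_dense\<close>).

  Baire's theorem needs a complete metric whose topology is at least as fine as the weak one. The
  \<open>L\<^sup>1\<close> distance of two maps plus the \<open>L\<^sup>1\<close> distance of their inverses is such a metric: a Cauchy
  sequence has a limit map and a limit of the inverse maps, these are inverse to each other almost
  everywhere, and they become honest Borel bijections once both are replaced by the identity on
  an invariant null set.

  Density of a level has two halves. First, every \<open>T\<close> is close to a permutation \<open>P\<close> of equal
  intervals: take a step function \<open>h\<close> close to \<open>T\<close> and let \<open>P\<close> arrange the intervals in the order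
  of the values of \<open>h\<close>. By one-dimensional optimal transport no measure-preserving map is
  closer to \<open>h\<close> in \<open>L\<^sup>2\<close> than \<open>P\<close>, so \<open>P\<close> is at most twice as far from \<open>T\<close> as \<open>h\<close> is.

  Second, \<open>P\<close> is close to a permutation of much shorter intervals which mixes at some time \<open>n\<close>
  (\<open>finite_mixing_permutation\<close>). Let \<open>P\<close> permute \<open>q\<close> blocks by \<open>\<pi>\<close>. Concatenate long pieces of
  orbits of \<open>\<pi>\<close>, starting from each block, into a cyclic word, and write this word around a
  circle, one arc for each letter. A rotation of this circle by about one arc
  moves a point labelled \<open>i\<close> to a point labelled \<open>\<pi> i\<close>, with few exceptions. Take many copies
  of the circle and rotate the copy \<open>y\<close> by its own angle \<open>\<alpha>\<^sub>y\<close>, slightly more than one arc. The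
  power \<open>\<phi>\<^sub>j(n)\<close> of the resulting map rotates the copy \<open>y\<close> by \<open>\<phi>\<^sub>j(n) \<alpha>\<^sub>y\<close>, and asymptotic
  independence allows all these rotation angles to be prescribed modulo \<open>1\<close>, up to a small
  error and for all \<open>j\<close> and \<open>y\<close> at once, if \<open>n\<close> is large, however short the interval from which
  the \<open>\<alpha>\<^sub>y\<close> are chosen (\<open>asymp_independent_simultaneous_approx\<close>). On a proportion \<open>1-\<lambda>\<^sub>j\<close> of the copies the angle \<open>0\<close> is prescribed, and these
  copies contribute \<open>\<mu>(A \<inter> B)\<close>. On the others the prescribed angles run through all multiples
  of an arc, and since each label occurs equally often around the circle, these copies
  contribute the average \<open>\<mu>(A) \<mu>(B)\<close>. The choice of the copies of
  the first kind for one \<open>j\<close> may depend in any way on the choice for another, since the limit is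
  prescribed for each \<open>j\<close> separately.
\<close>

section \<open>Measure-preserving maps of the unit interval\<close>

abbreviation mu :: "real set \<Rightarrow> real" where "mu \<equiv> measure unit_leb"

lemma sets_unit_leb_iff: "A \<in> sets unit_leb \<longleftrightarrow> A \<in> sets borel \<and> A \<subseteq> {0..1}"
  unfolding unit_leb_def by (subst sets_restrict_space_iff) auto

lemma emeasure_unit_leb: "A \<subseteq> {0..1} \<Longrightarrow> emeasure unit_leb A = emeasure lborel A"
  unfolding unit_leb_def by (rule emeasure_restrict_space) auto

lemma measure_unit_leb: "A \<subseteq> {0..1} \<Longrightarrow> mu A = measure lborel A"
  by (simp add: measure_def emeasure_unit_leb)

interpretation unit_leb: finite_measure unit_leb
  by (rule finite_measureI) (simp add: emeasure_unit_leb)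

lemma mu_space [simp]: "mu {0..1} = 1"
  by (simp add: measure_unit_leb)

lemma mu_le_1: "mu A \<le> 1"
  using unit_leb.bounded_measure[of A] by simp

lemma measurable_id_unit_leb [measurable]: "(\<lambda>x. x) \<in> borel_measurable unit_leb"
  unfolding unit_leb_def by (rule measurable_restrict_space1) auto

lemma vimage_unit_leb:
  assumes "f \<in> borel_measurable unit_leb" "B \<in> sets borel"
  shows "{x \<in> {0..1}. f x \<in> B} \<in> sets unit_leb"
proof -
  have "f -` B \<inter> space unit_leb \<in> sets unit_leb" using assms by (rule measurable_sets)
  also have "f -` B \<inter> space unit_leb = {x \<in> {0..1}. f x \<in> B}" by auto
  finally show ?thesis .
qed

lemma measurable_to_unit_leb:
  "f \<in> measurable M unit_leb \<longleftrightarrow> f \<in> borel_measurable M \<and> f \<in> space M \<rightarrow> {0..1}"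
  unfolding unit_leb_def by (subst measurable_restrict_space2_iff) auto

lemma integrable_unit_leb_bounded:
  assumes "f \<in> borel_measurable unit_leb" "\<And>x. x \<in> {0..1} \<Longrightarrow> \<bar>f x\<bar> \<le> (C :: real)"
  shows "integrable unit_leb f"
  by (rule unit_leb.integrable_const_bound[where B=C]) (use assms in auto)

text \<open>
  Not necessarily invertible. The limit maps in the completeness proof are of this kind
  before they are known to be invertible.
\<close>

definition mpt :: "(real \<Rightarrow> real) set" where
  "mpt = {f \<in> measurable unit_leb unit_leb. distr unit_leb unit_leb f = unit_leb}"

lemma mptD:
  assumes "f \<in> mpt"
  shows "f \<in> measurable unit_leb unit_leb" "f \<in> borel_measurable unit_leb"
    "distr unit_leb unit_leb f = unit_leb" "\<And>x. 0 \<le> x \<Longrightarrow> x \<le> 1 \<Longrightarrow> 0 \<le> f x \<and> f x \<le> 1"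
  using assms unfolding mpt_def measurable_to_unit_leb by auto

lemma mpt_range: "f \<in> mpt \<Longrightarrow> x \<in> {0..1} \<Longrightarrow> f x \<in> {0..1}"
  using mptD(4) by auto

lemma inv_mpt_imp_mpt: "T \<in> inv_mpt \<Longrightarrow> T \<in> mpt"
  by (auto simp: inv_mpt_def mpt_def)

lemma mpt_id [simp]: "(\<lambda>x. x) \<in> mpt"
  unfolding mpt_def by (auto simp: measurable_to_unit_leb distr_id)

lemma mpt_comp:
  assumes "f \<in> mpt" "g \<in> mpt"
  shows "(\<lambda>x. f (g x)) \<in> mpt"
proof -
  note f = mptD[OF assms(1)] and g = mptD[OF assms(2)]
  have "distr unit_leb unit_leb (f \<circ> g) = distr (distr unit_leb unit_leb g) unit_leb f"
    by (rule distr_distr[symmetric]) (use f g in auto)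
  then show ?thesis unfolding mpt_def using f g
    by (auto simp: o_def intro: measurable_compose)
qed

lemma mpt_integral:
  assumes "f \<in> mpt" "g \<in> borel_measurable unit_leb"
  shows "(\<integral>x. g (f x) \<partial>unit_leb) = (\<integral>x. g x \<partial>unit_leb :: real)"
  using integral_distr[of f unit_leb unit_leb g] mptD[OF assms(1)] assms(2) by simp

lemma mpt_vimage:
  assumes "f \<in> mpt" "B \<in> sets unit_leb"
  shows "{x \<in> {0..1}. f x \<in> B} \<in> sets unit_leb" "mu {x \<in> {0..1}. f x \<in> B} = mu B"
proof -
  have "f -` B \<inter> space unit_leb = {x \<in> {0..1}. f x \<in> B}" by auto
  then show "{x \<in> {0..1}. f x \<in> B} \<in> sets unit_leb" "mu {x \<in> {0..1}. f x \<in> B} = mu B"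
    using measure_distr[of f unit_leb unit_leb B] mptD[OF assms(1)] assms(2)
      measurable_sets[of f unit_leb unit_leb B] by auto
qed

lemma mpt_AE:
  assumes "f \<in> mpt" "AE x in unit_leb. P x"
  shows "AE x in unit_leb. P (f x)"
proof -
  have "AE x in distr unit_leb unit_leb f. P x" using assms(2) unfolding mptD(3)[OF assms(1)] .
  then show ?thesis using mptD(1)[OF assms(1)] by (rule AE_distrD[rotated])
qed

section \<open>Composition is continuous in the \<open>L\<^sup>1\<close> distance\<close>

definition L1_dist :: "(real \<Rightarrow> real) \<Rightarrow> (real \<Rightarrow> real) \<Rightarrow> real" where
  "L1_dist S T = (\<integral>x. \<bar>S x - T x\<bar> \<partial>unit_leb)"

lemma L1_dist_nonneg [simp]: "L1_dist S T \<ge> 0"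
  by (simp add: L1_dist_def)

lemma L1_dist_commute: "L1_dist S T = L1_dist T S"
  by (simp add: L1_dist_def abs_minus_commute)

lemma mpt_diff_integrable:
  assumes "S \<in> measurable unit_leb unit_leb" "T \<in> measurable unit_leb unit_leb"
  shows "integrable unit_leb (\<lambda>x. \<bar>S x - T x\<bar>)"
proof (rule integrable_unit_leb_bounded)
  have [measurable]: "S \<in> borel_measurable unit_leb" "T \<in> borel_measurable unit_leb"
    using assms by (auto simp: measurable_to_unit_leb)
  show "(\<lambda>x. \<bar>S x - T x\<bar>) \<in> borel_measurable unit_leb" by measurable
  fix x :: real assume "x \<in> {0..1}"
  then have "S x \<in> {0..1}" "T x \<in> {0..1}" using assms by (auto simp: measurable_to_unit_leb)
  then show "\<bar>\<bar>S x - T x\<bar>\<bar> \<le> 1" by (auto simp: abs_if)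
qed

lemma L1_dist_triangle:
  assumes "R \<in> measurable unit_leb unit_leb" "S \<in> measurable unit_leb unit_leb" "T \<in> measurable unit_leb unit_leb"
  shows "L1_dist R T \<le> L1_dist R S + L1_dist S T"
proof -
  have "L1_dist R T \<le> (\<integral>x. \<bar>R x - S x\<bar> + \<bar>S x - T x\<bar> \<partial>unit_leb)"
    unfolding L1_dist_def
    by (intro integral_mono mpt_diff_integrable assms Bochner_Integration.integrable_add) auto
  also have "\<dots> = L1_dist R S + L1_dist S T" unfolding L1_dist_def
    by (intro Bochner_Integration.integral_add mpt_diff_integrable assms)
  finally show ?thesis .
qed

lemma L1_dist_0_imp_AE:
  assumes "S \<in> measurable unit_leb unit_leb" "T \<in> measurable unit_leb unit_leb" "L1_dist S T = 0"
  shows "AE x in unit_leb. S x = T x"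
proof -
  have "AE x in unit_leb. \<bar>S x - T x\<bar> = 0"
    using integral_nonneg_eq_0_iff_AE[OF mpt_diff_integrable[OF assms(1,2)]] assms(3)
    by (simp add: L1_dist_def)
  then show ?thesis by eventually_elim simp
qed

lemma L1_dist_cong_AE:
  assumes "S \<in> measurable unit_leb unit_leb" "S' \<in> measurable unit_leb unit_leb"
    "T \<in> measurable unit_leb unit_leb" "T' \<in> measurable unit_leb unit_leb"
    "AE x in unit_leb. S x = S' x" "AE x in unit_leb. T x = T' x"
  shows "L1_dist S T = L1_dist S' T'"
proof -
  have [measurable]: "S \<in> borel_measurable unit_leb" "T \<in> borel_measurable unit_leb"
    "S' \<in> borel_measurable unit_leb" "T' \<in> borel_measurable unit_leb"
    using assms by (auto simp: measurable_to_unit_leb)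
  show ?thesis unfolding L1_dist_def
    
  proof (rule integral_cong_AE)
    show "AE x in unit_leb. \<bar>S x - T x\<bar> = \<bar>S' x - T' x\<bar>" using assms(5,6) by eventually_elim simp
  qed measurable
qed

lemma sets_borel_atMost: "sets (borel :: real measure) = sigma_sets UNIV (range (\<lambda>a::real. {..a}))"
  by (subst borel_eq_atMost) (rule sets_measure_of, simp)

lemma atMost_generator: "Int_stable (range (\<lambda>a::real. {..a}))" "range (\<lambda>a::real. {..a}) \<subseteq> Pow UNIV"
  by (auto simp: Int_stable_def image_iff intro!: exI[of _ "min _ _"])

definition disagree :: "(real \<Rightarrow> real) \<Rightarrow> (real \<Rightarrow> real) \<Rightarrow> real set \<Rightarrow> real" where
  "disagree f g B = mu {x \<in> {0..1}. (f x \<in> B) \<noteq> (g x \<in> B)}"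

lemma disagree_sets:
  assumes [measurable]: "f \<in> borel_measurable unit_leb" "g \<in> borel_measurable unit_leb" "B \<in> sets borel"
  shows "{x \<in> {0..1}. (f x \<in> B) \<noteq> (g x \<in> B)} \<in> sets unit_leb"
proof -
  have "{x \<in> space unit_leb. (f x \<in> B) \<noteq> (g x \<in> B)} \<in> sets unit_leb" by measurable
  then show ?thesis by simp
qed

lemma mu_Icc_le: "\<eta> \<ge> 0 \<Longrightarrow> mu ({0..1} \<inter> {a-\<eta>..a+\<eta>}) \<le> 2 * \<eta>"
proof -
  assume e: "\<eta> \<ge> 0"
  have "mu ({0..1} \<inter> {a-\<eta>..a+\<eta>}) = measure lborel ({0..1} \<inter> {a-\<eta>..a+\<eta>})"
    by (intro measure_unit_leb) auto
  also have "\<dots> \<le> measure lborel {a-\<eta>..a+\<eta>}"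
    by (rule measure_mono_fmeasurable) (auto simp: fmeasurable_def emeasure_lborel_Icc_eq)
  finally show ?thesis using e by simp
qed

text \<open>
  If exactly one of \<open>f x\<close> and \<open>T x\<close> exceeds \<open>a\<close>, then either the two are \<open>\<eta>\<close> apart, which
  is rare by Markov's inequality, or \<open>T x\<close> is within \<open>\<eta>\<close> of \<open>a\<close>, which is rare since \<open>T\<close>
  preserves the measure. The map \<open>f\<close> is any measurable one, because the estimate also serves to
  show that \<open>L\<^sup>1\<close> limits preserve the measure.
\<close>

lemma disagree_atMost_le:
  assumes f: "f \<in> measurable unit_leb unit_leb" and T: "T \<in> mpt" and "\<eta> > 0"
  shows "disagree f T {..a} \<le> L1_dist f T / \<eta> + 2 * \<eta>"
proof -
  have [measurable]: "f \<in> borel_measurable unit_leb" "T \<in> borel_measurable unit_leb"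
    using f mptD(2)[OF T] by (auto simp: measurable_to_unit_leb)
  let ?X = "{x \<in> space unit_leb. \<eta> \<le> \<bar>f x - T x\<bar>}"
  let ?J = "{0..1} \<inter> {a-\<eta>..a+\<eta>}"
  let ?Y = "{x \<in> {0..1}. T x \<in> ?J}"
  have J: "?J \<in> sets unit_leb" by (auto simp: sets_unit_leb_iff)
  have X: "?X \<in> sets unit_leb" by measurable
  have "disagree f T {..a} \<le> mu (?X \<union> ?Y)"
    unfolding disagree_def
  proof (rule unit_leb.finite_measure_mono)
    show "?X \<union> ?Y \<in> sets unit_leb" using X mpt_vimage(1)[OF T J] by auto
    show "{x \<in> {0..1}. (f x \<in> {..a}) \<noteq> (T x \<in> {..a})} \<subseteq> ?X \<union> ?Y"
    proof
      fix x assume x: "x \<in> {x \<in> {0..1}. (f x \<in> {..a}) \<noteq> (T x \<in> {..a})}"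
      then have "T x \<in> {0..1}" using mpt_range[OF T] by blast
      then show "x \<in> ?X \<union> ?Y" using x by (cases "\<eta> \<le> \<bar>f x - T x\<bar>") auto
    qed
  qed
  also have "\<dots> \<le> mu ?X + mu ?Y"
    by (rule measure_Un_le) (use X mpt_vimage(1)[OF T J] in auto)
  also have "mu ?Y = mu ?J" using mpt_vimage(2)[OF T J] .
  also have "mu ?J \<le> 2 * \<eta>" using mu_Icc_le \<open>\<eta> > 0\<close> by simp
  also have "mu ?X \<le> L1_dist f T / \<eta>"
    unfolding L1_dist_def
    by (rule integral_Markov_inequality_measure[where A="{}"])
       (use \<open>\<eta> > 0\<close> mpt_diff_integrable[OF f mptD(1)[OF T]] in auto)
  finally show ?thesis by simp
qed

text \<open>
  The previous estimate extends from half-lines to Borel sets, because the tail of a disjoint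
  union has small preimages under all measure-preserving maps at once.
\<close>

lemma disagree_cont:
  assumes T: "T \<in> mpt" and B: "B \<in> sets borel"
  shows "\<forall>\<epsilon>>0. \<exists>\<delta>>0. \<forall>S\<in>mpt. L1_dist S T < \<delta> \<longrightarrow> disagree S T B < \<epsilon>"
proof -
  have "B \<in> sigma_sets UNIV (range (\<lambda>a::real. {..a}))" using B sets_borel_atMost by simp
  then show ?thesis
  proof (induction B rule: sigma_sets_induct_disjoint[OF atMost_generator, consumes 1, case_names basic empty compl union])
    case (basic B)
    then obtain a where a: "B = {..a}" by auto
    show ?case
    proof (intro allI impI)
      fix \<epsilon> :: real assume e: "\<epsilon> > 0"
      show "\<exists>\<delta>>0. \<forall>S\<in>mpt. L1_dist S T < \<delta> \<longrightarrow> disagree S T B < \<epsilon>"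
      proof (intro exI conjI ballI impI)
        \<comment> \<open>chosen for the use of the half-line estimate with \<open>\<eta> = \<epsilon>/4\<close>\<close>
        show "\<epsilon>\<^sup>2 / 8 > 0" using e by simp
        fix S assume S: "S \<in> mpt" "L1_dist S T < \<epsilon>\<^sup>2 / 8"
        have "disagree S T B \<le> L1_dist S T / (\<epsilon>/4) + 2 * (\<epsilon>/4)"
          unfolding a by (rule disagree_atMost_le) (use S T e mptD in auto)
        also have "\<dots> < (\<epsilon>\<^sup>2/8) / (\<epsilon>/4) + 2 * (\<epsilon>/4)"
          using e S by (intro add_strict_right_mono divide_strict_right_mono) auto
        also have "\<dots> = \<epsilon>" using e by (simp add: field_simps power2_eq_square)
        finally show "disagree S T B < \<epsilon>" .
      qed
    qed
  next
    case empty
    show ?case by (auto simp: disagree_def intro: exI[of _ 1])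
  next
    case (compl A)
    have "disagree S T (UNIV - A) = disagree S T A" for S by (simp add: disagree_def)
    then show ?case using compl by simp
  next
    case (union A)
    have Ab: "A i \<in> sets borel" for i using union(2) sets_borel_atMost by auto
    show ?case
    proof (intro allI impI)
      fix \<epsilon> :: real assume e: "\<epsilon> > 0"
      define U where "U n = {0..1} \<inter> (\<Union>i\<in>{n..}. A i)" for n
      have U: "U n \<in> sets unit_leb" for n using Ab by (auto simp: U_def sets_unit_leb_iff)
      have "(\<lambda>n. mu (U n)) \<longlonglongrightarrow> mu (\<Inter>n. U n)"
        by (rule unit_leb.finite_Lim_measure_decseq) (use U in \<open>auto simp: decseq_def U_def\<close>, metis le_trans atLeast_iff)
      moreover have "(\<Inter>n. U n) = {}"
      proof -
        have False if "x \<in> (\<Inter>n. U n)" for x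
        proof -
          from that have "x \<in> U 0" by blast
          then obtain i where i: "x \<in> A i" by (auto simp: U_def)
          have "x \<in> U (Suc i)" using that by blast
          then obtain j where j: "j \<ge> Suc i" "x \<in> A j" by (auto simp: U_def)
          then show False using union(1) i unfolding disjoint_family_on_def
            by (metis Int_iff UNIV_I empty_iff not_less_eq_eq order_refl)
        qed
        then show ?thesis by blast
      qed
      ultimately have "(\<lambda>n. mu (U n)) \<longlonglongrightarrow> 0" by simp
      then have "\<forall>\<^sub>F n in sequentially. mu (U n) < \<epsilon> / 4"
        by (rule order_tendstoD) (use e in auto)
      then obtain n where n: "mu (U n) < \<epsilon> / 4" by (auto simp: eventually_sequentially)
      have "\<exists>\<delta>. \<forall>i. \<delta> i > 0 \<and> (\<forall>S\<in>mpt. L1_dist S T < \<delta> i \<longrightarrow> disagree S T (A i) < \<epsilon> / (4 * (n + 1)))"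
        using union(3) e by (intro choice allI) (simp add: zero_less_divide_iff add_pos_nonneg)
      then obtain \<delta> where d: "\<And>i. \<delta> i > 0"
        "\<And>i S. S \<in> mpt \<Longrightarrow> L1_dist S T < \<delta> i \<Longrightarrow> disagree S T (A i) < \<epsilon> / (4 * (n + 1))" by blast
      show "\<exists>\<delta>>0. \<forall>S\<in>mpt. L1_dist S T < \<delta> \<longrightarrow> disagree S T (\<Union> (range A)) < \<epsilon>"
      proof (intro exI conjI ballI impI)
        show "Min (insert 1 (\<delta> ` {..<n})) > 0" using d by (subst Min_gr_iff) auto
        fix S assume S: "S \<in> mpt" "L1_dist S T < Min (insert 1 (\<delta> ` {..<n}))"
        have Si: "L1_dist S T < \<delta> i" if "i < n" for i
          using S(2) that by (subst (asm) Min_gr_iff) auto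
        let ?D = "\<lambda>i. {x \<in> {0..1}. (S x \<in> A i) \<noteq> (T x \<in> A i)}"
        let ?S = "{x \<in> {0..1}. S x \<in> U n}" and ?T = "{x \<in> {0..1}. T x \<in> U n}"
        note Sm = mptD[OF S(1)] and Tm = mptD[OF T]
        have D: "?D i \<in> sets unit_leb" for i by (rule disagree_sets) (use Ab Sm Tm in auto)
        have ST: "?S \<in> sets unit_leb" "?T \<in> sets unit_leb" using mpt_vimage U S T by auto
        have "disagree S T (\<Union> (range A)) \<le> mu ((\<Union>i<n. ?D i) \<union> (?S \<union> ?T))"
          unfolding disagree_def
        proof (rule unit_leb.finite_measure_mono)
          show "(\<Union>i<n. ?D i) \<union> (?S \<union> ?T) \<in> sets unit_leb" using D ST by blast
          show "{x \<in> {0..1}. (S x \<in> \<Union> (range A)) \<noteq> (T x \<in> \<Union> (range A))} \<subseteq> (\<Union>i<n. ?D i) \<union> (?S \<union> ?T)"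
          proof
            fix x assume "x \<in> {x \<in> {0..1}. (S x \<in> \<Union> (range A)) \<noteq> (T x \<in> \<Union> (range A))}"
            then have x: "0 \<le> x" "x \<le> 1" "(\<exists>i. S x \<in> A i) \<noteq> (\<exists>i. T x \<in> A i)" by auto
            then obtain i where i: "(S x \<in> A i) \<noteq> (T x \<in> A i)" by blast
            show "x \<in> (\<Union>i<n. ?D i) \<union> (?S \<union> ?T)"
            proof (cases "i < n")
              case True then show ?thesis using i x by auto
            next
              case False
              then show ?thesis using i x Sm(4)[OF x(1,2)] Tm(4)[OF x(1,2)] by (auto simp: U_def not_less)
            qed
          qed
        qed
        also have "\<dots> \<le> mu (\<Union>i<n. ?D i) + mu (?S \<union> ?T)"
          by (rule measure_Un_le) (use D ST in auto)
        also have "mu (?S \<union> ?T) \<le> mu ?S + mu ?T" by (rule measure_Un_le) (use ST in auto)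
        also have "mu ?S = mu (U n)" by (rule mpt_vimage) (use S U in auto)
        also have "mu ?T = mu (U n)" by (rule mpt_vimage) (use T U in auto)
        also have "mu (\<Union>i<n. ?D i) \<le> (\<Sum>i<n. mu (?D i))"
          by (rule measure_UNION_le) (use D in auto)
        also have "\<dots> \<le> (\<Sum>i<n. \<epsilon> / (4 * (n + 1)))"
          using d(2)[OF S(1) Si] by (intro sum_mono) (auto simp: disagree_def less_imp_le)
        also have "\<dots> = \<epsilon> * n / (4 * (n+1))" by simp
        also have "\<dots> \<le> \<epsilon> / 4" using e by (simp add: field_simps)
        finally show "disagree S T (\<Union> (range A)) < \<epsilon>" using n e by simp
      qed
    qed
  qed
qed

lemma L2_norm_nonneg [simp]: "L2_norm f \<ge> 0" by (simp add: L2_norm_def)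

lemma L2_comp_mpt:
  assumes "f \<in> L2" "T \<in> mpt"
  shows "(\<lambda>x. f (T x)) \<in> L2" "L2_norm (\<lambda>x. f (T x)) = L2_norm f"
proof -
  note T = mptD[OF assms(2)]
  have f: "f \<in> borel_measurable unit_leb" "integrable unit_leb (\<lambda>x. (f x)\<^sup>2)"
    using assms by (auto simp: L2_def)
  have "integrable unit_leb (\<lambda>x. (f (T x))\<^sup>2)"
    using integrable_distr[of T unit_leb unit_leb "\<lambda>x. (f x)\<^sup>2"] T f by simp
  then show "(\<lambda>x. f (T x)) \<in> L2"
    using T f by (auto simp: L2_def intro: measurable_compose)
  show "L2_norm (\<lambda>x. f (T x)) = L2_norm f"
    unfolding L2_norm_def using mpt_integral[OF assms(2), of "\<lambda>x. (f x)\<^sup>2"] f by simp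
qed

lemma L2_bounded:
  assumes "f \<in> borel_measurable unit_leb" "\<And>x. x \<in> {0..1} \<Longrightarrow> \<bar>f x\<bar> \<le> C"
  shows "f \<in> L2"
  unfolding L2_def using assms
  by (auto intro!: integrable_unit_leb_bounded[where C="C\<^sup>2"] simp: abs_le_square_iff[symmetric])
    (metis abs_ge_zero abs_of_nonneg atLeastAtMost_iff order_trans)

lemma L2_uminus_norm: "L2_norm (\<lambda>x. f x - g x) = L2_norm (\<lambda>x. g x - f x)"
  by (simp add: L2_norm_def power2_commute)

lemma L2_triangle_diff:
  assumes "f \<in> L2" "g \<in> L2" "h \<in> L2"
  shows "L2_norm (\<lambda>x. f x - h x) \<le> L2_norm (\<lambda>x. f x - g x) + L2_norm (\<lambda>x. g x - h x)"
  using L2_triangle[OF L2_diff[OF assms(1,2)] L2_diff[OF assms(2,3)]] by simp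

lemma L2_simple_approx:
  assumes f: "f \<in> L2" and e: "\<epsilon> > 0"
  shows "\<exists>F. simple_function unit_leb F \<and> L2_norm (\<lambda>x. f x - F x) < \<epsilon>"
proof -
  have [measurable]: "f \<in> borel_measurable unit_leb" and fi: "integrable unit_leb (\<lambda>x. (f x)\<^sup>2)"
    using f by (auto simp: L2_def)
  obtain F where F0: "\<forall>i. simple_function unit_leb (F i)"
    "\<forall>x\<in>{0..1}. (\<lambda>i. F i x) \<longlonglongrightarrow> f x" "\<forall>i. \<forall>x\<in>{0..1}. dist (F i x) 0 \<le> 2 * dist (f x) 0"
    using borel_measurable_implies_sequence_metric[of f unit_leb 0, unfolded space_unit_leb]
      \<open>f \<in> borel_measurable unit_leb\<close> by (elim meta_impE exE conjE) (assumption, rule that)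
  have F: "simple_function unit_leb (F i)" "x \<in> {0..1} \<Longrightarrow> (\<lambda>i. F i x) \<longlonglongrightarrow> f x"
    "x \<in> {0..1} \<Longrightarrow> \<bar>F i x\<bar> \<le> 2 * \<bar>f x\<bar>" for i x using F0 by (auto simp: dist_real_def)
  have [measurable]: "F i \<in> borel_measurable unit_leb" for i
    using F(1) by (rule borel_measurable_simple_function)
  have "(\<lambda>i. \<integral>x. (f x - F i x)\<^sup>2 \<partial>unit_leb) \<longlonglongrightarrow> (\<integral>x. 0 \<partial>unit_leb)"
  proof (rule integral_dominated_convergence[where w="\<lambda>x. 9 * (f x)\<^sup>2"])
    show "integrable unit_leb (\<lambda>x. 9 * (f x)\<^sup>2)" using fi by simp
    show "AE x in unit_leb. (\<lambda>i. (f x - F i x)\<^sup>2) \<longlonglongrightarrow> 0"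
    proof (rule AE_I2)
      fix x assume "x \<in> space unit_leb"
      then have "(\<lambda>i. (f x - F i x)\<^sup>2) \<longlonglongrightarrow> (f x - f x)\<^sup>2"
        using F(2) by (intro tendsto_intros) auto
      then show "(\<lambda>i. (f x - F i x)\<^sup>2) \<longlonglongrightarrow> 0" by simp
    qed
    show "AE x in unit_leb. norm ((f x - F i x)\<^sup>2) \<le> 9 * (f x)\<^sup>2" for i
    proof (rule AE_I2)
      fix x assume "x \<in> space unit_leb"
      then have "\<bar>F i x\<bar> \<le> 2 * \<bar>f x\<bar>" using F(3) by simp
      then have "\<bar>f x - F i x\<bar> \<le> \<bar>3 * f x\<bar>" by linarith
      then have "(f x - F i x)\<^sup>2 \<le> (3 * f x)\<^sup>2" by (simp only: abs_le_square_iff)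
      then show "norm ((f x - F i x)\<^sup>2) \<le> 9 * (f x)\<^sup>2" by (simp add: power_mult_distrib)
    qed
  qed measurable
  then have "(\<lambda>i. L2_norm (\<lambda>x. f x - F i x)) \<longlonglongrightarrow> sqrt 0"
    unfolding L2_norm_def by (intro tendsto_real_sqrt) simp
  then have "\<forall>\<^sub>F i in sequentially. L2_norm (\<lambda>x. f x - F i x) < \<epsilon>"
    by (intro order_tendstoD) (use e in auto)
  then show ?thesis using F(1) by (auto simp: eventually_sequentially)
qed


text \<open>
  The values of a simple function at \<open>S x\<close> and \<open>T x\<close> differ only if some level set contains one
  of these points and not the other, and there are finitely many level sets.
\<close>

lemma L2_comp_cont_simple:
  assumes F: "simple_function unit_leb F" and T: "T \<in> mpt" and e: "\<epsilon> > 0"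
  shows "\<exists>\<delta>>0. \<forall>S\<in>mpt. L1_dist S T < \<delta> \<longrightarrow> L2_norm (\<lambda>x. F (S x) - F (T x)) < (\<epsilon>::real)"
proof -
  have [measurable]: "F \<in> borel_measurable unit_leb"
    using F by (rule borel_measurable_simple_function)
  define V where "V = F ` {0..1}"
  have V: "finite V" using F by (simp add: simple_function_def V_def)
  obtain C where C: "C > 0" "\<And>v. v \<in> V \<Longrightarrow> \<bar>v\<bar> \<le> C"
  proof -
    have "bounded V" using V by (rule finite_imp_bounded)
    then show ?thesis using that unfolding bounded_pos by auto
  qed
  define B where "B v = {y \<in> {0..1}. F y = v}" for v
  have B: "B v \<in> sets borel" for v
  proof -
    have "B v \<in> sets unit_leb"
      using vimage_unit_leb[OF \<open>F \<in> borel_measurable unit_leb\<close>, of "{v}"] by (simp add: B_def)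
    then show ?thesis unfolding sets_unit_leb_iff by blast
  qed
  define \<gamma> where "\<gamma> = \<epsilon>\<^sup>2 / (4 * C\<^sup>2 * (card V + 1))"
  have g: "\<gamma> > 0" using e C by (simp add: \<gamma>_def zero_less_divide_iff add_nonneg_pos)
  have "\<exists>\<delta>. \<forall>v. \<delta> v > 0 \<and> (\<forall>S\<in>mpt. L1_dist S T < \<delta> v \<longrightarrow> disagree S T (B v) < \<gamma>)"
    using disagree_cont[OF T B] g by (intro choice allI) blast
  then obtain \<delta> where d: "\<And>v. \<delta> v > 0"
    "\<And>v S. S \<in> mpt \<Longrightarrow> L1_dist S T < \<delta> v \<Longrightarrow> disagree S T (B v) < \<gamma>" by blast
  show ?thesis
  proof (intro exI conjI ballI impI)
    show "Min (insert 1 (\<delta> ` V)) > 0" using d V by (subst Min_gr_iff) auto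
    fix S assume S: "S \<in> mpt" "L1_dist S T < Min (insert 1 (\<delta> ` V))"
    have Si: "L1_dist S T < \<delta> v" if "v \<in> V" for v
      using S(2) that V by (subst (asm) Min_gr_iff) auto
    note Sm = mptD[OF S(1)] and Tm = mptD[OF T]
    let ?D = "\<lambda>v. {x \<in> {0..1}. (S x \<in> B v) \<noteq> (T x \<in> B v)}"
    have D: "?D v \<in> sets unit_leb" for v by (rule disagree_sets) (use B Sm Tm in auto)
    have [measurable]: "(\<lambda>x. F (S x)) \<in> borel_measurable unit_leb" "(\<lambda>x. F (T x)) \<in> borel_measurable unit_leb"
      by (rule measurable_compose[OF Sm(1) \<open>F \<in> _\<close>], rule measurable_compose[OF Tm(1) \<open>F \<in> _\<close>])
    have le: "(F (S x) - F (T x))\<^sup>2 \<le> 4 * C\<^sup>2 * (\<Sum>v\<in>V. indicator (?D v) x)" if x: "x \<in> {0..1}" for x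
    proof (cases "F (S x) = F (T x)")
      case True
      then show ?thesis by (auto intro!: mult_nonneg_nonneg sum_nonneg)
    next
      case False
      have Sx: "S x \<in> {0..1}" "T x \<in> {0..1}" using x mpt_range S T by blast+
      have "\<bar>F (S x)\<bar> \<le> C" "\<bar>F (T x)\<bar> \<le> C" using C(2) Sx by (auto simp: V_def)
      then have "\<bar>F (S x) - F (T x)\<bar> \<le> \<bar>2 * C\<bar>" by linarith
      then have "(F (S x) - F (T x))\<^sup>2 \<le> (2 * C)\<^sup>2" by (simp only: abs_le_square_iff)
      also have "\<dots> = 4 * C\<^sup>2 * 1" by (simp add: power_mult_distrib)
      also have "\<dots> \<le> 4 * C\<^sup>2 * (\<Sum>v\<in>V. indicator (?D v) x)"
      proof (rule mult_left_mono)
        have "(1::real) = indicator (?D (F (S x))) x" using False x Sx by (auto simp: B_def)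
        also have "\<dots> \<le> (\<Sum>v\<in>V. indicator (?D v) x)"
          by (rule member_le_sum[where f="\<lambda>v. indicator (?D v) x" and i="F (S x)"])
            (use V Sx in \<open>auto simp: V_def\<close>)
        finally show "(1::real) \<le> (\<Sum>v\<in>V. indicator (?D v) x)" .
      qed simp
      finally show ?thesis .
    qed
    have intb: "integrable unit_leb (\<lambda>x. 4 * C\<^sup>2 * (\<Sum>v\<in>V. indicator (?D v) x :: real))"
      using D by (intro integrable_mult_right Bochner_Integration.integrable_sum) (auto simp: unit_leb.emeasure_finite less_top[symmetric])
    have "(\<integral>x. (F (S x) - F (T x))\<^sup>2 \<partial>unit_leb) \<le> (\<integral>x. 4 * C\<^sup>2 * (\<Sum>v\<in>V. indicator (?D v) x) \<partial>unit_leb)"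
    proof (rule integral_mono_AE)
      show "integrable unit_leb (\<lambda>x. (F (S x) - F (T x))\<^sup>2)"
        by (rule Bochner_Integration.integrable_bound[OF intb], measurable)
          (use le in \<open>auto intro!: AE_I2 intro: order_trans[OF _ abs_ge_self]\<close>)
    qed (use le intb in auto)
    also have "\<dots> = 4 * C\<^sup>2 * (\<Sum>v\<in>V. disagree S T (B v))"
    proof -
      have "(\<integral>x. (\<Sum>v\<in>V. indicator (?D v) x) \<partial>unit_leb) = (\<Sum>v\<in>V. \<integral>x. indicator (?D v) x \<partial>unit_leb :: real)"
        using D by (intro Bochner_Integration.integral_sum) (auto simp: unit_leb.emeasure_finite less_top[symmetric])
      also have "\<dots> = (\<Sum>v\<in>V. disagree S T (B v))"
      proof (rule sum.cong[OF refl])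
        fix v
        have "?D v \<inter> space unit_leb = ?D v" by auto
        then show "(\<integral>x. indicator (?D v) x \<partial>unit_leb) = disagree S T (B v)"
          unfolding disagree_def by (simp only: Bochner_Integration.integral_indicator)
      qed
      finally show ?thesis by simp
    qed
    also have "\<dots> \<le> 4 * C\<^sup>2 * (\<Sum>v\<in>V. \<gamma>)"
      by (rule mult_left_mono, rule sum_mono, rule less_imp_le, rule d(2)[OF S(1) Si]) auto
    also have "\<dots> = \<epsilon>\<^sup>2 * (card V / (card V + 1))"
    proof -
      have "C\<^sup>2 \<noteq> 0" using C(1) by simp
      then show ?thesis unfolding \<gamma>_def sum_constant
        by (simp only: times_divide_eq_right times_divide_eq_left) (simp add: mult.commute mult.left_commute)
    qed
    also have "\<dots> < \<epsilon>\<^sup>2 * 1" using e by (intro mult_strict_left_mono) auto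
    finally show "L2_norm (\<lambda>x. F (S x) - F (T x)) < \<epsilon>"
      unfolding L2_norm_def using e by (intro real_less_lsqrt) auto
  qed
qed

text \<open>
  This is the comparison of topologies: closeness in \<open>L\<^sup>1\<close> forces closeness of \<open>f \<circ> S\<close> and
  \<open>f \<circ> T\<close> in \<open>L\<^sup>2\<close> for every square-integrable \<open>f\<close>. The error of a simple approximation of \<open>f\<close> has
  the same norm after composition with \<open>S\<close> or \<open>T\<close>.
\<close>

lemma L2_comp_cont:
  assumes f: "f \<in> L2" and T: "T \<in> mpt" and e: "\<epsilon> > 0"
  shows "\<exists>\<delta>>0. \<forall>S\<in>mpt. L1_dist S T < \<delta> \<longrightarrow> L2_norm (\<lambda>x. f (S x) - f (T x)) < \<epsilon>"
proof -
  obtain F where F: "simple_function unit_leb F" "L2_norm (\<lambda>x. f x - F x) < \<epsilon> / 3"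
    using L2_simple_approx[OF f, of "\<epsilon>/3"] e by auto
  obtain \<delta> where d: "\<delta> > 0" "\<And>S. S \<in> mpt \<Longrightarrow> L1_dist S T < \<delta> \<Longrightarrow> L2_norm (\<lambda>x. F (S x) - F (T x)) < \<epsilon> / 3"
    using L2_comp_cont_simple[OF F(1) T, of "\<epsilon>/3"] e by auto
  have "F \<in> borel_measurable unit_leb" using F(1) by (rule borel_measurable_simple_function)
  moreover have "bounded (F ` {0..1})" using F(1) by (intro finite_imp_bounded) (simp add: simple_function_def)
  ultimately have FL: "F \<in> L2"
    unfolding bounded_iff using L2_bounded[of F] by (metis image_eqI real_norm_def)
  have "L2_norm (\<lambda>x. f (S x) - f (T x)) < \<epsilon>" if S: "S \<in> mpt" "L1_dist S T < \<delta>" for S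
  proof -
    note L = L2_comp_mpt(1)[OF f S(1)] L2_comp_mpt(1)[OF f T] L2_comp_mpt(1)[OF FL S(1)] L2_comp_mpt(1)[OF FL T]
    have "L2_norm (\<lambda>x. f (S x) - f (T x)) \<le> L2_norm (\<lambda>x. f (S x) - F (S x)) + L2_norm (\<lambda>x. F (S x) - f (T x))"
      by (intro L2_triangle_diff L)
    moreover have "L2_norm (\<lambda>x. F (S x) - f (T x)) \<le> L2_norm (\<lambda>x. F (S x) - F (T x)) + L2_norm (\<lambda>x. F (T x) - f (T x))"
      by (intro L2_triangle_diff L)
    moreover have "L2_norm (\<lambda>x. f (S x) - F (S x)) = L2_norm (\<lambda>x. f x - F x)"
      using L2_comp_mpt(2)[OF L2_diff[OF f FL] S(1)] by simp
    moreover have "L2_norm (\<lambda>x. F (T x) - f (T x)) = L2_norm (\<lambda>x. f x - F x)"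
      using L2_comp_mpt(2)[OF L2_diff[OF f FL] T] by (subst L2_uminus_norm) simp
    ultimately show ?thesis using F(2) d(2)[OF S] by linarith
  qed
  then show ?thesis using d(1) by blast
qed

lemma L1_le_L2:
  assumes "f \<in> L2" shows "integrable unit_leb f" "(\<integral>x. \<bar>f x\<bar> \<partial>unit_leb) \<le> L2_norm f"
proof -
  have f: "f \<in> borel_measurable unit_leb" "integrable unit_leb (\<lambda>x. (f x)\<^sup>2)"
    using assms by (auto simp: L2_def)
  have one: "(\<lambda>x. 1) \<in> L2" by (auto simp: L2_def)
  show i: "integrable unit_leb f" using L2_mult_integrable[OF assms one] by simp
  have q: "(\<integral>x. \<bar>f x\<bar> \<partial>unit_leb) \<le> (s + (L2_norm f)\<^sup>2 / s) / 2" if s: "s > 0" for s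
  proof -
    have "(\<integral>x. \<bar>f x\<bar> \<partial>unit_leb) \<le> (\<integral>x. (s + (f x)\<^sup>2 / s) / 2 \<partial>unit_leb)"
    proof (rule integral_mono)
      show "integrable unit_leb (\<lambda>x. (s + (f x)\<^sup>2 / s) / 2)" using f by simp
      fix x
      have "0 \<le> (\<bar>f x\<bar> - s)\<^sup>2" by simp
      then have "2 * s * \<bar>f x\<bar> \<le> s\<^sup>2 + (f x)\<^sup>2" by (simp add: power2_diff algebra_simps)
      then show "\<bar>f x\<bar> \<le> (s + (f x)\<^sup>2 / s) / 2" using s by (simp add: field_simps power2_eq_square)
    qed (use i in simp)
    also have "\<dots> = (s + (\<integral>x. (f x)\<^sup>2 \<partial>unit_leb) / s) / 2" using f by simp
    finally show ?thesis by (simp add: L2_norm_def)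
  qed
  show "(\<integral>x. \<bar>f x\<bar> \<partial>unit_leb) \<le> L2_norm f"
  proof (cases "L2_norm f = 0")
    case True
    have "(\<integral>x. \<bar>f x\<bar> \<partial>unit_leb) \<le> s" if "s > 0" for s using q[OF that] True that by simp
    then have "(\<integral>x. \<bar>f x\<bar> \<partial>unit_leb) \<le> 0" by (meson dense_ge)
    then show ?thesis using True by simp
  next
    case False
    then have "L2_norm f > 0" using L2_norm_nonneg[of f] by linarith
    from q[OF this] show ?thesis using False by (simp add: power2_eq_square)
  qed
qed

section \<open>Completeness\<close>

lemma mpt_null_sets:
  assumes "f \<in> mpt" "N \<in> null_sets unit_leb"
  shows "{x \<in> {0..1}. f x \<in> N} \<in> null_sets unit_leb"
proof -
  have "mu N = 0" using assms(2) by (simp add: measure_def null_setsD1)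
  then show ?thesis
    using mpt_vimage[OF assms(1), of N] assms(2)
    by (auto simp: null_sets_def unit_leb.emeasure_eq_measure)
qed

lemma inv_mptD:
  assumes "T \<in> inv_mpt"
  shows "bij_betw T {0..1} {0..1}" "T \<in> measurable unit_leb unit_leb"
    "inv_into {0..1} T \<in> measurable unit_leb unit_leb"
    "\<And>x. x \<in> {0..1} \<Longrightarrow> inv_into {0..1} T (T x) = x" "\<And>x. x \<in> {0..1} \<Longrightarrow> T (inv_into {0..1} T x) = x"
proof -
  show b: "bij_betw T {0..1} {0..1}" and "T \<in> measurable unit_leb unit_leb"
    "inv_into {0..1} T \<in> measurable unit_leb unit_leb" using assms by (auto simp: inv_mpt_def)
  show "inv_into {0..1} T (T x) = x" "T (inv_into {0..1} T x) = x" if "x \<in> {0..1}" for x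
    using b that by (auto intro: bij_betw_inv_into_left bij_betw_inv_into_right)
qed

lemma inv_mpt_inverse_mpt:
  assumes "T \<in> inv_mpt" shows "inv_into {0..1} T \<in> mpt"
proof -
  let ?R = "inv_into {0..1} T"
  note T = inv_mptD[OF assms]
  have "distr unit_leb unit_leb ?R = distr (distr unit_leb unit_leb T) unit_leb ?R"
    using mptD(3)[OF inv_mpt_imp_mpt[OF assms]] by simp
  also have "\<dots> = distr unit_leb unit_leb (?R \<circ> T)"
    by (rule distr_distr) (use T in auto)
  also have "\<dots> = distr unit_leb unit_leb (\<lambda>x. x)"
    by (rule distr_cong) (use T(4) in auto)
  also have "\<dots> = unit_leb" by (rule mptD(3)[OF mpt_id])
  finally show ?thesis using T(3) by (simp add: mpt_def)
qed

text \<open>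
  Two maps that are inverse to each other almost everywhere are exactly inverse outside a null
  set. Closing this null set under preimages by both maps keeps it null and makes its complement
  invariant, so that the identity can be used on the exceptional set. In this way no measurable
  bijection between two different null sets has to be found.
\<close>

lemma inverse_point_realization:
  assumes f: "f \<in> mpt" and g: "g \<in> mpt"
    and gf: "AE x in unit_leb. g (f x) = x" and fg: "AE x in unit_leb. f (g x) = x"
  obtains T where "T \<in> inv_mpt" "AE x in unit_leb. T x = f x" "AE x in unit_leb. inv_into {0..1} T x = g x"
proof -
  obtain N1 where N1: "N1 \<in> null_sets unit_leb" "{x \<in> space unit_leb. g (f x) \<noteq> x} \<subseteq> N1"
    using gf by (auto simp: eventually_ae_filter)
  obtain N2 where N2: "N2 \<in> null_sets unit_leb" "{x \<in> space unit_leb. f (g x) \<noteq> x} \<subseteq> N2"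
    using fg by (auto simp: eventually_ae_filter)
  \<comment> \<open>The exceptional set, and the points that reach it in at most \<open>i\<close> steps of either map.\<close>
  define bad where "bad = rec_nat (N1 \<union> N2) (\<lambda>_ B. B \<union> {x \<in> {0..1}. f x \<in> B} \<union> {x \<in> {0..1}. g x \<in> B})"
  have bad_Suc: "bad (Suc i) = bad i \<union> {x \<in> {0..1}. f x \<in> bad i} \<union> {x \<in> {0..1}. g x \<in> bad i}" for i
    by (simp add: bad_def)
  have "bad i \<in> null_sets unit_leb" for i
  proof (induction i)
    case 0
    show ?case using N1 N2 by (simp add: bad_def null_sets.Un)
  next
    case (Suc i)
    then show ?case unfolding bad_Suc using mpt_null_sets[OF f Suc] mpt_null_sets[OF g Suc]
      by (intro null_sets.Un) auto
  qed
  then have N: "(\<Union>i. bad i) \<in> null_sets unit_leb" by (intro null_sets_UN) auto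
  define Z where "Z = {0..1} - (\<Union>i. bad i)"
  have Z: "f x \<in> Z" "g x \<in> Z" "g (f x) = x" "f (g x) = x" if "x \<in> Z" for x
  proof -
    have x: "x \<in> {0..1}" "\<And>i. x \<notin> bad i" using that by (auto simp: Z_def)
    have "f x \<notin> bad i" "g x \<notin> bad i" for i using x(1) x(2)[of "Suc i"] by (auto simp: bad_Suc)
    then show "f x \<in> Z" "g x \<in> Z" using x mpt_range f g unfolding Z_def by blast+
    have "x \<notin> N1 \<union> N2" using x(2)[of 0] by (simp add: bad_def)
    then show "g (f x) = x" "f (g x) = x" using N1 N2 x by auto
  qed
  have Z01: "x \<in> Z \<Longrightarrow> x \<in> {0..1}" for x by (simp add: Z_def)
  have Zs: "Z \<inter> space unit_leb \<in> sets unit_leb"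
    using N sets.compl_sets[of "\<Union>i. bad i" unit_leb] by (simp add: Z_def Int_absorb2 null_setsD2)
  define T where "T x = (if x \<in> Z then f x else x)" for x
  define R where "R x = (if x \<in> Z then g x else x)" for x
  have TR: "R (T x) = x" "T (R x) = x" for x using Z by (auto simp: T_def R_def)
  have T01: "T x \<in> {0..1}" "R x \<in> {0..1}" if "x \<in> {0..1}" for x
    using that mpt_range[OF f] mpt_range[OF g] unfolding T_def R_def by auto
  have bij: "bij_betw T {0..1} {0..1}"
    by (rule bij_betw_byWitness[where f'=R]) (use TR T01 in auto)
  have inv: "inv_into {0..1} T x = R x" if "x \<in> {0..1}" for x
    using bij_betw_imp_inj_on[OF bij] T01(2)[OF that] TR(2) by (rule inv_into_f_eq)
  have Tm: "T \<in> measurable unit_leb unit_leb" and Rm: "R \<in> measurable unit_leb unit_leb"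
    unfolding T_def R_def
    by (intro measurable_If_set Zs mptD(1) f g mpt_id)+
  have AEZ: "AE x in unit_leb. x \<in> Z"
    using AE_not_in[OF N] AE_space by eventually_elim (simp add: Z_def)
  have AET: "AE x in unit_leb. T x = f x" and AER: "AE x in unit_leb. R x = g x"
    using AEZ by (eventually_elim, simp add: T_def R_def)+
  show ?thesis
  proof
    show "T \<in> inv_mpt" unfolding inv_mpt_def
    proof (intro CollectI conjI bij Tm)
      show "inv_into {0..1} T \<in> measurable unit_leb unit_leb"
        using Rm by (subst measurable_cong[of _ _ R]) (use inv in auto)
      have "distr unit_leb unit_leb T = distr unit_leb unit_leb f"
        by (rule distr_cong_AE) (use AET Tm mptD[OF f] in auto)
      then show "distr unit_leb unit_leb T = unit_leb" using mptD[OF f] by simp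
    qed
    show "AE x in unit_leb. T x = f x" by (rule AET)
    show "AE x in unit_leb. inv_into {0..1} T x = g x"
      using AER AE_space by eventually_elim (simp add: inv)
  qed
qed

lemma mptI_atMost:
  assumes f: "f \<in> measurable unit_leb unit_leb"
    and le: "\<And>a. mu {x \<in> {0..1}. f x \<le> a} = mu ({0..1} \<inter> {..a})"
  shows "f \<in> mpt"
proof -
  have fb: "f \<in> borel_measurable unit_leb" using f by (simp add: measurable_to_unit_leb)
  have eq: "distr unit_leb borel f = distr unit_leb borel (\<lambda>x. x)"
  proof (rule measure_eqI_generator_eq[where E="range atMost" and \<Omega>=UNIV and A="\<lambda>i. {..real i}"])
    show "Int_stable (range (atMost :: real \<Rightarrow> _))"
      by (auto simp: Int_stable_def image_iff intro!: exI[of _ "min _ _"])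
    fix X :: "real set" assume "X \<in> range atMost"
    then obtain a where X: "X = {..a}" by auto
    have "f -` {..a} \<inter> space unit_leb = {x \<in> {0..1}. f x \<le> a}"
      "(\<lambda>x. x) -` {..a} \<inter> space unit_leb = {0..1} \<inter> {..a}" by auto
    then show "emeasure (distr unit_leb borel f) X = emeasure (distr unit_leb borel (\<lambda>x. x)) X"
      unfolding X using fb le[of a]
      by (simp add: emeasure_distr unit_leb.emeasure_eq_measure min.commute)
  next
    show "sets (distr unit_leb borel f) = sigma_sets UNIV (range atMost)"
      "sets (distr unit_leb borel (\<lambda>x. x)) = sigma_sets UNIV (range (atMost :: real \<Rightarrow> _))"
      using sets_borel_atMost by simp_all
    show "(\<Union>i. {..real i}) = UNIV" by (auto intro: real_arch_simple)
    show "emeasure (distr unit_leb borel f) {..real i} \<noteq> \<infinity>" for i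
      using fb by (simp add: emeasure_distr unit_leb.emeasure_eq_measure)
  qed auto
  have "distr unit_leb unit_leb f = unit_leb"
  proof (rule measure_eqI)
    fix A assume "A \<in> sets (distr unit_leb unit_leb f)"
    then have A: "A \<in> sets unit_leb" by simp
    then have Ab: "A \<in> sets borel" "A \<subseteq> {0..1}" by (simp_all add: sets_unit_leb_iff)
    have "emeasure (distr unit_leb unit_leb f) A = emeasure (distr unit_leb borel f) A"
      using A Ab f fb by (simp add: emeasure_distr)
    also have "\<dots> = emeasure unit_leb ((\<lambda>x. x) -` A \<inter> space unit_leb)"
      unfolding eq by (rule emeasure_distr) (use Ab in auto)
    also have "(\<lambda>x. x) -` A \<inter> space unit_leb = A" using Ab by auto
    finally show "emeasure (distr unit_leb unit_leb f) A = emeasure unit_leb A" .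
  qed simp
  then show ?thesis using f by (simp add: mpt_def)
qed

text \<open>
  The distribution function of the limit is the limit of the distribution functions, all of
  which are the same.
\<close>

lemma mpt_L1_closed:
  assumes T: "\<And>n. T n \<in> mpt" and f: "f \<in> measurable unit_leb unit_leb"
    and lim: "(\<lambda>n. L1_dist (T n) f) \<longlonglongrightarrow> 0"
  shows "f \<in> mpt"
proof (rule mptI_atMost[OF f])
  fix a :: real
  have fb: "f \<in> borel_measurable unit_leb" using f by (simp add: measurable_to_unit_leb)
  let ?I = "{0..1} \<inter> {..a}"
  have I: "?I \<in> sets unit_leb" by (auto simp: sets_unit_leb_iff)
  let ?F = "{x \<in> {0..1}. f x \<le> a}"
  have F: "?F \<in> sets unit_leb" using vimage_unit_leb[OF fb, of "{..a}"] by simp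
  have "\<bar>mu ?F - mu ?I\<bar> \<le> e" if e: "e > 0" for e
  proof -
    have "\<forall>\<^sub>F n in sequentially. L1_dist (T n) f < e\<^sup>2 / 8"
      by (rule order_tendstoD[OF lim]) (use e in simp)
    then obtain n where n: "L1_dist (T n) f < e\<^sup>2 / 8" by (auto simp: eventually_sequentially)
    let ?G = "{x \<in> {0..1}. T n x \<le> a}"
    have eqG: "?G = {x \<in> {0..1}. T n x \<in> ?I}" using mpt_range[OF T] by auto
    have G: "?G \<in> sets unit_leb" "mu ?G = mu ?I" using mpt_vimage[OF T I] eqG by auto
    let ?D = "{x \<in> {0..1}. (f x \<in> {..a}) \<noteq> (T n x \<in> {..a})}"
    have D: "?D \<in> sets unit_leb" by (rule disagree_sets[OF fb mptD(2)[OF T]]) simp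
    have "mu ?F \<le> mu (?G \<union> ?D)" "mu ?G \<le> mu (?F \<union> ?D)"
      by (rule unit_leb.finite_measure_mono; use D G F in auto)+
    moreover have "mu (?G \<union> ?D) \<le> mu ?G + mu ?D" "mu (?F \<union> ?D) \<le> mu ?F + mu ?D"
      by (rule measure_Un_le; use D G F in auto)+
    moreover have "mu ?D \<le> L1_dist f (T n) / (e/4) + 2 * (e/4)"
      using disagree_atMost_le[OF f T, of "e/4" n a] e by (simp add: disagree_def)
    moreover have "L1_dist f (T n) / (e/4) \<le> (e\<^sup>2/8) / (e/4)"
      by (rule divide_right_mono) (use n e in \<open>auto simp: L1_dist_commute\<close>)
    moreover have "(e\<^sup>2/8) / (e/4) = e / 2" using e by (simp add: power2_eq_square)
    ultimately show ?thesis using G(2) by linarith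
  qed
  then have "\<bar>mu ?F - mu ?I\<bar> \<le> 0" by (meson dense_ge)
  then show "mu ?F = mu ?I" by simp
qed

text \<open>
  A subsequence converges almost everywhere; by dominated convergence its limit is an \<open>L\<^sup>1\<close>
  limit, and the Cauchy property extends this to the whole sequence.
\<close>

lemma mpt_L1_complete:
  assumes T: "\<And>n. T n \<in> mpt"
    and C: "\<And>e. e > 0 \<Longrightarrow> \<exists>N. \<forall>i\<ge>N. \<forall>j\<ge>N. L1_dist (T i) (T j) < e"
  obtains f where "f \<in> mpt" "(\<lambda>n. L1_dist (T n) f) \<longlonglongrightarrow> 0"
proof -
  have [measurable]: "T n \<in> borel_measurable unit_leb" for n using mptD(2)[OF T] .
  have rng: "T n x \<in> {0..1}" if "x \<in> {0..1}" for n x using mpt_range[OF T that] .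
  have "integrable unit_leb (T n)" for n
    by (rule integrable_unit_leb_bounded[where C=1]) (use rng in auto)
  then obtain r where r: "strict_mono r" "AE x in unit_leb. Cauchy (\<lambda>i. T (r i) x)"
    using cauchy_L1_AE_cauchy_subseq[of unit_leb T] C unfolding L1_dist_def real_norm_def by blast
  \<comment> \<open>The truncation only matters where the subsequence diverges: it keeps the values in \<open>[0,1]\<close>.\<close>
  define f where "f x = min 1 (max 0 (lim (\<lambda>i. T (r i) x)))" for x
  have [measurable]: "f \<in> borel_measurable unit_leb" unfolding f_def by measurable
  have f [measurable]: "f \<in> measurable unit_leb unit_leb" unfolding measurable_to_unit_leb by (auto simp: f_def)
  have lim: "AE x in unit_leb. (\<lambda>i. T (r i) x) \<longlonglongrightarrow> f x"
    using r(2) AE_space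
  proof eventually_elim
    case (elim x)
    then have L: "(\<lambda>i. T (r i) x) \<longlonglongrightarrow> lim (\<lambda>i. T (r i) x)"
      by (simp add: Cauchy_convergent_iff convergent_LIMSEQ_iff)
    have "0 \<le> lim (\<lambda>i. T (r i) x)" "lim (\<lambda>i. T (r i) x) \<le> 1"
      using elim(2) rng by (auto intro!: LIMSEQ_le_const[OF L] LIMSEQ_le_const2[OF L])
    then show ?case using L by (simp add: f_def)
  qed
  have sub: "(\<lambda>i. L1_dist (T (r i)) f) \<longlonglongrightarrow> (\<integral>x. 0 \<partial>unit_leb)"
    unfolding L1_dist_def
  proof (rule integral_dominated_convergence[where w="\<lambda>x. 1"])
    show "AE x in unit_leb. (\<lambda>i. \<bar>T (r i) x - f x\<bar>) \<longlonglongrightarrow> 0"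
      using lim by eventually_elim (simp add: LIM_zero tendsto_rabs_zero)
    show "AE x in unit_leb. norm \<bar>T (r i) x - f x\<bar> \<le> 1" for i
    proof (rule AE_I2)
      fix x assume "x \<in> space unit_leb"
      then have "T (r i) x \<in> {0..1}" "f x \<in> {0..1}" using rng by (auto simp: f_def)
      then show "norm \<bar>T (r i) x - f x\<bar> \<le> 1" by (auto simp: abs_le_iff)
    qed
  qed simp_all
  have lim': "(\<lambda>n. L1_dist (T n) f) \<longlonglongrightarrow> 0"
  proof (rule LIMSEQ_I)
    fix e :: real assume e: "e > 0"
    obtain N where N: "\<forall>i\<ge>N. \<forall>j\<ge>N. L1_dist (T i) (T j) < e/2" using C[OF half_gt_zero[OF e]] by blast
    have "\<forall>\<^sub>F i in sequentially. L1_dist (T (r i)) f < e/2"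
      using order_tendstoD(2)[OF sub, of "e/2"] e by simp
    then obtain i0 where i0: "\<And>i. i \<ge> i0 \<Longrightarrow> L1_dist (T (r i)) f < e/2"
      by (auto simp: eventually_sequentially)
    define i where "i = max i0 N"
    have ri: "r i \<ge> N" using seq_suble[OF r(1), of i] by (simp add: i_def)
    have "L1_dist (T n) f < e" if "n \<ge> N" for n
    proof -
      have "L1_dist (T n) f \<le> L1_dist (T n) (T (r i)) + L1_dist (T (r i)) f"
        by (intro L1_dist_triangle f mptD(1)[OF T])
      then show ?thesis using N ri that i0[of i] by (fastforce simp: i_def)
    qed
    then show "\<exists>no. \<forall>n\<ge>no. norm (L1_dist (T n) f - 0) < e" by auto
  qed
  show ?thesis by (rule that[OF mpt_L1_closed[OF T f lim'] lim'])
qed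

lemma mpt_in_L2: "f \<in> mpt \<Longrightarrow> f \<in> L2"
  by (rule L2_bounded[where C=1]) (use mptD(2) mpt_range in fastforce)+

lemma mpt_comp_L1_cont:
  assumes f: "f \<in> mpt" and T: "T \<in> mpt" and e: "\<epsilon> > 0"
  shows "\<exists>\<delta>>0. \<forall>S\<in>mpt. L1_dist S T < \<delta> \<longrightarrow> L1_dist (\<lambda>x. f (S x)) (\<lambda>x. f (T x)) < \<epsilon>"
proof -
  obtain \<delta> where d: "\<delta> > 0" "\<And>S. S \<in> mpt \<Longrightarrow> L1_dist S T < \<delta> \<Longrightarrow> L2_norm (\<lambda>x. f (S x) - f (T x)) < \<epsilon>"
    using L2_comp_cont[OF mpt_in_L2[OF f] T e] by blast
  have "L1_dist (\<lambda>x. f (S x)) (\<lambda>x. f (T x)) \<le> L2_norm (\<lambda>x. f (S x) - f (T x))" if "S \<in> mpt" for S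
    unfolding L1_dist_def
    using L1_le_L2(2)[OF L2_diff[OF L2_comp_mpt(1)[OF mpt_in_L2[OF f] that] L2_comp_mpt(1)[OF mpt_in_L2[OF f] T]]] .
  then show ?thesis using d by (meson order_le_less_trans)
qed

lemma L1_dist_comp_right:
  assumes "f \<in> mpt" "g \<in> mpt" "h \<in> mpt"
  shows "L1_dist (\<lambda>x. f (h x)) (\<lambda>x. g (h x)) = L1_dist f g"
  unfolding L1_dist_def
  using mpt_integral[OF assms(3), of "\<lambda>x. \<bar>f x - g x\<bar>"] mptD(2)[OF assms(1)] mptD(2)[OF assms(2)] by simp

text \<open>
  Compare \<open>f \<circ> g\<close> with \<open>f \<circ> R n\<close> by continuity of composition, and \<open>f \<circ> R n\<close> with
  \<open>T n \<circ> R n\<close>, which is the identity, by invariance of the distance under \<open>R n\<close>.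
\<close>

lemma L1_limit_right_inverse:
  assumes T: "\<And>n. T n \<in> mpt" and R: "\<And>n. R n \<in> mpt" and TR: "\<And>n x. x \<in> {0..1} \<Longrightarrow> T n (R n x) = x"
    and f: "f \<in> mpt" and g: "g \<in> mpt"
    and Tf: "(\<lambda>n. L1_dist (T n) f) \<longlonglongrightarrow> 0" and Rg: "(\<lambda>n. L1_dist (R n) g) \<longlonglongrightarrow> 0"
  shows "AE x in unit_leb. f (g x) = x"
proof -
  have fg: "(\<lambda>x. f (g x)) \<in> mpt" by (rule mpt_comp[OF f g])
  have "L1_dist (\<lambda>x. f (g x)) (\<lambda>x. x) \<le> e" if e: "e > 0" for e
  proof -
    obtain \<delta> where d: "\<delta> > 0" "\<And>S. S \<in> mpt \<Longrightarrow> L1_dist S g < \<delta> \<Longrightarrow> L1_dist (\<lambda>x. f (S x)) (\<lambda>x. f (g x)) < e/2"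
      using mpt_comp_L1_cont[OF f g, of "e/2"] e by auto
    have "\<forall>\<^sub>F n in sequentially. L1_dist (R n) g < \<delta> \<and> L1_dist (T n) f < e/2"
      using order_tendstoD(2)[OF Rg d(1)] order_tendstoD(2)[OF Tf, of "e/2"] e
      by (intro eventually_conj) auto
    then obtain n where n: "L1_dist (R n) g < \<delta>" "L1_dist (T n) f < e/2"
      by (auto simp: eventually_sequentially)
    have "L1_dist (\<lambda>x. f (g x)) (\<lambda>x. x) \<le> L1_dist (\<lambda>x. f (g x)) (\<lambda>x. f (R n x)) + L1_dist (\<lambda>x. f (R n x)) (\<lambda>x. x)"
      by (rule L1_dist_triangle[OF mptD(1)[OF fg] mptD(1)[OF mpt_comp[OF f R]] mptD(1)[OF mpt_id]])
    also have "L1_dist (\<lambda>x. f (R n x)) (\<lambda>x. x) = L1_dist (\<lambda>x. f (R n x)) (\<lambda>x. T n (R n x))"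
      unfolding L1_dist_def by (rule Bochner_Integration.integral_cong) (use TR in auto)
    also have "\<dots> = L1_dist f (T n)" by (rule L1_dist_comp_right[OF f T R])
    finally show ?thesis using d(2)[OF R n(1)] n(2) by (simp add: L1_dist_commute)
  qed
  then have "L1_dist (\<lambda>x. f (g x)) (\<lambda>x. x) \<le> 0" by (meson dense_ge)
  then have "L1_dist (\<lambda>x. f (g x)) (\<lambda>x. x) = 0" using L1_dist_nonneg by (meson order_antisym)
  then show ?thesis by (rule L1_dist_0_imp_AE[OF mptD(1)[OF fg] mptD(1)[OF mpt_id]])
qed

text \<open>
  The one-sided distance also gives the weak topology, but it is not complete: a limit of
  invertible maps need not be invertible. The second summand repairs this.
\<close>

definition two_sided_dist :: "(real \<Rightarrow> real) \<Rightarrow> (real \<Rightarrow> real) \<Rightarrow> real" where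
  "two_sided_dist S T = L1_dist S T + L1_dist (inv_into {0..1} S) (inv_into {0..1} T)"

lemma inv_mpt_complete:
  assumes T: "\<And>n. T n \<in> inv_mpt"
    and C: "\<And>e. e > 0 \<Longrightarrow> \<exists>N. \<forall>i\<ge>N. \<forall>j\<ge>N. two_sided_dist (T i) (T j) < e"
  obtains S where "S \<in> inv_mpt" "(\<lambda>n. two_sided_dist (T n) S) \<longlonglongrightarrow> 0"
proof -
  let ?R = "\<lambda>n. inv_into {0..1} (T n)"
  note Tm = inv_mpt_imp_mpt[OF T] and Rm = inv_mpt_inverse_mpt[OF T]
  have le: "L1_dist (T i) (T j) \<le> two_sided_dist (T i) (T j)" "L1_dist (?R i) (?R j) \<le> two_sided_dist (T i) (T j)" for i j
    by (auto simp: two_sided_dist_def)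
  have CT: "\<exists>N. \<forall>i\<ge>N. \<forall>j\<ge>N. L1_dist (T i) (T j) < e"
    and CR: "\<exists>N. \<forall>i\<ge>N. \<forall>j\<ge>N. L1_dist (?R i) (?R j) < e" if "e > 0" for e
    using C[OF that] by (meson le order_le_less_trans)+
  obtain f where f: "f \<in> mpt" "(\<lambda>n. L1_dist (T n) f) \<longlonglongrightarrow> 0"
    by (rule mpt_L1_complete[OF Tm CT])
  obtain g where g: "g \<in> mpt" "(\<lambda>n. L1_dist (?R n) g) \<longlonglongrightarrow> 0"
    by (rule mpt_L1_complete[OF Rm CR])
  have "AE x in unit_leb. f (g x) = x" "AE x in unit_leb. g (f x) = x"
    using L1_limit_right_inverse[OF Tm Rm _ f(1) g(1) f(2) g(2)]
      L1_limit_right_inverse[OF Rm Tm _ g(1) f(1) g(2) f(2)] inv_mptD(4,5)[OF T] by auto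
  then obtain S where S: "S \<in> inv_mpt" "AE x in unit_leb. S x = f x" "AE x in unit_leb. inv_into {0..1} S x = g x"
    using inverse_point_realization[OF f(1) g(1)] by metis
  have "L1_dist (T n) S = L1_dist (T n) f" "L1_dist (?R n) (inv_into {0..1} S) = L1_dist (?R n) g" for n
    by (rule L1_dist_cong_AE; use S Tm Rm f g inv_mptD inv_mpt_imp_mpt inv_mpt_inverse_mpt mptD(1) in auto)+
  then have "(\<lambda>n. two_sided_dist (T n) S) \<longlonglongrightarrow> 0 + 0"
    unfolding two_sided_dist_def using f g by (intro tendsto_add) auto
  then show ?thesis using that S(1) by simp
qed

section \<open>A complete metric finer than the weak topology\<close>

lemma aut_class_eq_iff:
  assumes "S \<in> inv_mpt" "T \<in> inv_mpt"
  shows "aut_class S = aut_class T \<longleftrightarrow> (AE x in unit_leb. S x = T x)"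
  using eq_equiv_class_iff[OF equiv_ae_eq assms] assms by (simp add: ae_eq_def)

definition aut_rep :: "(real \<Rightarrow> real) set \<Rightarrow> real \<Rightarrow> real" where
  "aut_rep C = (SOME T. T \<in> inv_mpt \<and> aut_class T = C)"

lemma aut_rep:
  assumes "C \<in> Aut" shows "aut_rep C \<in> inv_mpt" "aut_class (aut_rep C) = C"
proof -
  have "\<exists>T. T \<in> inv_mpt \<and> aut_class T = C" using assms by (auto simp: Aut_eq)
  from someI_ex[OF this] show "aut_rep C \<in> inv_mpt" "aut_class (aut_rep C) = C"
    unfolding aut_rep_def by blast+
qed

lemma aut_class_in_Aut: "T \<in> inv_mpt \<Longrightarrow> aut_class T \<in> Aut" by (auto simp: Aut_eq)

lemma aut_rep_AE:
  assumes "T \<in> inv_mpt" shows "AE x in unit_leb. aut_rep (aut_class T) x = T x"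
  using aut_rep[OF aut_class_in_Aut[OF assms]] assms by (subst aut_class_eq_iff[symmetric]) auto

text \<open>
  The points where the inverses differ are the images under \<open>S\<close> of points where \<open>S\<close> and \<open>T\<close>
  differ.
\<close>

lemma inverse_AE_cong:
  assumes S: "S \<in> inv_mpt" and T: "T \<in> inv_mpt" and AE: "AE x in unit_leb. S x = T x"
  shows "AE x in unit_leb. inv_into {0..1} S x = inv_into {0..1} T x"
proof -
  let ?R = "inv_into {0..1} S"
  have "AE x in unit_leb. S (?R x) = T (?R x)"
    by (rule mpt_AE[OF inv_mpt_inverse_mpt[OF S] AE])
  then show ?thesis using AE_space
  proof eventually_elim
    case (elim x)
    then have x: "x \<in> {0..1}" by simp
    have R: "?R x \<in> {0..1}" by (rule mpt_range[OF inv_mpt_inverse_mpt[OF S] x])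
    have "T (?R x) = x" using elim(1) inv_mptD(5)[OF S x] by simp
    then show ?case using inv_mptD(4)[OF T R] by simp
  qed
qed

lemma two_sided_dist_cong:
  assumes "S \<in> inv_mpt" "S' \<in> inv_mpt" "T \<in> inv_mpt" "T' \<in> inv_mpt"
    "AE x in unit_leb. S x = S' x" "AE x in unit_leb. T x = T' x"
  shows "two_sided_dist S T = two_sided_dist S' T'"
  unfolding two_sided_dist_def
  by (intro arg_cong2[where f="(+)"] L1_dist_cong_AE inverse_AE_cong inv_mptD assms)

definition aut_dist :: "(real \<Rightarrow> real) set \<Rightarrow> (real \<Rightarrow> real) set \<Rightarrow> real" where
  "aut_dist C D = two_sided_dist (aut_rep C) (aut_rep D)"

lemma aut_dist_class:
  assumes "S \<in> inv_mpt" "T \<in> inv_mpt"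
  shows "aut_dist (aut_class S) (aut_class T) = two_sided_dist S T"
  unfolding aut_dist_def
  by (intro two_sided_dist_cong aut_rep_AE aut_rep aut_class_in_Aut assms)

lemma two_sided_dist_triangle:
  assumes "R \<in> inv_mpt" "S \<in> inv_mpt" "T \<in> inv_mpt"
  shows "two_sided_dist R T \<le> two_sided_dist R S + two_sided_dist S T"
  unfolding two_sided_dist_def
  using L1_dist_triangle[of R S T] L1_dist_triangle[of "inv_into {0..1} R" "inv_into {0..1} S" "inv_into {0..1} T"]
    inv_mptD(2,3)[OF assms(1)] inv_mptD(2,3)[OF assms(2)] inv_mptD(2,3)[OF assms(3)] by linarith

interpretation aut: Metric_space Aut aut_dist
proof
  show "0 \<le> aut_dist C D" for C D by (simp add: aut_dist_def two_sided_dist_def)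
  show "aut_dist C D = aut_dist D C" for C D
    by (simp add: aut_dist_def two_sided_dist_def L1_dist_commute)
  show "aut_dist C D = 0 \<longleftrightarrow> C = D" if C: "C \<in> Aut" and D: "D \<in> Aut" for C D
  proof
    assume "aut_dist C D = 0"
    then have "L1_dist (aut_rep C) (aut_rep D) = 0"
      unfolding aut_dist_def two_sided_dist_def
      using L1_dist_nonneg[of "aut_rep C" "aut_rep D"]
        L1_dist_nonneg[of "inv_into {0..1} (aut_rep C)" "inv_into {0..1} (aut_rep D)"] by linarith
    then have "AE x in unit_leb. aut_rep C x = aut_rep D x"
      by (rule L1_dist_0_imp_AE[OF inv_mptD(2)[OF aut_rep(1)[OF C]] inv_mptD(2)[OF aut_rep(1)[OF D]]])
    then show "C = D" using aut_class_eq_iff[OF aut_rep(1)[OF C] aut_rep(1)[OF D]] aut_rep C D by simp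
  next
    assume "C = D"
    then show "aut_dist C D = 0" by (simp add: aut_dist_def two_sided_dist_def L1_dist_def)
  qed
  show "aut_dist C E \<le> aut_dist C D + aut_dist D E" if "C \<in> Aut" "D \<in> Aut" "E \<in> Aut" for C D E
    unfolding aut_dist_def by (intro two_sided_dist_triangle aut_rep that)
qed

lemma aut_mcomplete: "aut.mcomplete"
  unfolding aut.mcomplete_def
proof (intro allI impI)
  fix C assume C: "aut.MCauchy C"
  then have CA: "C n \<in> Aut" for n by (auto simp: aut.MCauchy_def)
  have "\<exists>N. \<forall>i\<ge>N. \<forall>j\<ge>N. two_sided_dist (aut_rep (C i)) (aut_rep (C j)) < e" if "e > 0" for e
  proof -
    obtain N where "\<forall>n n'. N \<le> n \<longrightarrow> N \<le> n' \<longrightarrow> aut_dist (C n) (C n') < e"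
      using C \<open>e > 0\<close> unfolding aut.MCauchy_def by meson
    then show ?thesis unfolding aut_dist_def by blast
  qed
  then obtain S where S: "S \<in> inv_mpt" "(\<lambda>n. two_sided_dist (aut_rep (C n)) S) \<longlonglongrightarrow> 0"
    using inv_mpt_complete[of "\<lambda>n. aut_rep (C n)"] aut_rep(1)[OF CA] by blast
  have eq: "aut_dist (C n) (aut_class S) = two_sided_dist (aut_rep (C n)) S" for n
    using aut_dist_class[OF aut_rep(1)[OF CA] S(1)] aut_rep(2)[OF CA] by simp
  have "limitin aut.mtopology C (aut_class S) sequentially"
    unfolding aut.limitin_metric eq
    using S(2) aut_class_in_Aut[OF S(1)] CA order_tendstoD(2)[OF S(2)] by auto
  then show "\<exists>D. limitin aut.mtopology C D sequentially" by blast
qed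

text \<open>
  A subbasic weak neighbourhood restricts \<open>f \<circ> T\<close> for a single \<open>f\<close>. By continuity of composition
  it contains a metric ball around each of its points.
\<close>

lemma weak_open_imp_metric_open:
  assumes "openin weak_topology U" shows "openin aut.mtopology U"
proof -
  let ?B = "{aut_class ` {S \<in> inv_mpt. L2_norm (\<lambda>x. f (S x) - f (T x)) < e} | T f e.
        T \<in> inv_mpt \<and> f \<in> L2 \<and> e > 0}"
  have "generate_topology_on ?B U"
    using assms unfolding weak_topology_def openin_topology_generated_by_iff .
  then show ?thesis
  proof (rule generate_topology_on_coarsest[OF istopology_openin, rotated])
    fix V assume "V \<in> ?B"
    then obtain T f e where V: "T \<in> inv_mpt" "f \<in> L2" "e > 0"
      "V = aut_class ` {S \<in> inv_mpt. L2_norm (\<lambda>x. f (S x) - f (T x)) < e}" by blast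
    show "openin aut.mtopology V"
      unfolding aut.openin_mtopology
    proof (intro conjI allI impI)
      show "V \<subseteq> Aut" using V aut_class_in_Aut by auto
      fix C assume "C \<in> V"
      then obtain S where S: "S \<in> inv_mpt" "L2_norm (\<lambda>x. f (S x) - f (T x)) < e" "C = aut_class S"
        using V(4) by blast
      obtain \<delta> where d: "\<delta> > 0" "\<And>R. R \<in> mpt \<Longrightarrow> L1_dist R S < \<delta> \<Longrightarrow>
          L2_norm (\<lambda>x. f (R x) - f (S x)) < e - L2_norm (\<lambda>x. f (S x) - f (T x))"
        using L2_comp_cont[OF V(2) inv_mpt_imp_mpt[OF S(1)], of "e - L2_norm (\<lambda>x. f (S x) - f (T x))"] S(2) by auto
      show "\<exists>r>0. aut.mball C r \<subseteq> V"
      proof (intro exI conjI subsetI)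
        show "\<delta> > 0" by (rule d(1))
        fix D assume "D \<in> aut.mball C \<delta>"
        then have D: "D \<in> Aut" "aut_dist C D < \<delta>" by auto
        define R where "R = aut_rep D"
        have R: "R \<in> inv_mpt" "aut_class R = D" using aut_rep[OF D(1)] by (auto simp: R_def)
        have "L1_dist R S \<le> two_sided_dist S R"
          by (simp add: two_sided_dist_def L1_dist_commute)
        also have "\<dots> < \<delta>" using D(2) aut_dist_class[OF S(1) R(1)] R(2) S(3) by simp
        finally have "L2_norm (\<lambda>x. f (R x) - f (S x)) < e - L2_norm (\<lambda>x. f (S x) - f (T x))"
          by (rule d(2)[OF inv_mpt_imp_mpt[OF R(1)]])
        moreover have "L2_norm (\<lambda>x. f (R x) - f (T x)) \<le>
            L2_norm (\<lambda>x. f (R x) - f (S x)) + L2_norm (\<lambda>x. f (S x) - f (T x))"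
          by (rule L2_triangle_diff[OF L2_comp[OF V(2) R(1)] L2_comp[OF V(2) S(1)] L2_comp[OF V(2) V(1)]])
        ultimately have "L2_norm (\<lambda>x. f (R x) - f (T x)) < e" by linarith
        then show "D \<in> V" using V(4) R by blast
      qed
    qed
  qed
qed

text \<open>
  Baire's theorem for the metric topology; since weakly open sets are open in the
  metric, a set that is dense for the metric is weakly dense.
\<close>

lemma weak_dense_Inter:
  fixes G :: "nat \<Rightarrow> (real \<Rightarrow> real) set set"
  assumes op: "\<And>k. openin weak_topology (G k)"
    and dense: "\<And>k T \<epsilon>. T \<in> inv_mpt \<Longrightarrow> \<epsilon> > 0 \<Longrightarrow> \<exists>S\<in>inv_mpt. aut_class S \<in> G k \<and> two_sided_dist T S < \<epsilon>"
  shows "weak_topology closure_of (\<Inter>k. G k) = Aut"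
proof -
  have "aut.mtopology closure_of (\<Inter>(range G)) = Aut"
  proof (rule aut.metric_Baire_category[OF aut_mcomplete])
    fix U assume "U \<in> range G"
    then obtain k where U: "U = G k" by blast
    have "aut.mtopology closure_of (G k) = Aut"
      unfolding aut.metric_closure_of
    proof (intro equalityI subsetI)
      fix C assume C: "C \<in> Aut"
      have "\<exists>D\<in>G k. D \<in> aut.mball C r" if r: "r > 0" for r
      proof -
        obtain S where S: "S \<in> inv_mpt" "aut_class S \<in> G k" "two_sided_dist (aut_rep C) S < r"
          using dense[OF aut_rep(1)[OF C] r] by blast
        have "aut_dist C (aut_class S) = two_sided_dist (aut_rep C) S"
          using aut_dist_class[OF aut_rep(1)[OF C] S(1)] aut_rep(2)[OF C] by simp
        then show ?thesis using S C aut_class_in_Aut[OF S(1)] by auto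
      qed
      then show "C \<in> {x \<in> Aut. \<forall>r>0. \<exists>y\<in>G k. y \<in> aut.mball x r}" using C by blast
    qed auto
    then show "openin aut.mtopology U \<and> aut.mtopology closure_of U = Aut"
      using weak_open_imp_metric_open[OF op] U by blast
  qed simp
  then have cl: "C \<in> aut.mtopology closure_of (\<Inter>(range G))" if "C \<in> Aut" for C using that by simp
  have *: "\<exists>D. D \<in> \<Inter>(range G) \<and> D \<in> U" if "C \<in> Aut" "C \<in> U" "openin weak_topology U" for C U
    using cl[OF that(1)] that(2) weak_open_imp_metric_open[OF that(3)] unfolding in_closure_of by blast
  show ?thesis
  proof (intro equalityI subsetI)
    fix C assume "C \<in> weak_topology closure_of (\<Inter>k. G k)"
    then show "C \<in> Aut" by (simp add: in_closure_of)
  next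
    fix C assume "C \<in> Aut"
    then show "C \<in> weak_topology closure_of (\<Inter>k. G k)"
      unfolding in_closure_of using * by simp
  qed
qed

section \<open>Simultaneous inhomogeneous approximation\<close>

text \<open>
  The kernel is nonnegative, peaked at the integers, and a finite sum of exponentials whose
  constant term is the central binomial coefficient divided by \<open>4\<^sup>R\<close>.
\<close>

lemma cos_pi_power_expansion:
  "complex_of_real (cos (pi * x) ^ (2 * R)) =
     (\<Sum>k\<le>2*R. of_nat (2*R choose k) / 4 ^ R * cis (2 * pi * ((real k - real R) * x)))"
proof -
  have "complex_of_real (cos (pi * x)) = (cis (pi * x) + cis (- (pi * x))) / 2"
    by (simp add: complex_eq_iff)
  then have "complex_of_real (cos (pi * x) ^ (2 * R)) = (cis (pi * x) + cis (- (pi * x))) ^ (2 * R) / 4 ^ R"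
    by (simp only: of_real_power power_divide) (simp add: power_mult)
  also have "(cis (pi * x) + cis (- (pi * x))) ^ (2 * R) =
      (\<Sum>k\<le>2*R. of_nat (2*R choose k) * cis (pi * x) ^ k * cis (- (pi * x)) ^ (2 * R - k))"
    by (rule binomial_ring)
  also have "\<dots> = (\<Sum>k\<le>2*R. of_nat (2*R choose k) * cis (2 * pi * ((real k - real R) * x)))"
  proof (rule sum.cong[OF refl])
    fix k assume k: "k \<in> {..2*R}"
    then have "real k * (pi * x) + real (2 * R - k) * (- (pi * x)) = 2 * pi * ((real k - real R) * x)"
      by (simp add: of_nat_diff algebra_simps)
    moreover have "cis (pi * x) ^ k * cis (- (pi * x)) ^ (2 * R - k) =
        cis (real k * (pi * x) + real (2 * R - k) * (- (pi * x)))"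
      unfolding Complex.DeMoivre cis_mult ..
    ultimately have "cis (pi * x) ^ k * cis (- (pi * x)) ^ (2 * R - k) = cis (2 * pi * ((real k - real R) * x))"
      by (simp only:)
    then show "of_nat (2*R choose k) * cis (pi * x) ^ k * cis (- (pi * x)) ^ (2 * R - k)
        = of_nat (2*R choose k) * cis (2 * pi * ((real k - real R) * x))"
      by (simp add: mult.assoc)
  qed
  finally show ?thesis by (simp add: sum_divide_distrib)
qed

lemma cos_pi_power_small:
  assumes "0 < \<eta>" "\<eta> \<le> 1/2" and far: "\<And>h :: int. \<eta> \<le> \<bar>x - of_int h\<bar>"
  shows "cos (pi * x) ^ (2 * R) \<le> (cos (pi * \<eta>) ^ 2) ^ R"
proof -
  define y where "y = x - of_int (round x)"
  have y: "\<bar>y\<bar> \<le> 1/2" "\<eta> \<le> \<bar>y\<bar>"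
    using of_int_round_abs_le[of x] far[of "round x"] by (auto simp: y_def abs_minus_commute)
  have sin0: "sin (pi * of_int (round x)) = (0::real)"
    by (simp add: mult.commute[of pi] sin_times_pi_eq_0)
  have "pi * x = pi * y + pi * of_int (round x)" by (simp add: y_def algebra_simps)
  then have "cos (pi * x) ^ 2 = (cos (pi * y) * cos (pi * of_int (round x)) - sin (pi * y) * sin (pi * of_int (round x))) ^ 2"
    by (simp only: cos_add)
  also have "\<dots> = (cos (pi * y) * cos (pi * of_int (round x))) ^ 2"
    by (simp only: sin0 mult_zero_right diff_zero)
  also have "\<dots> = cos (pi * y) ^ 2"
  proof -
    have "cos (pi * of_int (round x)) ^ 2 = (1::real)" using sin0 sin_cos_squared_add[of "pi * of_int (round x)"] by simp
    then show ?thesis by (simp add: power_mult_distrib)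
  qed
  also have "cos (pi * y) = cos (pi * \<bar>y\<bar>)" by (simp add: abs_if)
  also have "cos (pi * \<bar>y\<bar>) ^ 2 \<le> cos (pi * \<eta>) ^ 2"
  proof (rule power_mono)
    show "cos (pi * \<bar>y\<bar>) \<le> cos (pi * \<eta>)"
      using y assms by (intro cos_monotone_0_pi_le) (auto simp: field_simps)
    show "0 \<le> cos (pi * \<bar>y\<bar>)" using y by (intro cos_ge_zero) (auto simp: field_simps intro: order_trans[of _ 0])
  qed
  finally have "(cos (pi * x) ^ 2) ^ R \<le> (cos (pi * \<eta>) ^ 2) ^ R" by (rule power_mono) simp
  then show ?thesis by (simp add: power_mult)
qed

lemma integral_cis:
  fixes s a b :: real
  assumes "a \<le> b" "s \<noteq> 0"
  shows "((\<lambda>t. cis (2 * pi * (s * t))) has_integral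
     (cis (2 * pi * (s * b)) - cis (2 * pi * (s * a))) / (2 * pi * s * \<i>)) {a..b}"
proof -
  define c :: complex where "c = 2 * pi * s * \<i>"
  have c: "c \<noteq> 0" using assms by (simp add: c_def)
  have "((\<lambda>t. cis (2 * pi * (s * t)) / c) has_vector_derivative cis (2 * pi * (s * t))) (at t within {a..b})" for t
  proof -
    have "((\<lambda>t. exp (of_real t * c) / c) has_vector_derivative exp (of_real t * c)) (at t within {a..b})"
      by (rule has_vector_derivative_real_field[where f="\<lambda>z. exp (z * c) / c"])
        (use c in \<open>auto intro!: derivative_eq_intros\<close>)
    moreover have "exp (of_real t * c) = cis (2 * pi * (s * t))" for t
      by (simp add: cis_conv_exp c_def mult_ac)
    ultimately show ?thesis by simp
  qed
  then have "((\<lambda>t. cis (2 * pi * (s * t))) has_integral (cis (2 * pi * (s * b)) / c - cis (2 * pi * (s * a)) / c)) {a..b}"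
    by (intro fundamental_theorem_of_calculus assms)
  then show ?thesis by (simp add: c_def diff_divide_distrib)
qed

lemma integral_cis_tendsto_0:
  fixes s :: "nat \<Rightarrow> int" and a b :: real
  assumes ab: "a \<le> b" and s: "filterlim (\<lambda>n. \<bar>s n\<bar>) at_top sequentially"
  shows "(\<lambda>n. integral {a..b} (\<lambda>t. cis (2 * pi * (of_int (s n) * t)))) \<longlonglongrightarrow> 0"
proof (rule Lim_null_comparison)
  have ev: "\<forall>\<^sub>F n in sequentially. \<bar>s n\<bar> > 0"
    using s[unfolded filterlim_at_top, rule_format, of 1] by eventually_elim simp
  show "\<forall>\<^sub>F n in sequentially. norm (integral {a..b} (\<lambda>t. cis (2 * pi * (of_int (s n) * t)))) \<le> inverse (real_of_int \<bar>s n\<bar>)"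
    using ev
  proof eventually_elim
    case (elim n)
    then have s0: "real_of_int (s n) \<noteq> 0" by simp
    have "integral {a..b} (\<lambda>t. cis (2 * pi * (of_int (s n) * t))) =
        (cis (2 * pi * (of_int (s n) * b)) - cis (2 * pi * (of_int (s n) * a))) / (2 * pi * of_int (s n) * \<i>)"
      using integral_unique[OF integral_cis[OF ab s0]] by simp
    also have "norm \<dots> \<le> 2 / norm (2 * pi * of_int (s n) * \<i>)"
      unfolding norm_divide
      by (rule divide_right_mono) (use norm_triangle_ineq4[of "cis (2 * pi * (of_int (s n) * b))" "cis (2 * pi * (of_int (s n) * a))"] in auto)
    also have "\<dots> = inverse pi * inverse (real_of_int \<bar>s n\<bar>)"
      by (simp add: norm_mult field_simps)
    also have "\<dots> \<le> 1 * inverse (real_of_int \<bar>s n\<bar>)"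
    proof (rule mult_right_mono)
      have "1 \<le> pi" using pi_gt3 by linarith
      then show "inverse pi \<le> 1" by (simp add: inverse_le_1_iff)
    qed simp
    finally show ?case by simp
  qed
  have "filterlim (\<lambda>n. real_of_int \<bar>s n\<bar>) at_top sequentially"
    by (rule filterlim_compose[OF filterlim_real_of_int_at_top s])
  then show "(\<lambda>n. inverse (real_of_int \<bar>s n\<bar>)) \<longlonglongrightarrow> 0"
    by (rule tendsto_inverse_0_at_top)
qed

text \<open>
  Expanding the product gives one exponential \<open>t \<mapsto> cis (2\<pi> s t)\<close> for each choice of
  indices \<open>k\<^sub>j\<close>, with the frequency \<open>s = \<Sum>\<^sub>j (k\<^sub>j - R) \<phi>\<^sub>j(n)\<close>. Unless \<open>k\<^sub>j = R\<close> for all \<open>j\<close>, asymptotic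
  independence makes \<open>\<bar>s\<bar>\<close> tend to infinity, and the integral of the exponential tends to \<open>0\<close>.
\<close>

lemma integral_cos_product_tendsto:
  fixes \<phi> :: "nat \<Rightarrow> nat \<Rightarrow> int" and v :: "nat \<Rightarrow> real"
  assumes ind: "asymp_independent N \<phi>" and ab: "a \<le> b"
  shows "(\<lambda>n. integral {a..b} (\<lambda>t. \<Prod>j\<in>{1..N}. cos (pi * (of_int (\<phi> j n) * t - v j)) ^ (2 * R)))
     \<longlonglongrightarrow> (b - a) * (real (2*R choose R) / 4 ^ R) ^ N"
proof -
  define c :: "nat \<Rightarrow> complex" where "c k = of_nat (2*R choose k) / 4 ^ R" for k
  define K where "K = PiE {1..N} (\<lambda>_. {..2*R})"
  have K: "finite K" unfolding K_def by (rule finite_PiE) auto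
  define S where "S k n = (\<Sum>j\<in>{1..N}. (int (k j) - int R) * \<phi> j n)" for k :: "nat \<Rightarrow> nat" and n
  define d :: "(nat \<Rightarrow> nat) \<Rightarrow> complex" where
    "d k = (\<Prod>j\<in>{1..N}. c (k j) * cis (2 * pi * (- (real (k j) - real R) * v j)))" for k
  have exp: "complex_of_real (\<Prod>j\<in>{1..N}. cos (pi * (of_int (\<phi> j n) * t - v j)) ^ (2 * R)) =
      (\<Sum>k\<in>K. d k * cis (2 * pi * (of_int (S k n) * t)))" for n t
  proof -
    have "complex_of_real (\<Prod>j\<in>{1..N}. cos (pi * (of_int (\<phi> j n) * t - v j)) ^ (2 * R)) =
        (\<Prod>j\<in>{1..N}. \<Sum>k\<le>2*R. c k * cis (2 * pi * ((real k - real R) * (of_int (\<phi> j n) * t - v j))))"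
      unfolding of_real_prod cos_pi_power_expansion c_def ..
    also have "\<dots> = (\<Sum>k\<in>K. \<Prod>j\<in>{1..N}. c (k j) * cis (2 * pi * ((real (k j) - real R) * (of_int (\<phi> j n) * t - v j))))"
      unfolding K_def by (rule prod_sum_PiE) auto
    also have "\<dots> = (\<Sum>k\<in>K. d k * cis (2 * pi * (of_int (S k n) * t)))"
    proof (rule sum.cong[OF refl])
      fix k
      have cs: "cis (\<Sum>j\<in>A. f j) = (\<Prod>j\<in>A. cis (f j))" if "finite A" for A :: "nat set" and f
        using that by (induction A) (auto simp: cis_mult[symmetric])
      have "2 * pi * (of_int (S k n) * t) = (\<Sum>j\<in>{1..N}. 2 * pi * ((real (k j) - real R) * (of_int (\<phi> j n) * t)))"
        by (simp add: S_def sum_distrib_left sum_distrib_right mult_ac)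
      then have "cis (2 * pi * (of_int (S k n) * t)) = (\<Prod>j\<in>{1..N}. cis (2 * pi * ((real (k j) - real R) * (of_int (\<phi> j n) * t))))"
        by (simp only: cs[OF finite_atLeastAtMost])
      then have "d k * cis (2 * pi * (of_int (S k n) * t)) =
          (\<Prod>j\<in>{1..N}. (c (k j) * cis (2 * pi * (- (real (k j) - real R) * v j))) * cis (2 * pi * ((real (k j) - real R) * (of_int (\<phi> j n) * t))))"
        by (simp only: d_def prod.distrib)
      also have "\<dots> = (\<Prod>j\<in>{1..N}. c (k j) * cis (2 * pi * ((real (k j) - real R) * (of_int (\<phi> j n) * t - v j))))"
        by (rule prod.cong[OF refl]) (simp only: mult.assoc cis_mult, simp add: algebra_simps)
      finally show "(\<Prod>j\<in>{1..N}. c (k j) * cis (2 * pi * ((real (k j) - real R) * (of_int (\<phi> j n) * t - v j)))) =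
          d k * cis (2 * pi * (of_int (S k n) * t))" by simp
    qed
    finally show ?thesis .
  qed
  \<comment> \<open>the only choice of indices with frequency \<open>0\<close> for all \<open>n\<close>\<close>
  define k0 where "k0 = restrict (\<lambda>_. R) {1..N}"
  have k0: "k0 \<in> K" by (auto simp: k0_def K_def)
  have lim_term: "(\<lambda>n. integral {a..b} (\<lambda>t. cis (2 * pi * (of_int (S k n) * t)))) \<longlonglongrightarrow> (if k = k0 then of_real (b - a) else 0)"
    if k: "k \<in> K" for k
  proof (cases "k = k0")
    case True
    then have "S k n = 0" for n by (auto simp: S_def k0_def intro!: sum.neutral)
    then show ?thesis using True ab by (simp add: scaleR_conv_of_real)
  next
    case False
    then obtain j where j: "j \<in> {1..N}" "k j \<noteq> R"
      using k unfolding K_def k0_def by (metis PiE_restrict restrict_ext)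
    have "filterlim (\<lambda>n. \<bar>S k n\<bar>) at_top sequentially"
      using ind[unfolded asymp_independent_def, rule_format, of "\<lambda>j. int (k j) - int R"] j
      unfolding S_def by force
    from integral_cis_tendsto_0[OF ab this] show ?thesis using False by simp
  qed
  have cint: "(\<lambda>t. cis (2 * pi * (of_int (S k n) * t))) integrable_on {a..b}" for k n
    by (intro integrable_continuous_interval continuous_intros)
  have eq: "complex_of_real (integral {a..b} (\<lambda>t. \<Prod>j\<in>{1..N}. cos (pi * (of_int (\<phi> j n) * t - v j)) ^ (2 * R))) =
      (\<Sum>k\<in>K. d k * integral {a..b} (\<lambda>t. cis (2 * pi * (of_int (S k n) * t))))" for n
  proof -
    have "(\<lambda>t. \<Prod>j\<in>{1..N}. cos (pi * (of_int (\<phi> j n) * t - v j)) ^ (2 * R)) integrable_on {a..b}"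
      by (intro integrable_continuous_interval continuous_intros)
    from integral_linear[OF this bounded_linear_of_real[where ?'a=complex]]
    have "complex_of_real (integral {a..b} (\<lambda>t. \<Prod>j\<in>{1..N}. cos (pi * (of_int (\<phi> j n) * t - v j)) ^ (2 * R))) =
        integral {a..b} (\<lambda>t. \<Sum>k\<in>K. d k * cis (2 * pi * (of_int (S k n) * t)))"
      unfolding o_def exp by simp
    also have "\<dots> = (\<Sum>k\<in>K. integral {a..b} (\<lambda>t. d k * cis (2 * pi * (of_int (S k n) * t))))"
      by (intro integral_sum K integrable_on_mult_right cint)
    finally show ?thesis by simp
  qed
  have "(\<lambda>n. \<Sum>k\<in>K. d k * integral {a..b} (\<lambda>t. cis (2 * pi * (of_int (S k n) * t))))
      \<longlonglongrightarrow> (\<Sum>k\<in>K. d k * (if k = k0 then of_real (b - a) else 0))"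
    by (intro tendsto_sum tendsto_mult tendsto_const lim_term)
  also have "(\<Sum>k\<in>K. d k * (if k = k0 then of_real (b - a) else 0)) = d k0 * of_real (b - a)"
    using K k0 by (simp add: if_distrib[of "\<lambda>x. d _ * x"] cong: if_cong)
  also have "d k0 = of_real ((real (2*R choose R) / 4 ^ R) ^ N)"
    by (simp add: d_def k0_def c_def)
  finally have "(\<lambda>n. complex_of_real (integral {a..b} (\<lambda>t. \<Prod>j\<in>{1..N}. cos (pi * (of_int (\<phi> j n) * t - v j)) ^ (2 * R))))
     \<longlonglongrightarrow> of_real ((b - a) * (real (2*R choose R) / 4 ^ R) ^ N)"
    unfolding eq by (simp add: mult.commute)
  then show ?thesis by (simp only: tendsto_of_real_iff)
qed

text \<open>
  The quantitative form of independence on which the construction rests: for large \<open>n\<close> the numbers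
  \<open>\<phi>\<^sub>j(n) t\<close> can be made close to arbitrary targets modulo \<open>1\<close>, with \<open>t\<close> in any given interval.
  If this failed, some factor of the product of kernels would be at most \<open>\<rho>\<^sup>R\<close> at every \<open>t\<close>, with
  \<open>\<rho> < 1\<close>. But the mean of the product tends to the \<open>N\<close>th power of the central
  coefficient, which decays only polynomially in \<open>R\<close>.
\<close>

lemma asymp_independent_simultaneous_approx:
  fixes \<phi> :: "nat \<Rightarrow> nat \<Rightarrow> int" and v :: "nat \<Rightarrow> real"
  assumes ind: "asymp_independent N \<phi>" and ab: "a < b" and eta: "0 < \<eta>"
  shows "\<forall>\<^sub>F n in sequentially. \<exists>t\<in>{a..b}. \<forall>j\<in>{1..N}. \<exists>h :: int. \<bar>of_int (\<phi> j n) * t - v j - of_int h\<bar> < \<eta>"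
proof -
  define \<eta>' where "\<eta>' = min \<eta> (1/2)"
  have e': "0 < \<eta>'" "\<eta>' \<le> 1/2" "\<eta>' \<le> \<eta>" using eta by (auto simp: \<eta>'_def)
  define \<rho> where "\<rho> = cos (pi * \<eta>') ^ 2"
  have "cos (pi * \<eta>') < cos 0" using e' by (intro cos_monotone_0_pi) (auto simp: field_simps)
  moreover have "0 \<le> cos (pi * \<eta>')" using e' by (intro cos_ge_zero) (auto simp: field_simps intro: order_trans[of _ 0])
  ultimately have rho: "0 \<le> \<rho>" "\<rho> < 1" by (auto simp: \<rho>_def power_less_one_iff abs_less_iff intro: power_strict_mono)
  obtain R where R: "R > 0" "\<rho> ^ R < (real (2*R choose R) / 4 ^ R) ^ N"
  proof -
    \<comment> \<open>\<open>R\<^sup>N \<rho>\<^sup>R\<close> is at most \<open>(R x\<^sup>R)\<^sup>N\<^sup>+\<^sup>1\<close> with \<open>x\<^sup>N\<^sup>+\<^sup>1 = \<rho>\<close>; the exponent \<open>N + 1\<close> is positive even for \<open>N = 0\<close>.\<close>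
    define x where "x = root (Suc N) \<rho>"
    have x: "0 \<le> x" "x < 1" "x ^ Suc N = \<rho>"
      using rho real_root_pow_pos2[of "Suc N" \<rho>] by (auto simp: x_def)
    have "(\<lambda>R. real R * x ^ R) \<longlonglongrightarrow> 0"
      using x by (intro powser_times_n_limit_0) auto
    then have "(\<lambda>R. 2 ^ N * (real R * x ^ R) ^ Suc N) \<longlonglongrightarrow> 2 ^ N * 0 ^ Suc N" by (intro tendsto_intros)
    then have "\<forall>\<^sub>F R in sequentially. 2 ^ N * (real R * x ^ R) ^ Suc N < 1"
      by (rule order_tendstoD) simp
    then have "\<forall>\<^sub>F R in sequentially. 2 ^ N * (real R * x ^ R) ^ Suc N < 1 \<and> R > 0"
      using eventually_gt_at_top[of 0] by (rule eventually_conj)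
    then obtain R where R': "2 ^ N * (real R * x ^ R) ^ Suc N < 1" "R > 0"
      by (auto simp: eventually_sequentially)
    have "(real R * x ^ R) ^ Suc N = real R ^ Suc N * (x ^ Suc N) ^ R"
      by (simp only: power_mult_distrib power_mult[symmetric] mult.commute[of R])
    then have eq: "(real R * x ^ R) ^ Suc N = real R ^ Suc N * \<rho> ^ R" by (simp only: x)
    have "real R ^ N \<le> real R ^ Suc N" using R'(2) by (intro power_increasing) auto
    then have "2 ^ N * (real R ^ N * \<rho> ^ R) \<le> 2 ^ N * (real R ^ Suc N * \<rho> ^ R)"
      using rho by (intro mult_left_mono mult_right_mono) auto
    from order_le_less_trans[OF this R'(1)[unfolded eq]]
    have R: "2 ^ N * (real R ^ N * \<rho> ^ R) < 1" "R > 0" using R'(2) by blast+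
    have "4 ^ R / (2 * real R) \<le> real (2*R choose R)"
      using central_binomial_lower_bound[of R] R by simp
    then have "1 / (2 * real R) \<le> real (2*R choose R) / 4 ^ R"
      using R by (simp add: field_simps)
    then have "(1 / (2 * real R)) ^ N \<le> (real (2*R choose R) / 4 ^ R) ^ N"
      by (rule power_mono) simp
    moreover have "\<rho> ^ R < (1 / (2 * real R)) ^ N"
      using R by (simp add: power_divide power_mult_distrib field_simps)
    ultimately show ?thesis using that[OF R(2)] by linarith
  qed
  have "(b - a) * \<rho> ^ R < (b - a) * (real (2*R choose R) / 4 ^ R) ^ N"
    using R ab by simp
  from order_tendstoD(1)[OF integral_cos_product_tendsto[where v=v, OF ind less_imp_le[OF ab]] this]
  show ?thesis
  proof eventually_elim
    case (elim n)
    let ?P = "\<lambda>t. \<Prod>j\<in>{1..N}. cos (pi * (of_int (\<phi> j n) * t - v j)) ^ (2 * R)"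
    show ?case
    proof (rule ccontr)
      assume neg: "\<not> ?case"
      have "?P t \<le> \<rho> ^ R" if t: "t \<in> {a..b}" for t
      proof -
        obtain j where j: "j \<in> {1..N}" "\<And>h :: int. \<eta> \<le> \<bar>of_int (\<phi> j n) * t - v j - of_int h\<bar>"
          using neg t by (force simp: not_less)
        have "?P t = cos (pi * (of_int (\<phi> j n) * t - v j)) ^ (2 * R) *
            (\<Prod>j\<in>{1..N} - {j}. cos (pi * (of_int (\<phi> j n) * t - v j)) ^ (2 * R))"
          by (rule prod.remove) (use j in auto)
        also have "\<dots> \<le> \<rho> ^ R * 1"
        proof (rule mult_mono)
          show "cos (pi * (of_int (\<phi> j n) * t - v j)) ^ (2 * R) \<le> \<rho> ^ R"
            unfolding \<rho>_def by (rule cos_pi_power_small) (use e' j in \<open>auto intro: order_trans\<close>)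
          show "(\<Prod>j\<in>{1..N} - {j}. cos (pi * (of_int (\<phi> j n) * t - v j)) ^ (2 * R)) \<le> 1"
          proof (rule prod_le_1)
            fix i
            have "\<bar>cos (pi * (of_int (\<phi> i n) * t - v i))\<bar> ^ (2 * R) \<le> 1" by (rule power_le_one) auto
            then show "0 \<le> cos (pi * (of_int (\<phi> i n) * t - v i)) ^ (2 * R) \<and> cos (pi * (of_int (\<phi> i n) * t - v i)) ^ (2 * R) \<le> 1"
              by (simp add: power_mult)
          qed
        qed (use rho in \<open>auto intro!: prod_nonneg simp: power_mult\<close>)
        finally show ?thesis by simp
      qed
      then have "integral {a..b} ?P \<le> integral {a..b} (\<lambda>t. \<rho> ^ R)"
        by (intro integral_le integrable_continuous_interval continuous_intros) auto
      then show False using elim ab by simp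
    qed
  qed
qed

section \<open>Correlations of a labelled cycle\<close>

lemma periodic_int_mult:
  fixes F :: "int \<Rightarrow> 'a"
  assumes "\<And>p. F (p + Q) = F p"
  shows "F (p + k * Q) = F p"
proof (induction k rule: int_induct[where k=0])
  case (step1 i)
  have "F (p + (i + 1) * Q) = F ((p + i * Q) + Q)" by (simp add: algebra_simps)
  then show ?case using step1 assms by simp
next
  case (step2 i)
  have "F (p + i * Q) = F ((p + (i - 1) * Q) + Q)" by (simp add: algebra_simps)
  then show ?case using step2 assms by simp
qed simp

lemma periodic_mod:
  fixes F :: "int \<Rightarrow> 'a"
  assumes "\<And>p. F (p + Q) = F p"
  shows "F (p mod Q) = F p"
  using periodic_int_mult[of F Q "p mod Q" "p div Q", OF assms] by (simp add: add.commute)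

lemma card_periodic_shift:
  fixes P :: "int \<Rightarrow> bool"
  assumes Q: "Q > 0" and per: "\<And>p. P (p + Q) = P p"
  shows "card {p \<in> {0..<Q}. P (p + s)} = card {p \<in> {0..<Q}. P p}"
proof (rule bij_betw_same_card)
  have m: "P (p mod Q) = P p" for p by (rule periodic_mod[of P, OF per])
  have "P (((p - s) mod Q) + s) = P p" for p
    using m[of "(p - s) mod Q + s"] m[of p] by (simp add: mod_add_left_eq)
  then show "bij_betw (\<lambda>p. (p + s) mod Q) {p \<in> {0..<Q}. P (p + s)} {p \<in> {0..<Q}. P p}"
    using Q m by (intro bij_betw_byWitness[where f'="\<lambda>p. (p - s) mod Q"])
      (auto simp: mod_diff_left_eq mod_add_left_eq)
qed

lemma div_in_range:
  fixes p :: int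
  assumes "W > 0" "0 \<le> p" "p < G * W"
  shows "0 \<le> p div W" "p div W < G"
proof -
  show "0 \<le> p div W" using assms by (simp add: pos_imp_zdiv_nonneg_iff)
  have "p div W * W \<le> p" using assms(1) by (simp add: minus_mod_eq_div_mult[symmetric])
  then have "p div W * W < G * W" using assms(3) by linarith
  then show "p div W < G" using assms(1) by simp
qed

lemma card_Collect_const: "card {v \<in> A. P} = (if P then card A else 0)"
  by simp

lemma div_mod_eqI:
  fixes p :: int
  assumes "p = r + k * W" "0 \<le> r" "r < W"
  shows "p div W = k" "p mod W = r"
  using assms by (simp_all add: div_pos_pos_trivial)

lemma card_div_mod:
  fixes R :: "int \<Rightarrow> int \<Rightarrow> bool"
  assumes W: "W > 0"
  shows "card {p \<in> {0..<G * W}. R (p div W) (p mod W)} = (\<Sum>r\<in>{0..<W}. card {v \<in> {0..<G}. R v r})"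
proof -
  let ?S = "SIGMA r:{0..<W}. {v \<in> {0..<G}. R v r}"
  have "bij_betw (\<lambda>p. (p mod W, p div W)) {p \<in> {0..<G * W}. R (p div W) (p mod W)} ?S"
  proof (rule bij_betw_byWitness[where f'="\<lambda>(r, v). v * W + r"])
    show "(\<lambda>p. (p mod W, p div W)) ` {p \<in> {0..<G * W}. R (p div W) (p mod W)} \<subseteq> ?S"
      using W div_in_range[OF W] by auto
    show "(\<lambda>(r, v). v * W + r) ` ?S \<subseteq> {p \<in> {0..<G * W}. R (p div W) (p mod W)}"
    proof (rule image_subsetI)
      fix x assume "x \<in> ?S"
      then obtain r v where x: "x = (r, v)" and *: "0 \<le> r" "r < W" "R v r" "0 \<le> v" "v < G" by auto
      then have "(v + 1) * W \<le> G * W" by (intro mult_right_mono) auto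
      then show "(case x of (r, v) \<Rightarrow> v * W + r) \<in> {p \<in> {0..<G * W}. R (p div W) (p mod W)}"
        using * by (auto simp: x algebra_simps)
    qed
  qed auto
  then have "card {p \<in> {0..<G * W}. R (p div W) (p mod W)} = card ?S" by (rule bij_betw_same_card)
  also have "\<dots> = (\<Sum>r\<in>{0..<W}. card {v \<in> {0..<G}. R v r})"
    by (rule card_SigmaI) (auto intro: finite_subset[of _ "{0..<G}"])
  finally show ?thesis .
qed

text \<open>
  The correlation of \<open>A\<close> and \<open>B\<close> under the shift by \<open>s\<close> of the cycle of length \<open>Q\<close>, whose points
  are labelled by the \<open>Q\<close>-periodic function \<open>F\<close>.
\<close>

definition shift_count :: "int \<Rightarrow> (int \<Rightarrow> nat) \<Rightarrow> nat set \<Rightarrow> nat set \<Rightarrow> int \<Rightarrow> nat" where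
  "shift_count Q F A B s = card {p \<in> {0..<Q}. F p \<in> A \<and> F (p + s) \<in> B}"

lemma shift_count_periodic:
  assumes "\<And>p. F (p + Q) = F p"
  shows "shift_count Q F A B (s + h * Q) = shift_count Q F A B s"
  using periodic_int_mult[of F Q _ h, OF assms] by (simp add: shift_count_def add.assoc[symmetric])

lemma shift_count_swap:
  assumes "Q > 0" "\<And>p. F (p + Q) = F p"
  shows "shift_count Q F A B (- s) = shift_count Q F B A s"
proof -
  have "card {p \<in> {0..<Q}. F (p + s) \<in> A \<and> F ((p + s) + - s) \<in> B} =
      card {p \<in> {0..<Q}. F p \<in> A \<and> F (p + - s) \<in> B}"
    by (rule card_periodic_shift[OF assms(1), of "\<lambda>p. F p \<in> A \<and> F (p + - s) \<in> B"])
      (metis (no_types) add.assoc add.commute assms(2))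
  then show ?thesis by (simp add: shift_count_def conj_commute)
qed

text \<open>
  A shift by one step changes labels only at the places where the label jumps, at most \<open>J\<close> in number. Hence an
  approximate shift has approximately the right correlations.
\<close>

lemma shift_count_lipschitz:
  assumes Q: "Q > 0" and per: "\<And>p. F (p + Q) = F p"
    and J: "card {p \<in> {0..<Q}. F p \<noteq> F (p + 1)} \<le> J"
  shows "\<bar>real (shift_count Q F A B s) - real (shift_count Q F A B t)\<bar> \<le> real J * \<bar>real_of_int (s - t)\<bar>"
proof -
  let ?c = "shift_count Q F A B"
  have step: "\<bar>real (?c (s + 1)) - real (?c s)\<bar> \<le> real J" for s
  proof -
    let ?D = "{p \<in> {0..<Q}. F (p + s) \<noteq> F (p + s + 1)}"
    have "card ?D = card {p \<in> {0..<Q}. F p \<noteq> F (p + 1)}"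
      by (rule card_periodic_shift[OF Q, of "\<lambda>p. F p \<noteq> F (p + 1)"]) (metis add.assoc add.commute per)
    then have D: "card ?D \<le> J" using J by simp
    have fin: "finite {p \<in> {0..<Q}. P p}" for P by (rule finite_subset[of _ "{0..<Q}"]) auto
    have "?c (s + 1) \<le> card ({p \<in> {0..<Q}. F p \<in> A \<and> F (p + s) \<in> B} \<union> ?D)"
      unfolding shift_count_def by (rule card_mono[OF finite_UnI[OF fin fin]]) (auto simp: add.assoc[symmetric])
    then have "?c (s + 1) \<le> ?c s + card ?D"
      unfolding shift_count_def using card_Un_le order_trans by blast
    moreover have "?c s \<le> card ({p \<in> {0..<Q}. F p \<in> A \<and> F (p + (s + 1)) \<in> B} \<union> ?D)"
      unfolding shift_count_def by (rule card_mono[OF finite_UnI[OF fin fin]]) (auto simp: add.assoc[symmetric])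
    then have "?c s \<le> ?c (s + 1) + card ?D"
      unfolding shift_count_def using card_Un_le order_trans by blast
    ultimately show ?thesis using D by linarith
  qed
  have up: "\<bar>real (?c (s + int d)) - real (?c s)\<bar> \<le> real J * real d" for s d
  proof (induction d)
    case (Suc d)
    have "\<bar>real (?c (s + int (Suc d))) - real (?c (s + int d))\<bar> \<le> real J"
      using step[of "s + int d"] by (simp add: add_ac)
    then show ?case using Suc by (simp add: algebra_simps abs_le_iff)
  qed simp
  show ?thesis
  proof (cases "s \<ge> t")
    case True
    then show ?thesis using up[of t "nat (s - t)"] by simp
  next
    case False
    then show ?thesis using up[of s "nat (t - s)"] by (simp add: abs_minus_commute)
  qed
qed

text \<open>
  The label of the arc \<open>u\<close>. The word consists of \<open>q\<close> pieces of length \<open>L\<close>, and the piece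
  number \<open>i\<close> is \<open>i, \<pi> i, \<pi>\<^sup>2 i, \<dots>\<close>; the word is repeated periodically.
\<close>

definition orbit_label :: "(nat \<Rightarrow> nat) \<Rightarrow> nat \<Rightarrow> nat \<Rightarrow> int \<Rightarrow> nat" where
  "orbit_label \<pi> q L u = (\<pi> ^^ nat (u mod int L)) (nat (u mod int (q * L) div int L))"

lemma orbit_label_periodic: "orbit_label \<pi> q L (u + int (q * L)) = orbit_label \<pi> q L u"
  unfolding orbit_label_def by (simp add: mult.commute)

lemma orbit_label_Suc:
  assumes L: "L > 0" "q > 0" and u: "u mod int L \<noteq> int L - 1"
  shows "orbit_label \<pi> q L (u + 1) = \<pi> (orbit_label \<pi> q L u)"
proof -
  define w where "w = u mod int (q * L)"
  have w: "0 \<le> w" "w < int q * int L" using L by (auto simp: w_def)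
  have wL: "w mod int L = u mod int L" unfolding w_def by (simp add: mod_mod_cancel)
  have r: "0 \<le> w mod int L" "w mod int L < int L - 1" 
    using L u wL pos_mod_bound[of "int L" u] pos_mod_sign[of "int L" u] by linarith+
  have e: "w = (w div int L) * int L + w mod int L" by simp
  have e1: "w + 1 = (w mod int L + 1) + (w div int L) * int L" using e by linarith
  have d: "(w + 1) div int L = w div int L" "(w + 1) mod int L = w mod int L + 1"
    using div_mod_eqI[OF e1] r by linarith+
  have "w + 1 \<noteq> int q * int L"
  proof
    assume "w + 1 = int q * int L"
    then have "(w + 1) mod int L = 0" by simp
    then show False using d r by simp
  qed
  then have "w + 1 < int q * int L" using w by linarith
  then have "(u + 1) mod int (q * L) = w + 1"
    using w(1) by (metis (no_types) w_def mod_add_left_eq mod_pos_pos_trivial of_nat_mult add_increasing2 zero_le_one)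
  moreover have "(u + 1) mod int L = w mod int L + 1"
    using d(2) wL by (metis mod_add_left_eq)
  moreover have "nat (w mod int L + 1) = Suc (nat (w mod int L))" using r by simp
  ultimately show ?thesis
    unfolding orbit_label_def
    by (simp only: d(1) w_def[symmetric] wL[symmetric] funpow.simps o_apply)
qed

text \<open>
  Every label occurs \<open>L\<close> times in a period, once at each place within the pieces,
  because \<open>\<pi>\<^sup>r\<close> is a permutation.
\<close>

lemma card_orbit_label:
  assumes \<pi>: "\<pi> permutes {..<q}" and L: "L > 0" and A: "A \<subseteq> {..<q}"
  shows "card {v \<in> {0..<int (q * L)}. orbit_label \<pi> q L v \<in> A} = L * card A"
proof -
  have "{v \<in> {0..<int (q * L)}. orbit_label \<pi> q L v \<in> A} =
      {v \<in> {0..<int q * int L}. (\<pi> ^^ nat (v mod int L)) (nat (v div int L)) \<in> A}"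
    by (auto simp: orbit_label_def)
  also have "card \<dots> = (\<Sum>r\<in>{0..<int L}. card {v \<in> {0..<int q}. (\<pi> ^^ nat r) (nat v) \<in> A})"
    by (rule card_div_mod) (use L in simp)
  also have "\<dots> = (\<Sum>r\<in>{0..<int L}. card A)"
  proof (rule sum.cong[OF refl])
    fix r :: int
    have p: "(\<pi> ^^ nat r) permutes {..<q}" by (rule permutes_funpow[OF \<pi>])
    have "bij_betw (\<lambda>v. (\<pi> ^^ nat r) (nat v)) {v \<in> {0..<int q}. (\<pi> ^^ nat r) (nat v) \<in> A} A"
      by (rule bij_betw_byWitness[where f'="\<lambda>a. int (inv (\<pi> ^^ nat r) a)"])
        (use p A permutes_in_image[OF permutes_inv[OF p]] permutes_inverses[OF p] in \<open>auto simp: subset_iff\<close>)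
    then show "card {v \<in> {0..<int q}. (\<pi> ^^ nat r) (nat v) \<in> A} = card A" by (rule bij_betw_same_card)
  qed
  finally show ?thesis by simp
qed

lemma orbit_label_range:
  assumes "\<pi> permutes {..<q}" "L > 0" "q > 0"
  shows "orbit_label \<pi> q L u < q"
proof -
  have "0 \<le> u mod int (q * L)" "u mod int (q * L) < int q * int L"
    using assms pos_mod_bound[of "int (q * L)" u] by auto
  then have "nat (u mod int (q * L) div int L) < q"
    using assms div_in_range[of "int L" "u mod int (q * L)" "int q"] by (simp add: nat_less_iff)
  then show ?thesis
    using permutes_in_image[OF permutes_funpow[OF assms(1)]] by (auto simp: orbit_label_def)
qed

text \<open>
  Any bijection of a finite set whose labels are equally frequent is conjugate to a
  permutation of the \<open>q * c\<close> short intervals, with the label becoming the number \<open>i div c\<close>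
  of the long interval.
\<close>

lemma permutation_of_labelled_bijection:
  fixes s :: "'a \<Rightarrow> 'a" and lb :: "'a \<Rightarrow> nat"
  assumes I: "finite I" and s: "bij_betw s I I" and l: "\<And>x. x \<in> I \<Longrightarrow> lb x < q"
    and fib: "\<And>i. i < q \<Longrightarrow> card {x \<in> I. lb x = i} = c" and c: "c > 0"
  shows "\<exists>\<sigma>. \<sigma> permutes {..<q * c} \<and>
    (\<forall>R m. card {i \<in> {..<q * c}. R (i div c) ((\<sigma> ^^ m) i div c)} = card {x \<in> I. R (lb x) (lb ((s ^^ m) x))})"
proof -
  have "\<exists>b. bij_betw b {x \<in> I. lb x = i} {..<c}" if "i < q" for i
    using I fib[OF that] by (intro finite_same_card_bij) auto
  then obtain b where b: "\<And>i. i < q \<Longrightarrow> bij_betw (b i) {x \<in> I. lb x = i} {..<c}" by metis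
  define \<beta> where "\<beta> x = lb x * c + b (lb x) x" for x
  have bc: "b (lb x) x < c" if "x \<in> I" for x
    using bij_betw_apply[OF b[OF l[OF that]], of x] that by simp
  have \<beta>div: "\<beta> x div c = lb x" if "x \<in> I" for x using bc[OF that] c by (simp add: \<beta>_def)
  have inj: "inj_on \<beta> I"
  proof (rule inj_onI)
    fix x y assume xy: "x \<in> I" "y \<in> I" "\<beta> x = \<beta> y"
    then have "lb x = lb y" using \<beta>div by metis
    moreover from this have "b (lb x) x = b (lb x) y" using xy by (simp add: \<beta>_def)
    ultimately show "x = y"
      using inj_onD[OF bij_betw_imp_inj_on[OF b[OF l[OF xy(1)]]]] xy by simp
  qed
  have "card I = card (\<Union>i\<in>{..<q}. {x \<in> I. lb x = i})"
    by (rule arg_cong[where f=card]) (use l in auto)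
  also have "\<dots> = (\<Sum>i\<in>{..<q}. card {x \<in> I. lb x = i})"
    by (rule card_UN_disjoint) (use I in auto)
  also have "\<dots> = q * c" using fib by simp
  finally have cI: "card I = q * c" .
  have "\<beta> x < q * c" if "x \<in> I" for x
  proof -
    have "(lb x + 1) * c \<le> q * c" using l[OF that] by (intro mult_right_mono) auto
    then show ?thesis using bc[OF that] by (simp add: \<beta>_def algebra_simps)
  qed
  then have "\<beta> ` I \<subseteq> {..<q * c}" by auto
  then have "\<beta> ` I = {..<q * c}"
    by (intro card_subset_eq) (auto simp: card_image[OF inj] cI)
  then have bij: "bij_betw \<beta> I {..<q * c}" using inj by (simp add: bij_betw_def)
  let ?g = "inv_into I \<beta>"
  define \<sigma> where "\<sigma> i = (if i \<in> {..<q * c} then (\<beta> \<circ> s \<circ> ?g) i else i)" for i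
  have "bij_betw (\<beta> \<circ> s \<circ> ?g) {..<q * c} {..<q * c}"
    by (intro bij_betw_trans[OF bij_betw_inv_into[OF bij]] bij_betw_trans[OF s] bij)
  then have "bij_betw \<sigma> {..<q * c} {..<q * c}"
    by (subst bij_betw_cong[of _ _ "\<beta> \<circ> s \<circ> ?g"]) (auto simp: \<sigma>_def)
  then have \<sigma>: "\<sigma> permutes {..<q * c}" by (rule bij_imp_permutes) (auto simp: \<sigma>_def)
  have pow: "(s ^^ m) x \<in> I \<and> (\<sigma> ^^ m) (\<beta> x) = \<beta> ((s ^^ m) x)" if "x \<in> I" for m x
  proof (induction m)
    case (Suc m)
    have "\<sigma> (\<beta> y) = \<beta> (s y)" if "y \<in> I" for y
      using that bij_betw_apply[OF bij that] bij_betw_inv_into_left[OF bij that] by (simp add: \<sigma>_def)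
    then show ?case using Suc bij_betw_apply[OF s] by simp
  qed (use that in simp)
  have "card {i \<in> {..<q * c}. R (i div c) ((\<sigma> ^^ m) i div c)} = card {x \<in> I. R (lb x) (lb ((s ^^ m) x))}" for R m
  proof -
    have "{i \<in> {..<q * c}. R (i div c) ((\<sigma> ^^ m) i div c)} = \<beta> ` {x \<in> I. R (lb x) (lb ((s ^^ m) x))}"
      unfolding \<open>\<beta> ` I = {..<q * c}\<close>[symmetric] using pow \<beta>div by auto
    then show ?thesis by (simp add: card_image inj_on_subset[OF inj])
  qed
  then show ?thesis using \<sigma> by blast
qed

text \<open>
  Each arc of the cycle has \<open>W\<close> points, so that the label of the point \<open>p\<close> is that of the arc
  \<open>p div W\<close>. The label jumps only at ends of arcs. Shifts by multiples of an arc, one for each arc,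
  average to exact independence of the labels. A shift by slightly more than one arc acts on labels
  as \<open>\<pi>\<close>, except in the last part of an arc or in the last arc of a piece.
\<close>

lemma orbit_label_word:
  assumes \<pi>: "\<pi> permutes {..<q}" and pos: "q > 0" "L > 0" "W > 0"
  defines "G \<equiv> q * L" and "Q \<equiv> int (q * L) * int W" and "F \<equiv> \<lambda>p. orbit_label \<pi> q L (p div int W)"
  shows "F (p + Q) = F p"
    and "A \<subseteq> {..<q} \<Longrightarrow> card {p \<in> {0..<Q}. F p \<in> A} = W * (L * card A)"
    and "card {p \<in> {0..<Q}. F p \<noteq> F (p + 1)} \<le> G"
    and "\<lbrakk>A \<subseteq> {..<q}; B \<subseteq> {..<q}\<rbrakk> \<Longrightarrow> shift_count Q F A B 0 = W * (L * card (A \<inter> B))"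
    and "\<lbrakk>A \<subseteq> {..<q}; B \<subseteq> {..<q}\<rbrakk> \<Longrightarrow>
        (\<Sum>g<G. shift_count Q F A B (int g * int W)) = W * (L * card A) * (L * card B)"
    and "card {p \<in> {0..<Q}. F (p + int W + int e) \<noteq> \<pi> (F p)} \<le> e * G + W * q"
proof -
  have G: "int G > 0" using pos by (simp add: G_def)
  have Q: "Q = int G * int W" "Q > 0" using pos by (auto simp: Q_def G_def)
  have W: "int W > 0" using pos by simp
  show per: "F (p + Q) = F p" for p
  proof -
    have "(p + Q) div int W = p div int W + int (q * L)" using W by (simp add: Q(1) G_def)
    then show ?thesis unfolding F_def by (simp only: orbit_label_periodic)
  qed
  show cA: "card {p \<in> {0..<Q}. F p \<in> A} = W * (L * card A)" if "A \<subseteq> {..<q}" for A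
  proof -
    have "card {p \<in> {0..<Q}. F p \<in> A} = (\<Sum>r\<in>{0..<int W}. card {v \<in> {0..<int G}. orbit_label \<pi> q L v \<in> A})"
      unfolding Q(1) F_def by (rule card_div_mod[OF W])
    then show ?thesis unfolding G_def card_orbit_label[OF \<pi> pos(2) that] by simp
  qed
  show "card {p \<in> {0..<Q}. F p \<noteq> F (p + 1)} \<le> G"
  proof -
    have "{p \<in> {0..<Q}. F p \<noteq> F (p + 1)} \<subseteq> {p \<in> {0..<int G * int W}. p mod int W = int W - 1}"
    proof (intro subsetI CollectI conjI)
      fix p assume p: "p \<in> {p \<in> {0..<Q}. F p \<noteq> F (p + 1)}"
      then show "p \<in> {0..<int G * int W}" by (simp add: Q(1))
      show "p mod int W = int W - 1"
      proof (rule ccontr)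
        assume "p mod int W \<noteq> int W - 1"
        then have r: "0 \<le> p mod int W" "p mod int W + 1 < int W"
          using pos_mod_bound[OF W, of p] pos_mod_sign[OF W, of p] by linarith+
        have "p + 1 = (p mod int W + 1) + p div int W * int W" by simp
        then have "(p + 1) div int W = p div int W" by (rule div_mod_eqI(1)) (use r in linarith)+
        then show False using p by (simp add: F_def)
      qed
    qed
    then have "card {p \<in> {0..<Q}. F p \<noteq> F (p + 1)} \<le> card {p \<in> {0..<int G * int W}. p mod int W = int W - 1}"
      by (intro card_mono finite_subset[OF _ finite_atLeastLessThan_int[of 0 "int G * int W"]]) auto
    also have "\<dots> = (\<Sum>r\<in>{0..<int W}. card {v \<in> {0..<int G}. r = int W - 1})"
      by (rule card_div_mod[OF W])
    also have "\<dots> = (\<Sum>r\<in>{0..<int W}. if r = int W - 1 then G else 0)"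
      by (rule sum.cong[OF refl]) (simp only: card_Collect_const, simp)
    also have "\<dots> = G" using W by (simp add: sum.delta)
    finally show ?thesis .
  qed
  show "shift_count Q F A B 0 = W * (L * card (A \<inter> B))" if "A \<subseteq> {..<q}" "B \<subseteq> {..<q}" for A B
    using cA[of "A \<inter> B"] that by (simp add: shift_count_def le_infI1)
  show "(\<Sum>g<G. shift_count Q F A B (int g * int W)) = W * (L * card A) * (L * card B)"
    if AB: "A \<subseteq> {..<q}" "B \<subseteq> {..<q}" for A B
  proof -
    let ?l = "orbit_label \<pi> q L"
    let ?P = "{p \<in> {0..<Q}. F p \<in> A}"
    have fin: "finite ?P" by (rule finite_subset[of _ "{0..<Q}"]) auto
    have B: "card {g \<in> {..<G}. ?l (u + int g) \<in> B} = L * card B" for u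
    proof -
      have "card {g \<in> {..<G}. ?l (u + int g) \<in> B} = card {v \<in> {0..<int G}. ?l (v + u) \<in> B}"
        by (rule bij_betw_same_card[where f=int], rule bij_betw_byWitness[where f'=nat]) (auto simp: add.commute)
      also have "\<dots> = card {v \<in> {0..<int G}. ?l v \<in> B}"
        by (rule card_periodic_shift[OF G, of "\<lambda>v. ?l v \<in> B"]) (simp only: G_def orbit_label_periodic)
      finally show ?thesis unfolding G_def card_orbit_label[OF \<pi> pos(2) AB(2)] .
    qed
    have "shift_count Q F A B (int g * int W) = (\<Sum>p\<in>?P. of_bool (?l (p div int W + int g) \<in> B))" for g
    proof -
      have F: "F (p + int g * int W) = ?l (p div int W + int g)" for p using W by (simp add: F_def add.commute)
      have "{p \<in> {0..<Q}. F p \<in> A \<and> ?l (p div int W + int g) \<in> B} = ?P \<inter> {p. ?l (p div int W + int g) \<in> B}" by auto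
      then show ?thesis unfolding shift_count_def F using fin by simp
    qed
    then have "(\<Sum>g<G. shift_count Q F A B (int g * int W)) =
        (\<Sum>g<G. \<Sum>p\<in>?P. of_bool (?l (p div int W + int g) \<in> B))" by simp
    also have "\<dots> = (\<Sum>p\<in>?P. \<Sum>g<G. of_bool (?l (p div int W + int g) \<in> B))" by (rule sum.swap)
    also have "\<dots> = (\<Sum>p\<in>?P. L * card B)"
    proof (rule sum.cong[OF refl])
      fix p
      have "{..<G} \<inter> {g. ?l (p div int W + int g) \<in> B} = {g \<in> {..<G}. ?l (p div int W + int g) \<in> B}" by auto
      then show "(\<Sum>g<G. of_bool (?l (p div int W + int g) \<in> B)) = L * card B"
        using B[of "p div int W"] by simp
    qed
    finally show ?thesis using cA[OF AB(1)] by simp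
  qed
  show "card {p \<in> {0..<Q}. F (p + int W + int e) \<noteq> \<pi> (F p)} \<le> e * G + W * q"
  proof -
    let ?X = "{p \<in> {0..<int G * int W}. int W - int e \<le> p mod int W}"
    let ?Y = "{p \<in> {0..<int G * int W}. p div int W mod int L = int L - 1}"
    have fin: "finite ?X" "finite ?Y" by (rule finite_subset[of _ "{0..<int G * int W}"]; auto)+
    have "{p \<in> {0..<Q}. F (p + int W + int e) \<noteq> \<pi> (F p)} \<subseteq> ?X \<union> ?Y"
    proof
      fix p assume p: "p \<in> {p \<in> {0..<Q}. F (p + int W + int e) \<noteq> \<pi> (F p)}"
      show "p \<in> ?X \<union> ?Y"
      proof (rule ccontr)
        assume n: "p \<notin> ?X \<union> ?Y"
        then have r: "0 \<le> p mod int W + int e" "p mod int W + int e < int W" and u: "p div int W mod int L \<noteq> int L - 1"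
          using p W by (auto simp: Q(1))
        have "p + int W + int e = (p mod int W + int e) + (p div int W + 1) * int W"
          by (simp add: algebra_simps)
        then have "(p + int W + int e) div int W = p div int W + 1" by (rule div_mod_eqI(1)[OF _ r])
        then have "F (p + int W + int e) = \<pi> (F p)"
          unfolding F_def using orbit_label_Suc[OF pos(2,1) u] by simp
        then show False using p by simp
      qed
    qed
    then have "card {p \<in> {0..<Q}. F (p + int W + int e) \<noteq> \<pi> (F p)} \<le> card (?X \<union> ?Y)"
      using fin by (intro card_mono) auto
    also have "\<dots> \<le> card ?X + card ?Y" by (rule card_Un_le)
    also have "card ?X = (\<Sum>r\<in>{0..<int W}. card {v \<in> {0..<int G}. int W - int e \<le> r})"
      by (rule card_div_mod[OF W])
    also have "\<dots> = (\<Sum>r\<in>{0..<int W}. of_bool (int W - int e \<le> r) * G)"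
      by (rule sum.cong[OF refl]) (simp only: card_Collect_const, simp)
    also have "\<dots> = card ({0..<int W} \<inter> {r. int W - int e \<le> r}) * G"
      by (simp add: sum_distrib_right[symmetric])
    also have "\<dots> \<le> e * G"
    proof (rule mult_right_mono)
      have "card ({0..<int W} \<inter> {r. int W - int e \<le> r}) \<le> card {int W - int e..<int W}"
        by (rule card_mono) auto
      then show "card ({0..<int W} \<inter> {r. int W - int e \<le> r}) \<le> e" by simp
    qed simp
    also have "card ?Y = (\<Sum>r\<in>{0..<int W}. card {v \<in> {0..<int G}. v mod int L = int L - 1})"
      by (rule card_div_mod[OF W])
    also have "card {v \<in> {0..<int G}. v mod int L = int L - 1} =
        (\<Sum>r\<in>{0..<int L}. card {v \<in> {0..<int q}. r = int L - 1})"
      unfolding G_def of_nat_mult by (rule card_div_mod) (use pos in simp)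
    also have "\<dots> = (\<Sum>r\<in>{0..<int L}. if r = int L - 1 then q else 0)"
      by (rule sum.cong[OF refl]) (simp only: card_Collect_const, simp)
    also have "\<dots> = q" using pos by (simp add: sum.delta)
    finally show ?thesis by simp
  qed
qed

section \<open>A finite mixing permutation\<close>

lemma rotation_iterate:
  fixes a :: "'b \<Rightarrow> int"
  assumes "p \<in> {0..<Q}"
  shows "((\<lambda>(y, p). (y, (p + a y) mod Q)) ^^ m) (y, p) = (y, (p + int m * a y) mod Q)"
proof (induction m)
  case 0
  then show ?case using assms by simp
next
  case (Suc m)
  then show ?case by (simp add: algebra_simps mod_add_right_eq mod_add_left_eq)
qed

lemma rotation_bij:
  fixes a :: "'b \<Rightarrow> int"
  assumes "Q > 0"
  shows "bij_betw (\<lambda>(y, p). (y, (p + a y) mod Q)) (Y \<times> {0..<Q}) (Y \<times> {0..<Q})"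
  by (rule bij_betw_byWitness[where f'="\<lambda>(y, p). (y, (p - a y) mod Q)"])
    (use assms in \<open>auto simp: mod_add_left_eq mod_diff_left_eq\<close>)

text \<open>
  The disjoint union of copies of the cycle, indexed by \<open>Y\<close>, the copy \<open>y\<close> being shifted by \<open>a y\<close>.
\<close>

lemma rotation_bundle_correlation:
  fixes a :: "'b \<Rightarrow> int"
  assumes Q: "Q > 0" and per: "\<And>p. F (p + Q) = F p" and Y: "finite Y"
  shows "card {x \<in> Y \<times> {0..<Q}. F (snd x) \<in> A \<and> F (snd (((\<lambda>(y, p). (y, (p + a y) mod Q)) ^^ m) x)) \<in> B}
    = (\<Sum>y\<in>Y. shift_count Q F A B (int m * a y))"
proof -
  let ?s = "\<lambda>(y, p). (y, (p + a y) mod Q)"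
  have "F (snd ((?s ^^ m) (y, p))) = F (p + int m * a y)" if "p \<in> {0..<Q}" for y p
    unfolding rotation_iterate[OF that] by (simp add: periodic_mod[of F, OF per])
  then have "{x \<in> Y \<times> {0..<Q}. F (snd x) \<in> A \<and> F (snd ((?s ^^ m) x)) \<in> B} =
      (SIGMA y:Y. {p \<in> {0..<Q}. F p \<in> A \<and> F (p + int m * a y) \<in> B})"
    by (intro set_eqI) (auto simp del: split_paired_All)
  also have "card \<dots> = (\<Sum>y\<in>Y. card {p \<in> {0..<Q}. F p \<in> A \<and> F (p + int m * a y) \<in> B})"
    by (rule card_SigmaI) (auto intro: finite_subset[of _ "{0..<Q}"] Y)
  finally show ?thesis by (simp add: shift_count_def)
qed

text \<open>
  Integer shifts \<open>W + e y\<close> of a cycle with \<open>G\<close> arcs of \<open>W\<close> points, whose multiples by \<open>\<phi>\<^sub>j(n)\<close> are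
  close to prescribed multiples \<open>v j y\<close> of an arc. They are obtained by rounding real angles;
  since \<open>n\<close> is chosen before \<open>W\<close>, the rounding error, multiplied by \<open>\<phi>\<^sub>j(n)\<close>, is still
  small compared with an arc.
\<close>

lemma asymp_independent_rotation_numbers:
  fixes \<phi> :: "nat \<Rightarrow> nat \<Rightarrow> int" and v :: "nat \<Rightarrow> 'y \<Rightarrow> nat" and G :: nat
  assumes ind: "asymp_independent N \<phi>" and Y: "finite Y" and eta: "\<eta> > 0" and G: "G > 0"
  shows "\<exists>n>nmin. \<exists>W>0. \<exists>e. \<forall>y\<in>Y. real (e y) \<le> \<eta> * W \<and>
     (\<forall>j\<in>{1..N}. \<exists>h. \<bar>real_of_int (\<phi> j n * (int W + int (e y)) - int (v j y) * int W - h * (int G * int W))\<bar> \<le> \<eta> * W)"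
proof -
  \<comment> \<open>Angles are fractions of the whole circle, so that one arc is \<open>1/G\<close>.\<close>
  define J where "J = 1 / real G"
  have lt: "J < (1 + \<eta>) / real G" using eta G by (simp add: J_def divide_strict_right_mono)
  have "\<forall>\<^sub>F n in sequentially. \<exists>t\<in>{J..(1 + \<eta>) / real G}. \<forall>j\<in>{1..N}. \<exists>h :: int.
      \<bar>of_int (\<phi> j n) * t - real (v j y) / real G - of_int h\<bar> < \<eta> / (2 * real G)" for y
    by (rule asymp_independent_simultaneous_approx[OF ind lt]) (use eta G in simp)
  then have "\<forall>\<^sub>F n in sequentially. \<forall>y\<in>Y. \<exists>t\<in>{J..(1 + \<eta>) / real G}. \<forall>j\<in>{1..N}. \<exists>h :: int.
      \<bar>of_int (\<phi> j n) * t - real (v j y) / real G - of_int h\<bar> < \<eta> / (2 * real G)"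
    by (intro eventually_ball_finite Y ballI)
  then obtain n1 where n1: "\<And>n. n \<ge> n1 \<Longrightarrow> \<forall>y\<in>Y. \<exists>t\<in>{J..(1 + \<eta>) / real G}. \<forall>j\<in>{1..N}. \<exists>h :: int.
      \<bar>of_int (\<phi> j n) * t - real (v j y) / real G - of_int h\<bar> < \<eta> / (2 * real G)"
    by (auto simp: eventually_sequentially)
  define n where "n = max n1 (Suc nmin)"
  obtain t where t: "\<And>y. y \<in> Y \<Longrightarrow> t y \<in> {J..(1 + \<eta>) / real G}"
    "\<And>y j. y \<in> Y \<Longrightarrow> j \<in> {1..N} \<Longrightarrow> \<exists>h :: int. \<bar>of_int (\<phi> j n) * t y - real (v j y) / real G - of_int h\<bar> < \<eta> / (2 * real G)"
    using n1[of n] unfolding bchoice_iff by (metis (no_types, lifting) max.cobounded1 n_def)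
  define m where "m = (\<Sum>j\<in>{1..N}. \<bar>\<phi> j n\<bar>)"
  have m: "\<bar>\<phi> j n\<bar> \<le> m" if "j \<in> {1..N}" for j
    unfolding m_def by (rule member_le_sum[where f="\<lambda>j. \<bar>\<phi> j n\<bar>"]) (use that in auto)
  obtain W0 :: nat where W0: "2 * real_of_int m / \<eta> \<le> real W0" using real_arch_simple by blast
  define W where "W = Suc W0"
  have W: "W > 0" "real_of_int m \<le> \<eta> / 2 * W"
    using W0 eta by (auto simp: W_def field_simps)
  define e where "e y = nat (\<lfloor>t y * (G * W)\<rfloor> - int W)" for y
  have "real (e y) \<le> \<eta> * W \<and>
     (\<forall>j\<in>{1..N}. \<exists>h. \<bar>real_of_int (\<phi> j n * (int W + int (e y)) - int (v j y) * int W - h * (int G * int W))\<bar> \<le> \<eta> * W)"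
    if y: "y \<in> Y" for y
  proof -
    let ?x = "t y * (G * W)"
    have GW: "real G * real W > 0" using G W by simp
    have "J * (G * W) \<le> ?x" "?x \<le> ((1 + \<eta>) / real G) * (G * W)"
      by (rule mult_right_mono; use t(1)[OF y] in simp)+
    moreover have "J * (G * W) = W" "((1 + \<eta>) / real G) * (G * W) = (1 + \<eta>) * W"
      using G by (auto simp: J_def)
    ultimately have x1: "real W \<le> ?x" "?x \<le> (1 + \<eta>) * W" by linarith+
    then have x: "real W \<le> ?x" "?x \<le> W + \<eta> * W" by (simp_all add: distrib_right)
    then have fl: "int W \<le> \<lfloor>?x\<rfloor>" by (simp add: le_floor_iff)
    then have e: "int W + int (e y) = \<lfloor>?x\<rfloor>" by (simp add: e_def)
    have "real_of_int (int W + int (e y)) \<le> ?x" unfolding e by (rule of_int_floor_le)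
    then have "real (e y) \<le> \<eta> * W" using x by simp
    moreover have "\<exists>h. \<bar>real_of_int (\<phi> j n * (int W + int (e y)) - int (v j y) * int W - h * (int G * int W))\<bar> \<le> \<eta> * W"
      if j: "j \<in> {1..N}" for j
    proof -
      obtain h :: int where h: "\<bar>of_int (\<phi> j n) * t y - real (v j y) / real G - of_int h\<bar> < \<eta> / (2 * real G)"
        using t(2)[OF y j] by blast
      define \<delta> where "\<delta> = ?x - real_of_int \<lfloor>?x\<rfloor>"
      have d: "\<bar>\<delta>\<bar> \<le> 1" unfolding \<delta>_def by linarith
      have "real_of_int (\<phi> j n * (int W + int (e y)) - int (v j y) * int W - h * (int G * int W))
          = of_int (\<phi> j n) * real_of_int \<lfloor>?x\<rfloor> - real (v j y) * W - of_int h * (G * W)"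
        unfolding e by simp
      also have "\<dots> = (of_int (\<phi> j n) * t y - real (v j y) / real G - of_int h) * (G * W) - of_int (\<phi> j n) * \<delta>"
        using G by (simp add: \<delta>_def algebra_simps)
      also have "\<bar>\<dots>\<bar> \<le> \<bar>of_int (\<phi> j n) * t y - real (v j y) / real G - of_int h\<bar> * (G * W) + \<bar>of_int (\<phi> j n)\<bar> * \<bar>\<delta>\<bar>"
        by (rule order_trans[OF abs_triangle_ineq4]) (simp add: abs_mult)
      also have "\<dots> \<le> (\<eta> / (2 * real G)) * (G * W) + of_int m * 1"
      proof (rule add_mono)
        show "\<bar>of_int (\<phi> j n) * t y - real (v j y) / real G - of_int h\<bar> * (G * W) \<le> (\<eta> / (2 * real G)) * (G * W)"
          using h by (intro mult_right_mono) auto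
        show "\<bar>real_of_int (\<phi> j n)\<bar> * \<bar>\<delta>\<bar> \<le> of_int m * 1"
          using m[OF j] d by (intro mult_mono) linarith+
      qed
      also have "\<dots> \<le> \<eta> * W" using W(2) G by simp
      finally show ?thesis by blast
    qed
    ultimately show ?thesis by blast
  qed
  moreover have "n > nmin" by (auto simp: n_def)
  ultimately show ?thesis using W(1) by blast
qed

text \<open>
  The permutation is the rotation of \<open>G * L\<close> copies of the labelled cycle, indexed by
  \<open>(g, z)\<close>. For the index \<open>j\<close>, the copies with \<open>z < r j\<close> are to return to their position at time
  \<open>\<phi>\<^sub>j(n)\<close>, and the others are to be shifted by \<open>g\<close> arcs. The proportion of the former is \<open>r j / L\<close>,
  which approximates \<open>1 - \<lambda>\<^sub>j\<close>, and for each of the other values of \<open>z\<close> the shifts run through all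
  arcs once. Negative values of \<open>\<phi>\<^sub>j(n)\<close> are treated through the symmetry of correlations, which is
  why only \<open>\<bar>\<phi>\<^sub>j(n)\<bar>\<close> appears as an exponent.
\<close>

lemma finite_mixing_permutation:
  fixes lam :: "nat \<Rightarrow> real"
  assumes q: "q > 0" and \<pi>: "\<pi> permutes {..<q}" and ind: "asymp_independent N \<phi>"
    and lam: "\<forall>j\<in>{1..N}. lam j \<in> {0..1}" and eps: "\<epsilon> > 0"
  shows "\<exists>n>nmin. \<exists>c>0. \<exists>\<sigma>. \<sigma> permutes {..<q * c} \<and>
     real (card {i \<in> {..<q * c}. \<sigma> i div c \<noteq> \<pi> (i div c)}) \<le> \<epsilon> * real (q * c) \<and>
     (\<forall>j\<in>{1..N}. \<forall>A B. A \<subseteq> {..<q} \<longrightarrow> B \<subseteq> {..<q} \<longrightarrow>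
       \<bar>real (card {i \<in> {..<q * c}. i div c \<in> A \<and> (\<sigma> ^^ nat \<bar>\<phi> j n\<bar>) i div c \<in> B}) / real (q * c)
        - ((1 - lam j) * (real (card (A \<inter> B)) / q) + lam j * (real (card A) / q) * (real (card B) / q))\<bar> \<le> \<epsilon>)"
proof -
  define \<eta> where "\<eta> = \<epsilon> / 2"
  have eta: "\<eta> > 0" using eps by (simp add: \<eta>_def)
  \<comment> \<open>Both the pieces of the word and the fibres \<open>{g} \<times> {..<L}\<close> of the index set need length at least \<open>1/\<eta>\<close>.\<close>
  obtain L0 :: nat where L0: "1 / \<eta> \<le> real L0" using real_arch_simple by blast
  define L where "L = Suc L0"
  have L: "L > 0" "1 / real L \<le> \<eta>"
  proof -
    have "1 / \<eta> \<le> real L" using L0 by (simp add: L_def)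
    then show "1 / real L \<le> \<eta>" using eta by (simp add: L_def field_simps)
  qed (simp add: L_def)
  define G where "G = q * L"
  have G: "G > 0" using q L by (simp add: G_def)
  then have G': "real G > 0" by simp
  define Y where "Y = {..<G} \<times> {..<L}"
  have Y: "finite Y" "card Y = G * L" by (auto simp: Y_def)
  define r where "r j = nat \<lfloor>(1 - lam j) * real L\<rfloor>" for j
  have r: "r j \<le> L" "\<bar>real (r j) / L - (1 - lam j)\<bar> \<le> \<eta>" if j: "j \<in> {1..N}" for j
  proof -
    have l: "0 \<le> (1 - lam j) * real L" using bspec[OF lam j] by simp
    have l': "(1 - lam j) * real L \<le> 1 * real L" by (rule mult_right_mono) (use bspec[OF lam j] in auto)
    from l have rr: "real (r j) = of_int \<lfloor>(1 - lam j) * real L\<rfloor>" by (simp add: r_def)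
    have *: "real (r j) \<le> (1 - lam j) * real L" "(1 - lam j) * real L \<le> real (r j) + 1"
      unfolding rr by linarith+
    then show "r j \<le> L" using l' by linarith
    have "\<bar>real (r j) - (1 - lam j) * L\<bar> / L \<le> 1 / L"
      using * by (intro divide_right_mono) auto
    moreover have "\<bar>real (r j) - (1 - lam j) * L\<bar> / L = \<bar>real (r j) / L - (1 - lam j)\<bar>"
      using L(1) by (simp add: diff_divide_distrib[symmetric] abs_divide field_simps)
        (simp add: abs_divide[symmetric] diff_divide_distrib)?
    ultimately show "\<bar>real (r j) / L - (1 - lam j)\<bar> \<le> \<eta>" using L(2) by linarith
  qed
  define v where "v j y = (if snd y < r j then 0 else fst y)" for j and y :: "nat \<times> nat"
  obtain n W e where n: "n > nmin" and W: "W > 0" and e: "\<And>y. y \<in> Y \<Longrightarrow> real (e y) \<le> \<eta> / G * W"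
    and app: "\<And>y j. y \<in> Y \<Longrightarrow> j \<in> {1..N} \<Longrightarrow> \<exists>h. \<bar>real_of_int (\<phi> j n * (int W + int (e y)) - int (v j y) * int W - h * (int G * int W))\<bar> \<le> \<eta> / G * W"
    using asymp_independent_rotation_numbers[OF ind Y(1) divide_pos_pos[OF eta G'] G, of nmin v] by blast
  define Q where "Q = int (q * L) * int W"
  define F where "F p = orbit_label \<pi> q L (p div int W)" for p
  have F: "\<And>p. F p < q" unfolding F_def using orbit_label_range[OF \<pi> L(1) q] by blast
  note word = orbit_label_word[OF \<pi> q L(1) W, folded Q_def G_def, folded F_def]
  have QG: "Q = int G * int W" "Q > 0" using G W by (auto simp: Q_def G_def)
  define a where "a y = int W + int (e y)" for y
  define s where "s = (\<lambda>(y, p). (y, (p + a y) mod Q))"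
  define I where "I = Y \<times> {0..<Q}"
  define c where "c = W * L * card Y"
  have c: "c > 0" using W L G by (simp add: c_def Y)
  have qc: "q * c = G * W * (G * L)" by (simp add: c_def G_def Y)
  have fib: "card {x \<in> I. F (snd x) = i} = c" if "i < q" for i
  proof -
    have "{x \<in> I. F (snd x) = i} = Y \<times> {p \<in> {0..<Q}. F p \<in> {i}}" by (auto simp: I_def)
    then show ?thesis using word(2)[of "{i}"] that by (simp add: card_cartesian_product c_def)
  qed
  obtain \<sigma> where \<sigma>: "\<sigma> permutes {..<q * c}"
    "\<And>R m. card {i \<in> {..<q * c}. R (i div c) ((\<sigma> ^^ m) i div c)} = card {x \<in> I. R (F (snd x)) (F (snd ((s ^^ m) x)))}"
    using permutation_of_labelled_bijection[of I s "\<lambda>x. F (snd x)" q c]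
      rotation_bij[OF QG(2), of a Y] F fib c Y(1) unfolding I_def s_def by auto
  have close: "real (card {i \<in> {..<q * c}. \<sigma> i div c \<noteq> \<pi> (i div c)}) \<le> \<epsilon> * real (q * c)"
  proof -
    have "card {i \<in> {..<q * c}. \<sigma> i div c \<noteq> \<pi> (i div c)} = card {x \<in> I. F (snd (s x)) \<noteq> \<pi> (F (snd x))}"
      using \<sigma>(2)[of "\<lambda>x y. y \<noteq> \<pi> x" 1] by simp
    also have "{x \<in> I. F (snd (s x)) \<noteq> \<pi> (F (snd x))} =
        (SIGMA y:Y. {p \<in> {0..<Q}. F (p + int W + int (e y)) \<noteq> \<pi> (F p)})"
      by (auto simp: I_def s_def a_def periodic_mod[of F, OF word(1)] add.assoc)
    also have "card \<dots> = (\<Sum>y\<in>Y. card {p \<in> {0..<Q}. F (p + int W + int (e y)) \<noteq> \<pi> (F p)})"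
      by (rule card_SigmaI) (auto intro: finite_subset[of _ "{0..<Q}"] Y)
    finally have "real (card {i \<in> {..<q * c}. \<sigma> i div c \<noteq> \<pi> (i div c)}) =
        (\<Sum>y\<in>Y. real (card {p \<in> {0..<Q}. F (p + int W + int (e y)) \<noteq> \<pi> (F p)}))" by simp
    also have "\<dots> \<le> (\<Sum>y\<in>Y. \<epsilon> * (G * W))"
    proof (rule sum_mono)
      fix y assume y: "y \<in> Y"
      have "real (card {p \<in> {0..<Q}. F (p + int W + int (e y)) \<noteq> \<pi> (F p)}) \<le> real (e y * G + W * q)"
        using word(6)[of "e y"] by (simp only: of_nat_le_iff)
      also have "\<dots> = real (e y) * G + W * q * (L * (1 / L))" using L(1) by simp
      also have "\<dots> \<le> \<eta> / G * W * G + W * q * (L * (1 / L))"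
        by (intro add_right_mono mult_right_mono e[OF y]) simp
      also have "\<dots> \<le> \<eta> * W * G + W * q * (L * \<eta>)"
      proof (rule add_mono)
        have "\<eta> * W * 1 \<le> \<eta> * W * G" using eta G by (intro mult_left_mono) auto
        then show "\<eta> / G * W * G \<le> \<eta> * W * G" using G by simp
        show "W * q * (L * (1 / L)) \<le> W * q * (L * \<eta>)" using L by (intro mult_left_mono) auto
      qed
      also have "\<dots> = \<epsilon> * (G * W)" by (simp add: \<eta>_def G_def algebra_simps)
      finally show "real (card {p \<in> {0..<Q}. F (p + int W + int (e y)) \<noteq> \<pi> (F p)}) \<le> \<epsilon> * (G * W)" .
    qed
    also have "\<dots> = \<epsilon> * real (q * c)" unfolding qc by (simp add: Y(2))
    finally show ?thesis .
  qed
  \<comment> \<open>The signed exponent \<open>\<phi>\<^sub>j(n)\<close> makes sense for shifts, and here the prescribed angles enter.\<close>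
  have main: "\<bar>real (\<Sum>y\<in>Y. shift_count Q F A B (\<phi> j n * a y)) / real (q * c)
      - ((1 - lam j) * (real (card (A \<inter> B)) / q) + lam j * (real (card A) / q) * (real (card B) / q))\<bar> \<le> \<epsilon>"
    if j: "j \<in> {1..N}" and A: "A \<subseteq> {..<q}" and B: "B \<subseteq> {..<q}" for j A B
  proof -
    let ?c = "shift_count Q F A B"
    have near: "\<bar>real (?c (\<phi> j n * a y)) - real (?c (int (v j y) * int W))\<bar> \<le> \<eta> * W" if y: "y \<in> Y" for y
    proof -
      obtain h where h: "\<bar>real_of_int (\<phi> j n * a y - int (v j y) * int W - h * Q)\<bar> \<le> \<eta> / G * W"
        using app[OF y j] unfolding a_def QG(1) by blast
      have "\<bar>real (?c (\<phi> j n * a y)) - real (?c (int (v j y) * int W + h * Q))\<bar>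
          \<le> real G * \<bar>real_of_int (\<phi> j n * a y - (int (v j y) * int W + h * Q))\<bar>"
        by (rule shift_count_lipschitz[OF QG(2) word(1) word(3)])
      also have "\<dots> \<le> real G * (\<eta> / G * W)"
        using h by (intro mult_left_mono) (auto simp: algebra_simps)
      also have "\<dots> = \<eta> * W" using G by simp
      finally show ?thesis unfolding shift_count_periodic[where F=F and Q=Q, OF word(1)] .
    qed
    have "(\<Sum>y\<in>Y. ?c (int (v j y) * int W)) = (\<Sum>g<G. \<Sum>z<L. ?c (int (v j (g, z)) * int W))"
      unfolding Y_def sum.cartesian_product by (rule sum.cong) auto
    also have "\<dots> = (\<Sum>g<G. r j * ?c 0 + (L - r j) * ?c (int g * int W))"
    proof (rule sum.cong[OF refl])
      fix g
      have "{..<L} = {..<r j} \<union> {r j..<L}" using r(1)[OF j] by auto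
      then have "(\<Sum>z<L. ?c (int (v j (g, z)) * int W)) =
          (\<Sum>z\<in>{..<r j}. ?c (int (v j (g, z)) * int W)) + (\<Sum>z\<in>{r j..<L}. ?c (int (v j (g, z)) * int W))"
        by (simp add: sum.union_disjoint ivl_disj_int)
      also have "\<dots> = (\<Sum>z\<in>{..<r j}. ?c 0) + (\<Sum>z\<in>{r j..<L}. ?c (int g * int W))"
        by (intro arg_cong2[where f="(+)"] sum.cong) (auto simp: v_def)
      finally show "(\<Sum>z<L. ?c (int (v j (g, z)) * int W)) = r j * ?c 0 + (L - r j) * ?c (int g * int W)" by simp
    qed
    also have "\<dots> = G * (r j * ?c 0) + (L - r j) * (\<Sum>g<G. ?c (int g * int W))"
      by (simp add: sum.distrib sum_distrib_left)
    also have "\<dots> = G * (r j * (W * (L * card (A \<inter> B)))) + (L - r j) * (W * (L * card A) * (L * card B))"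
      unfolding word(4)[OF A B] word(5)[OF A B] ..
    finally have tot: "real (\<Sum>y\<in>Y. ?c (int (v j y) * int W)) =
        G * (r j * (W * (L * card (A \<inter> B)))) + (real L - r j) * (W * (L * card A) * (L * card B))"
      using r(1)[OF j] by (simp add: of_nat_diff)
    \<comment> \<open>\<open>\<alpha>\<close> and \<open>\<beta>\<close> are the correlations of the two kinds of copies, and \<open>x\<close> is the actual proportion of the first kind.\<close>
    define x where "x = real (r j) / L"
    define \<alpha> where "\<alpha> = real (card (A \<inter> B)) / q"
    define \<beta> where "\<beta> = (real (card A) / q) * (real (card B) / q)"
    have rx: "real (r j) = x * L" using L by (simp add: x_def)
    have cards: "real (card (A \<inter> B)) = \<alpha> * q" "real (card A) * real (card B) = \<beta> * q * q"
      using q by (auto simp: \<alpha>_def \<beta>_def)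
    have "real (\<Sum>y\<in>Y. ?c (int (v j y) * int W)) =
        G * (r j * (W * (L * real (card (A \<inter> B))))) + (real L - r j) * (W * L * L * (real (card A) * real (card B)))"
      unfolding tot by (simp add: mult_ac)
    also have "\<dots> = real (q * c) * (x * \<alpha> + (1 - x) * \<beta>)"
      unfolding cards rx qc by (simp add: G_def algebra_simps)
    finally have tgt: "real (\<Sum>y\<in>Y. ?c (int (v j y) * int W)) / real (q * c) = x * \<alpha> + (1 - x) * \<beta>"
      using q c by simp
    have "\<bar>real (\<Sum>y\<in>Y. ?c (\<phi> j n * a y)) - real (\<Sum>y\<in>Y. ?c (int (v j y) * int W))\<bar> \<le> (\<Sum>y\<in>Y. \<eta> * W)"
      unfolding of_nat_sum sum_subtractf[symmetric] by (rule order_trans[OF sum_abs sum_mono[OF near]])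
    also have "\<dots> \<le> \<eta> * real (q * c)"
    proof -
      have "real W * 1 \<le> real W * real G" using G by (intro mult_left_mono) auto
      then have "\<eta> * (real (card Y) * W) \<le> \<eta> * (real (card Y) * (real W * real G))"
        using eta by (intro mult_left_mono) auto
      then show ?thesis unfolding qc by (simp add: Y mult_ac)
    qed
    finally have "\<bar>real (\<Sum>y\<in>Y. ?c (\<phi> j n * a y)) - real (\<Sum>y\<in>Y. ?c (int (v j y) * int W))\<bar> / real (q * c) \<le> \<eta>"
      using q c by (simp add: field_simps)
    then have 1: "\<bar>real (\<Sum>y\<in>Y. ?c (\<phi> j n * a y)) / real (q * c) - (x * \<alpha> + (1 - x) * \<beta>)\<bar> \<le> \<eta>"
      unfolding tgt[symmetric] by (simp only: diff_divide_distrib[symmetric] abs_divide abs_of_nat)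
    have cle: "card (A \<inter> B) \<le> q" "card A \<le> q" "card B \<le> q"
      using card_mono[of "{..<q}"] A B by (auto simp: le_infI1)
    then have u: "real (card (A \<inter> B)) / q \<le> 1" "real (card A) / q \<le> 1" "real (card B) / q \<le> 1"
      using q by simp_all
    have "0 \<le> \<alpha>" "0 \<le> \<beta>" by (simp_all add: \<alpha>_def \<beta>_def)
    moreover have "\<alpha> \<le> 1" using u(1) by (simp only: \<alpha>_def)
    moreover have "\<beta> \<le> 1" unfolding \<beta>_def by (rule mult_le_one) (use u in simp_all)
    ultimately have "\<bar>\<alpha> - \<beta>\<bar> \<le> 1" by linarith
    then have "\<bar>(x - (1 - lam j)) * (\<alpha> - \<beta>)\<bar> \<le> \<eta> * 1"
      unfolding abs_mult using r(2)[OF j] eta by (intro mult_mono) (auto simp: x_def)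
    moreover have "(x * \<alpha> + (1 - x) * \<beta>) - ((1 - lam j) * \<alpha> + lam j * \<beta>) = (x - (1 - lam j)) * (\<alpha> - \<beta>)"
      by (simp add: algebra_simps)
    ultimately have 2: "\<bar>(x * \<alpha> + (1 - x) * \<beta>) - ((1 - lam j) * \<alpha> + lam j * \<beta>)\<bar> \<le> \<eta>" by simp
    have tri: "\<bar>X - Z\<bar> \<le> \<epsilon>" if "\<bar>X - Y\<bar> \<le> \<eta>" "\<bar>Y - Z\<bar> \<le> \<eta>" for X Y Z :: real
      using that unfolding \<eta>_def by linarith
    have "\<bar>real (\<Sum>y\<in>Y. ?c (\<phi> j n * a y)) / real (q * c) - ((1 - lam j) * \<alpha> + lam j * \<beta>)\<bar> \<le> \<epsilon>"
      by (rule tri[OF 1 2])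
    then show ?thesis by (simp add: \<alpha>_def \<beta>_def mult.assoc)
  qed
  have "\<bar>real (card {i \<in> {..<q * c}. i div c \<in> A \<and> (\<sigma> ^^ nat \<bar>\<phi> j n\<bar>) i div c \<in> B}) / real (q * c)
        - ((1 - lam j) * (real (card (A \<inter> B)) / q) + lam j * (real (card A) / q) * (real (card B) / q))\<bar> \<le> \<epsilon>"
    if j: "j \<in> {1..N}" and A: "A \<subseteq> {..<q}" and B: "B \<subseteq> {..<q}" for j A B
  proof -
    have eq: "card {i \<in> {..<q * c}. i div c \<in> A \<and> (\<sigma> ^^ nat \<bar>\<phi> j n\<bar>) i div c \<in> B} =
        (\<Sum>y\<in>Y. shift_count Q F A B (\<bar>\<phi> j n\<bar> * a y))"
      using \<sigma>(2)[of "\<lambda>x y. x \<in> A \<and> y \<in> B" "nat \<bar>\<phi> j n\<bar>"]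
        rotation_bundle_correlation[where F=F and Q=Q and A=A and B=B and a=a and m="nat \<bar>\<phi> j n\<bar>", OF QG(2) word(1) Y(1)]
      by (simp add: I_def s_def)
    show ?thesis
    proof (cases "\<phi> j n \<ge> 0")
      case True
      then show ?thesis unfolding eq using main[OF j A B] by simp
    next
      case False
      then have "shift_count Q F A B (\<bar>\<phi> j n\<bar> * a y) = shift_count Q F B A (\<phi> j n * a y)" for y
        using shift_count_swap[where F=F and Q=Q and s="\<phi> j n * a y" and A=A and B=B, OF QG(2) word(1)] by simp
      then show ?thesis unfolding eq using main[OF j B A] by (simp add: Int_commute mult_ac)
    qed
  qed
  then show ?thesis using n c \<sigma>(1) close by blast
qed

section \<open>Interval permutations\<close>

definition block :: "nat \<Rightarrow> real \<Rightarrow> nat" where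
  "block q x = nat \<lfloor>real q * x\<rfloor>"

lemma block_iff:
  assumes "q > 0" "0 \<le> x"
  shows "block q x = i \<longleftrightarrow> real i / q \<le> x \<and> x < real (i + 1) / q"
proof -
  have "0 \<le> \<lfloor>real q * x\<rfloor>" using assms by simp
  then have "block q x = i \<longleftrightarrow> \<lfloor>real q * x\<rfloor> = int i" unfolding block_def by linarith
  also have "\<dots> \<longleftrightarrow> real i \<le> real q * x \<and> real q * x < real i + 1" by (simp add: floor_eq_iff)
  also have "\<dots> \<longleftrightarrow> real i / q \<le> x \<and> x < real (i + 1) / q"
    using assms by (simp add: field_simps)
  finally show ?thesis .
qed

lemma block_bounds:
  assumes "q > 0" "0 \<le> x"
  shows "real (block q x) / q \<le> x" "x < real (block q x + 1) / q"
  using block_iff[OF assms, of "block q x"] by auto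

lemma block_less:
  assumes "q > 0" "0 \<le> x" "x < 1" shows "block q x < q"
proof -
  have "real (block q x) / q < 1" using block_bounds(1)[OF assms(1,2)] assms by linarith
  then show ?thesis using assms by simp
qed

lemma block_div:
  assumes "c > 0" "0 \<le> x" shows "block q x = block (q * c) x div c"
proof -
  have "\<lfloor>real q * x\<rfloor> = \<lfloor>(real (q * c) * x) / real_of_int (int c)\<rfloor>" using assms by simp
  also have "\<dots> = \<lfloor>real (q * c) * x\<rfloor> div int c" by (rule floor_divide_real_eq_div) simp
  finally show ?thesis using assms by (simp add: block_def nat_div_distrib)
qed

lemma block_measurable [measurable]: "block q \<in> measurable borel (count_space UNIV)"
  unfolding block_def by measurable

lemma block_measurable_unit [measurable]: "block q \<in> measurable unit_leb (count_space UNIV)"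
  unfolding unit_leb_def by (rule measurable_restrict_space1) simp

lemma same_block_close:
  assumes "q > 0" "0 \<le> x" "0 \<le> y" "block q x = block q y" shows "\<bar>x - y\<bar> \<le> 1 / q"
  using block_bounds[OF assms(1,2)] block_bounds[OF assms(1,3)] assms(4)
  by (simp add: add_divide_distrib abs_le_iff)

lemma mu_singleton_1: "mu {1} = 0" "{1} \<in> sets unit_leb"
  by (simp_all add: measure_unit_leb sets_unit_leb_iff)

lemma null_sets_singleton_1: "{1} \<in> null_sets unit_leb"
  using mu_singleton_1 by (simp add: null_sets_def unit_leb.emeasure_eq_measure)

lemma AE_neq_1: "AE x in unit_leb. x \<noteq> 1"
  using AE_not_in[OF null_sets_singleton_1] by simp

lemma block_interval_01:
  fixes i q :: nat
  assumes "i < q" "x \<in> {real i / q..<real (i + 1) / q}"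
  shows "0 \<le> x" "x < 1"
proof -
  have "0 \<le> real i / q" "real (i + 1) / q \<le> 1" using assms(1) by simp_all
  moreover have "real i / q \<le> x" "x < real (i + 1) / q" using assms(2) by simp_all
  ultimately show "0 \<le> x" "x < 1" by linarith+
qed

lemma mu_block_interval:
  fixes i q :: nat
  assumes "i < q" shows "mu {real i / q..<real (i + 1) / q} = 1 / q"
proof -
  have "{real i / q..<real (i + 1) / q} \<subseteq> {0..1}"
    using block_interval_01[OF assms] by (meson atLeastAtMost_iff less_imp_le subsetI)
  moreover have "real i / q \<le> real (i + 1) / q" by (rule divide_right_mono) auto
  ultimately show ?thesis by (simp add: measure_unit_leb diff_divide_distrib[symmetric])
qed

text \<open>
  The blocks leave out the point \<open>1\<close>, a null set.
\<close>

lemma mu_block_sum: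
  assumes q: "q > 0" and B: "B \<in> sets unit_leb"
  shows "mu B = (\<Sum>i<q. mu (B \<inter> {real i / q..<real (i + 1) / q}))"
proof -
  let ?J = "\<lambda>i. {real i / q..<real (i + 1) / q}"
  have Bs: "B \<in> sets borel" "B \<subseteq> {0..1}" using B by (auto simp: sets_unit_leb_iff)
  have BJ: "B \<inter> ?J i \<in> sets unit_leb" for i using Bs by (auto simp: sets_unit_leb_iff)
  have "B - {1} = (\<Union>i<q. B \<inter> ?J i)"
  proof (intro equalityI subsetI)
    fix x assume x: "x \<in> B - {1}"
    then have "0 \<le> x" "x < 1" using Bs by force+
    then have "block q x < q" "x \<in> ?J (block q x)" using block_less block_bounds q by auto
    then show "x \<in> (\<Union>i<q. B \<inter> ?J i)" using x by blast
  next
    fix x assume "x \<in> (\<Union>i<q. B \<inter> ?J i)"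
    then obtain i where i: "i < q" "x \<in> B" "x < real (i + 1) / q" by auto
    have "real (i + 1) / q \<le> 1" using i(1) by simp
    then show "x \<in> B - {1}" using i by auto
  qed
  moreover have "mu (\<Union>i<q. B \<inter> ?J i) = (\<Sum>i<q. mu (B \<inter> ?J i))"
  proof (rule unit_leb.finite_measure_finite_Union)
    show "disjoint_family_on (\<lambda>i. B \<inter> ?J i) {..<q}"
      unfolding disjoint_family_on_def
    proof (intro ballI impI)
      fix i j :: nat assume "i \<noteq> j"
      have False if x: "x \<in> B \<inter> ?J i" "x \<in> B \<inter> ?J j" for x
      proof -
        have "0 \<le> x" using x Bs by force
        then have "block q x = i" "block q x = j" using x block_iff[OF q] by auto
        then show False using \<open>i \<noteq> j\<close> by simp
      qed
      then show "(B \<inter> ?J i) \<inter> (B \<inter> ?J j) = {}" by blast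
    qed
  qed (use BJ in auto)
  moreover have "mu (B - {1}) = mu B" by (rule measure_Diff_null_set[OF B null_sets_singleton_1])
  ultimately show ?thesis by simp
qed

lemma block_set_in_sets: "{x \<in> {0..<1}. block q x \<in> H} \<in> sets unit_leb"
proof -
  have "{x \<in> space unit_leb. block q x \<in> H \<and> x \<noteq> 1} \<in> sets unit_leb" by measurable
  also have "{x \<in> space unit_leb. block q x \<in> H \<and> x \<noteq> 1} = {x \<in> {0..<1}. block q x \<in> H}" by auto
  finally show ?thesis .
qed

lemma mu_block_set:
  assumes q: "q > 0" and H: "H \<subseteq> {..<q}"
  shows "mu {x \<in> {0..<1}. block q x \<in> H} = real (card H) / q"
proof -
  let ?J = "\<lambda>i. {real i / q..<real (i + 1) / q}"
  have J01: "x \<in> {0..<1}" if "i < q" "x \<in> ?J i" for x i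
    using block_interval_01[OF that] by simp
  have "mu {x \<in> {0..<1}. block q x \<in> H} = (\<Sum>i<q. mu ({x \<in> {0..<1}. block q x \<in> H} \<inter> ?J i))"
    by (rule mu_block_sum[OF q block_set_in_sets])
  also have "\<dots> = (\<Sum>i<q. if i \<in> H then 1 / q else 0)"
  proof (rule sum.cong[OF refl])
    fix i assume i: "i \<in> {..<q}"
    have "x \<in> {x \<in> {0..<1}. block q x \<in> H} \<inter> ?J i \<longleftrightarrow> x \<in> (if i \<in> H then ?J i else {})" for x
    proof (cases "x \<in> ?J i")
      case True
      then have "x \<in> {0..<1}" using J01 i by blast
      moreover from this True have "block q x = i" using block_iff[OF q] by simp
      ultimately show ?thesis using True by simp
    next
      case False
      then show ?thesis by (cases "i \<in> H") (simp_all only: Int_iff if_True if_False empty_iff simp_thms)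
    qed
    then have "{x \<in> {0..<1}. block q x \<in> H} \<inter> ?J i = (if i \<in> H then ?J i else {})" by blast
    then show "mu ({x \<in> {0..<1}. block q x \<in> H} \<inter> ?J i) = (if i \<in> H then 1 / q else 0)"
      using mu_block_interval i by auto
  qed
  also have "\<dots> = (\<Sum>i\<in>{..<q} \<inter> H. 1 / q)" by (rule sum.inter_restrict[symmetric]) simp
  also have "{..<q} \<inter> H = H" using H by blast
  finally show ?thesis by simp
qed

text \<open>
  The interval \<open>[i/q, (i+1)/q)\<close> is translated onto the one with number \<open>\<sigma> i\<close>; the remaining point \<open>1\<close> is
  fixed.
\<close>

definition interval_perm :: "nat \<Rightarrow> (nat \<Rightarrow> nat) \<Rightarrow> real \<Rightarrow> real" where
  "interval_perm q \<sigma> x =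
     (if 0 \<le> x \<and> x < 1 then x + (real (\<sigma> (block q x)) - real (block q x)) / q else x)"

lemma interval_perm_block:
  assumes q: "q > 0" and \<sigma>: "\<sigma> permutes {..<q}" and x: "0 \<le> x" "x < 1"
  shows "0 \<le> interval_perm q \<sigma> x" "interval_perm q \<sigma> x < 1"
    "block q (interval_perm q \<sigma> x) = \<sigma> (block q x)"
proof -
  let ?b = "block q x" and ?y = "interval_perm q \<sigma> x"
  have y: "?y = x + (real (\<sigma> ?b) - real ?b) / q" using x by (simp add: interval_perm_def)
  have s: "\<sigma> ?b < q" using permutes_in_image[OF \<sigma>, of ?b] block_less[OF q x] by simp
  have l: "real (\<sigma> ?b) / q \<le> ?y" and u: "?y < real (\<sigma> ?b + 1) / q"
    unfolding y using block_bounds[OF q x(1)] by (simp_all add: add_divide_distrib diff_divide_distrib)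
  show "0 \<le> ?y" by (rule order_trans[OF _ l]) simp
  then show "block q ?y = \<sigma> ?b" using l u block_iff[OF q] by blast
  have "real (\<sigma> ?b + 1) / q \<le> 1" using s by simp
  then show "?y < 1" using u by linarith
qed

lemma interval_perm_inverse:
  assumes q: "q > 0" and \<sigma>: "\<sigma> permutes {..<q}"
  shows "interval_perm q (inv \<sigma>) (interval_perm q \<sigma> x) = x"
proof (cases "0 \<le> x \<and> x < 1")
  case True
  then have y: "0 \<le> interval_perm q \<sigma> x" "interval_perm q \<sigma> x < 1"
    "block q (interval_perm q \<sigma> x) = \<sigma> (block q x)" using interval_perm_block[OF q \<sigma>] by blast+
  have "interval_perm q (inv \<sigma>) (interval_perm q \<sigma> x) =
      interval_perm q \<sigma> x + (real (inv \<sigma> (\<sigma> (block q x))) - real (\<sigma> (block q x))) / q"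
    using y by (simp add: interval_perm_def[of q "inv \<sigma>"])
  also have "inv \<sigma> (\<sigma> (block q x)) = block q x" by (rule permutes_inverses(2)[OF \<sigma>])
  finally show ?thesis using True by (simp add: interval_perm_def diff_divide_distrib)
next
  case False
  then show ?thesis by (auto simp: interval_perm_def)
qed

lemma interval_perm_measurable:
  assumes q: "q > 0" and \<sigma>: "\<sigma> permutes {..<q}"
  shows "interval_perm q \<sigma> \<in> measurable unit_leb unit_leb"
  unfolding measurable_to_unit_leb
proof
  show "interval_perm q \<sigma> \<in> borel_measurable unit_leb"
  proof -
    have [measurable]: "(\<lambda>x. real (\<sigma> (block q x))) \<in> borel_measurable unit_leb"
      "(\<lambda>x. real (block q x)) \<in> borel_measurable unit_leb"
      by (rule measurable_compose[OF block_measurable_unit], simp)+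
    have "(\<lambda>x. x + (real (\<sigma> (block q x)) - real (block q x)) / q) \<in> borel_measurable unit_leb"
      by (intro borel_measurable_add borel_measurable_divide borel_measurable_diff) measurable
    moreover have "{x \<in> space unit_leb. 0 \<le> x \<and> x < 1} \<in> sets unit_leb"
      by (auto simp: sets_unit_leb_iff)
    ultimately show ?thesis
      unfolding interval_perm_def by (intro measurable_If measurable_id_unit_leb)
  qed
  show "interval_perm q \<sigma> \<in> space unit_leb \<rightarrow> {0..1}"
  proof
    fix x assume x: "x \<in> space unit_leb"
    show "interval_perm q \<sigma> x \<in> {0..1}"
    proof (cases "x < 1")
      case True
      then show ?thesis using interval_perm_block[OF q \<sigma>, of x] x by auto
    qed (use x in \<open>auto simp: interval_perm_def\<close>)
  qed
qed

lemma mptI: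
  assumes f: "f \<in> measurable unit_leb unit_leb"
    and eq: "\<And>A. A \<in> sets unit_leb \<Longrightarrow> mu {x \<in> {0..1}. f x \<in> A} = mu A"
  shows "f \<in> mpt"
proof -
  have "distr unit_leb unit_leb f = unit_leb"
  proof (rule measure_eqI)
    fix A assume "A \<in> sets (distr unit_leb unit_leb f)"
    then have A: "A \<in> sets unit_leb" by simp
    have "f -` A \<inter> space unit_leb = {x \<in> {0..1}. f x \<in> A}" by auto
    then show "emeasure (distr unit_leb unit_leb f) A = emeasure unit_leb A"
      using A f eq[OF A] by (simp add: emeasure_distr unit_leb.emeasure_eq_measure)
  qed simp
  then show ?thesis using f by (simp add: mpt_def)
qed

lemma interval_perm_mpt:
  assumes q: "q > 0" and \<sigma>: "\<sigma> permutes {..<q}"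
  shows "interval_perm q \<sigma> \<in> mpt"
proof (rule mptI[OF interval_perm_measurable[OF q \<sigma>]])
  fix A assume A: "A \<in> sets unit_leb"
  then have Ab: "A \<in> sets borel" by (simp add: sets_unit_leb_iff)
  let ?T = "interval_perm q \<sigma>"
  let ?J = "\<lambda>i. {real i / q..<real (i + 1) / q}"
  let ?P = "{x \<in> {0..1}. ?T x \<in> A}"
  have P: "?P \<in> sets unit_leb"
    using measurable_sets[OF interval_perm_measurable[OF q \<sigma>] A] by (simp add: vimage_def Int_def conj_commute)
  have piece: "mu (?P \<inter> ?J i) = mu (A \<inter> ?J (\<sigma> i))" if i: "i < q" for i
  proof -
    have s: "\<sigma> i < q" using permutes_in_image[OF \<sigma>, of i] i by simp
    define c where "c = (real (\<sigma> i) - real i) / q"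
    have J01: "0 \<le> x \<and> x < 1" if "x \<in> ?J k" "k < q" for x k
      using block_interval_01[OF that(2,1)] by simp
    have T: "?T x = c + x" if "x \<in> ?J i" for x
    proof -
      have x: "0 \<le> x" "x < 1" using J01[OF that i] by auto
      then have "block q x = i" using block_iff[OF q] that by auto
      then show ?thesis using x by (simp add: interval_perm_def c_def)
    qed
    have J: "x \<in> ?J i \<longleftrightarrow> c + x \<in> ?J (\<sigma> i)" for x
      by (simp add: c_def add_divide_distrib diff_divide_distrib) linarith
    have "?P \<inter> ?J i = (+) c -` (A \<inter> ?J (\<sigma> i))"
    proof (intro set_eqI iffI)
      fix x assume x: "x \<in> ?P \<inter> ?J i"
      then show "x \<in> (+) c -` (A \<inter> ?J (\<sigma> i))" using T[of x] J[of x] by simp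
    next
      fix x assume x: "x \<in> (+) c -` (A \<inter> ?J (\<sigma> i))"
      then have xi: "x \<in> ?J i" using J[of x] by blast
      then show "x \<in> ?P \<inter> ?J i" using x T[OF xi] J01[OF xi i] by auto
    qed
    moreover have "measure lborel ((+) c -` (A \<inter> ?J (\<sigma> i))) = measure lborel (A \<inter> ?J (\<sigma> i))"
    proof -
      have "measure (distr lborel borel ((+) c)) (A \<inter> ?J (\<sigma> i)) = measure lborel ((+) c -` (A \<inter> ?J (\<sigma> i)) \<inter> space lborel)"
        by (rule measure_distr) (use Ab in auto)
      then show ?thesis by (simp add: lborel_distr_plus)
    qed
    moreover have "mu (?P \<inter> ?J i) = measure lborel (?P \<inter> ?J i)" by (rule measure_unit_leb) auto
    moreover have "mu (A \<inter> ?J (\<sigma> i)) = measure lborel (A \<inter> ?J (\<sigma> i))"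
      by (rule measure_unit_leb) (use A in \<open>auto simp: sets_unit_leb_iff\<close>)
    ultimately show ?thesis by simp
  qed
  have "mu ?P = (\<Sum>i<q. mu (?P \<inter> ?J i))" by (rule mu_block_sum[OF q P])
  also have "\<dots> = (\<Sum>i<q. mu (A \<inter> ?J (\<sigma> i)))" by (rule sum.cong) (use piece in auto)
  also have "\<dots> = (\<Sum>i<q. mu (A \<inter> ?J i))"
    by (rule sum.reindex_bij_betw[OF permutes_imp_bij[OF \<sigma>]])
  also have "\<dots> = mu A" by (rule mu_block_sum[OF q A, symmetric])
  finally show "mu ?P = mu A" .
qed

lemma interval_perm_inv_mpt:
  assumes q: "q > 0" and \<sigma>: "\<sigma> permutes {..<q}"
  shows "interval_perm q \<sigma> \<in> inv_mpt"
proof -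
  let ?T = "interval_perm q \<sigma>" and ?R = "interval_perm q (inv \<sigma>)"
  have \<sigma>': "inv \<sigma> permutes {..<q}" by (rule permutes_inv[OF \<sigma>])
  have RT: "?R (?T x) = x" "?T (?R x) = x" for x
    using interval_perm_inverse[OF q \<sigma>] interval_perm_inverse[OF q \<sigma>'] by (simp_all add: permutes_inv_inv[OF \<sigma>])
  have m: "?T \<in> measurable unit_leb unit_leb" "?R \<in> measurable unit_leb unit_leb"
    using interval_perm_measurable q \<sigma> \<sigma>' by blast+
  have r: "x \<in> {0..1} \<Longrightarrow> ?T x \<in> {0..1}" "x \<in> {0..1} \<Longrightarrow> ?R x \<in> {0..1}" for x
    using interval_perm_mpt[OF q \<sigma>] interval_perm_mpt[OF q \<sigma>'] mpt_range by blast+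
  have b: "bij_betw ?T {0..1} {0..1}"
    by (rule bij_betw_byWitness[where f'="?R"]) (use RT r in auto)
  have "inv_into {0..1} ?T x = ?R x" if "x \<in> {0..1}" for x
    using bij_betw_imp_inj_on[OF b] r(2)[OF that] RT(2) by (rule inv_into_f_eq)
  then have "inv_into {0..1} ?T \<in> measurable unit_leb unit_leb"
    using m(2) by (subst measurable_cong[of _ _ ?R]) auto
  then show ?thesis using b m mptD(3)[OF interval_perm_mpt[OF q \<sigma>]] by (simp add: inv_mpt_def)
qed

lemma interval_perm_funpow:
  assumes q: "q > 0" and \<sigma>: "\<sigma> permutes {..<q}" and x: "0 \<le> x" "x < 1"
  shows "0 \<le> (interval_perm q \<sigma> ^^ m) x \<and> (interval_perm q \<sigma> ^^ m) x < 1 \<and>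
    block q ((interval_perm q \<sigma> ^^ m) x) = (\<sigma> ^^ m) (block q x)"
proof (induction m)
  case (Suc m)
  then show ?case using interval_perm_block[OF q \<sigma>, of "(interval_perm q \<sigma> ^^ m) x"] by simp
qed (use x in simp)

lemma interval_perm_correlation:
  assumes q: "q > 0" and c: "c > 0" and \<sigma>: "\<sigma> permutes {..<q * c}"
  shows "mu {x \<in> {0..<1}. block q x \<in> A \<and> (interval_perm (q * c) \<sigma> ^^ m) x \<in> {0..<1} \<and>
       block q ((interval_perm (q * c) \<sigma> ^^ m) x) \<in> B}
     = real (card {i \<in> {..<q * c}. i div c \<in> A \<and> (\<sigma> ^^ m) i div c \<in> B}) / real (q * c)"
proof -
  have qc: "q * c > 0" using q c by simp
  let ?H = "{i \<in> {..<q * c}. i div c \<in> A \<and> (\<sigma> ^^ m) i div c \<in> B}"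
  have "{x \<in> {0..<1}. block q x \<in> A \<and> (interval_perm (q * c) \<sigma> ^^ m) x \<in> {0..<1} \<and>
       block q ((interval_perm (q * c) \<sigma> ^^ m) x) \<in> B} = {x \<in> {0..<1}. block (q * c) x \<in> ?H}"
    (is "?L = ?R")
  proof (rule set_eqI)
    fix x
    show "x \<in> ?L \<longleftrightarrow> x \<in> ?R"
    proof (cases "x \<in> {0..<1}")
      case True
      then have x: "0 \<le> x" "x < 1" by auto
      note y = interval_perm_funpow[OF qc \<sigma> x, of m]
      show ?thesis
        using x y block_div[OF c x(1), of q] block_less[OF qc x]
          block_div[OF c, of "(interval_perm (q * c) \<sigma> ^^ m) x" q] by simp
    qed auto
  qed
  then show ?thesis using mu_block_set[OF qc, of ?H] by auto
qed

text \<open>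
  Two points in the same long interval are at distance at most \<open>1/q\<close>, and the points whose long
  intervals differ are counted by the second term.
\<close>

lemma interval_perm_lift_close:
  assumes q: "q > 0" and c: "c > 0" and \<pi>: "\<pi> permutes {..<q}" and \<sigma>: "\<sigma> permutes {..<q * c}"
  shows "L1_dist (interval_perm (q * c) \<sigma>) (interval_perm q \<pi>)
    \<le> 1 / q + real (card {i \<in> {..<q * c}. \<sigma> i div c \<noteq> \<pi> (i div c)}) / real (q * c)"
proof -
  have qc: "q * c > 0" using q c by simp
  let ?S = "interval_perm (q * c) \<sigma>" and ?T = "interval_perm q \<pi>"
  let ?H = "{i \<in> {..<q * c}. \<sigma> i div c \<noteq> \<pi> (i div c)}"
  let ?X = "{x \<in> {0..<1}. block (q * c) x \<in> ?H}"
  have X: "?X \<in> sets unit_leb" by (rule block_set_in_sets)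
  have le: "\<bar>?S x - ?T x\<bar> \<le> 1 / q + indicator ?X x" if x: "x \<in> {0..1}" for x
  proof (cases "x < 1")
    case True
    then have x: "0 \<le> x" "x < 1" using x by auto
    note S = interval_perm_block[OF qc \<sigma> x] and T = interval_perm_block[OF q \<pi> x]
    show ?thesis
    proof (cases "x \<in> ?X")
      case True
      have "\<bar>?S x - ?T x\<bar> \<le> 1" using S T by linarith
      moreover have "0 \<le> 1 / real q" by simp
      ultimately show ?thesis using True by (simp only: indicator_simps)
    next
      case False
      then have "\<sigma> (block (q * c) x) div c = \<pi> (block (q * c) x div c)"
        using x block_less[OF qc x] by auto
      then have "block q (?S x) = block q (?T x)"
        using block_div[OF c S(1), of q] block_div[OF c x(1), of q] S(3) T(3) by simp
      then have "\<bar>?S x - ?T x\<bar> \<le> 1 / q" by (rule same_block_close[OF q S(1) T(1)])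
      then show ?thesis by (simp add: indicator_def)
    qed
  next
    case False
    then show ?thesis by (simp add: interval_perm_def)
  qed
  have int: "integrable unit_leb (indicator ?X :: real \<Rightarrow> real)"
    using X by (simp add: unit_leb.emeasure_finite less_top[symmetric])
  have "L1_dist ?S ?T \<le> (\<integral>x. 1 / q + indicator ?X x \<partial>unit_leb)"
    unfolding L1_dist_def
    by (rule integral_mono)
      (use le int mpt_diff_integrable[OF interval_perm_measurable[OF qc \<sigma>] interval_perm_measurable[OF q \<pi>]] in auto)
  also have "\<dots> = 1 / q + mu ?X"
    using int X sets.sets_into_space[OF X] by (simp add: Int_absorb2)
  also have "mu ?X = real (card ?H) / real (q * c)" by (rule mu_block_set[OF qc]) auto
  finally show ?thesis .
qed

section \<open>Dyadic approximation\<close>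

definition dyadic_set :: "nat \<Rightarrow> nat set \<Rightarrow> real set" where
  "dyadic_set K J = {x \<in> {0..<1}. block (2 ^ K) x \<in> J}"

lemma dyadic_set_in_sets [simp]: "dyadic_set K J \<in> sets unit_leb"
  unfolding dyadic_set_def by (rule block_set_in_sets)

text \<open>
  Dyadic sets are dense in the measure algebra. Approximability at all sufficiently
  fine levels, rather than at one level, makes several approximations available at a common level.
\<close>

lemma dyadic_set_approx:
  assumes B: "B \<in> sets borel"
  shows "\<forall>\<epsilon>>0. \<exists>K0. \<forall>K\<ge>K0. \<exists>J\<subseteq>{..<2^K}. mu (sym_diff ({0..1} \<inter> B) (dyadic_set K J)) < \<epsilon>"
proof -
  have I: "{0..1} \<inter> C \<in> sets unit_leb" if "C \<in> sets borel" for C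
    using that by (auto simp: sets_unit_leb_iff)
  have sd: "sym_diff ({0..1} \<inter> C) (dyadic_set K J) \<in> sets unit_leb" if "C \<in> sets borel" for C K J
    using I[OF that] by (intro sets.Un sets.Diff) auto
  have "B \<in> sigma_sets UNIV (range (\<lambda>a::real. {..a}))" using B sets_borel_atMost by simp
  then show ?thesis
  proof (induction B rule: sigma_sets_induct_disjoint[OF atMost_generator, consumes 1, case_names basic empty compl union])
    case (basic B)
    then obtain a where a: "B = {..a}" by auto
    show ?case
    proof (intro allI impI)
      fix \<epsilon> :: real assume e: "\<epsilon> > 0"
      obtain K0 where K0: "(1/2 :: real) ^ K0 < \<epsilon> / 2"
        using real_arch_pow_inv[of "\<epsilon>/2" "1/2"] e by auto
      show "\<exists>K0. \<forall>K\<ge>K0. \<exists>J\<subseteq>{..<2^K}. mu (sym_diff ({0..1} \<inter> B) (dyadic_set K J)) < \<epsilon>"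
      proof (intro exI[of _ K0] allI impI)
        fix K assume K: "K \<ge> K0"
        define q :: nat where "q = 2 ^ K"
        have q: "q > 0" by (simp add: q_def)
        \<comment> \<open>the blocks inside the half-line; at most the block that contains \<open>a\<close> is lost\<close>
        define J where "J = {i. i < q \<and> real (i + 1) / q \<le> a}"
        let ?I = "{0..1} \<inter> {a - 1/q..a + 1/q}"
        have "sym_diff ({0..1} \<inter> B) (dyadic_set K J) \<subseteq> ?I \<union> {1}"
        proof
          fix x assume x: "x \<in> sym_diff ({0..1} \<inter> B) (dyadic_set K J)"
          then have x01: "x \<in> {0..1}" by (auto simp: dyadic_set_def)
          show "x \<in> ?I \<union> {1}"
          proof (cases "x = 1")
            case False
            then have x': "0 \<le> x" "x < 1" using x01 by auto
            note b = block_bounds[OF q x'(1)] and bl = block_less[OF q x']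
            have "real (block q x + 1) / q = real (block q x) / q + 1 / q" by (simp add: add_divide_distrib)
            moreover have "x \<le> a \<longleftrightarrow> \<not> real (block q x + 1) / q \<le> a"
              using x x' x01 bl unfolding a dyadic_set_def q_def[symmetric] J_def by auto
            ultimately have "a - 1/q \<le> x" "x \<le> a + 1/q" using b by linarith+
            then show ?thesis using x01 by auto
          qed simp
        qed
        then have "mu (sym_diff ({0..1} \<inter> B) (dyadic_set K J)) \<le> mu (?I \<union> {1})"
          by (rule unit_leb.finite_measure_mono) (auto simp: sets_unit_leb_iff)
        also have "\<dots> \<le> mu ?I + mu {1}" by (rule measure_Un_le) (auto simp: sets_unit_leb_iff)
        also have "\<dots> \<le> 2 * (1/q)" using mu_Icc_le[of "1/q" a] mu_singleton_1 by simp
        also have "\<dots> = 2 * (1/2)^K" by (simp add: q_def power_divide)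
        also have "\<dots> \<le> 2 * (1/2)^K0" using K by (intro mult_left_mono power_decreasing) auto
        also have "\<dots> < \<epsilon>" using K0 by simp
        finally show "\<exists>J\<subseteq>{..<2^K}. mu (sym_diff ({0..1} \<inter> B) (dyadic_set K J)) < \<epsilon>"
          by (intro exI[of _ J]) (auto simp: J_def q_def)
      qed
    qed
  next
    case empty
    show ?case by (auto simp: dyadic_set_def intro!: exI[of _ 0] exI[of _ "{}"])
  next
    case (compl A)
    have Ab: "A \<in> sets borel" using compl(1) sets_borel_atMost by simp
    show ?case
    proof (intro allI impI)
      fix \<epsilon> :: real assume e: "\<epsilon> > 0"
      obtain K0 where K0: "\<And>K. K \<ge> K0 \<Longrightarrow> \<exists>J\<subseteq>{..<2^K}. mu (sym_diff ({0..1} \<inter> A) (dyadic_set K J)) < \<epsilon>"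
        using compl(2) e by blast
      show "\<exists>K0. \<forall>K\<ge>K0. \<exists>J\<subseteq>{..<2^K}. mu (sym_diff ({0..1} \<inter> (UNIV - A)) (dyadic_set K J)) < \<epsilon>"
      proof (intro exI[of _ K0] allI impI)
        fix K assume K: "K \<ge> K0"
        obtain J where J: "J \<subseteq> {..<2^K}" "mu (sym_diff ({0..1} \<inter> A) (dyadic_set K J)) < \<epsilon>"
          using K0[OF K] by blast
        \<comment> \<open>Complements are taken in \<open>[0,1]\<close> and in \<open>[0,1)\<close> respectively, hence the point \<open>1\<close>.\<close>
        have "sym_diff ({0..1} \<inter> (UNIV - A)) (dyadic_set K ({..<2^K} - J)) \<subseteq> sym_diff ({0..1} \<inter> A) (dyadic_set K J) \<union> {1}"
        proof
          fix x assume x: "x \<in> sym_diff ({0..1} \<inter> (UNIV - A)) (dyadic_set K ({..<2^K} - J))"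
          show "x \<in> sym_diff ({0..1} \<inter> A) (dyadic_set K J) \<union> {1}"
          proof (cases "x = 1")
            case False
            have "x \<in> {0..1}" using x by (auto simp: dyadic_set_def)
            then have x': "0 \<le> x" "x < 1" using False by auto
            then have "block (2^K) x < 2^K" using block_less[of "2^K" x] by simp
            then show ?thesis using x x' by (auto simp: dyadic_set_def)
          qed simp
        qed
        then have "mu (sym_diff ({0..1} \<inter> (UNIV - A)) (dyadic_set K ({..<2^K} - J))) \<le> mu (sym_diff ({0..1} \<inter> A) (dyadic_set K J) \<union> {1})"
          by (rule unit_leb.finite_measure_mono) (intro sets.Un[OF sd[OF Ab]] mu_singleton_1)
        also have "\<dots> \<le> mu (sym_diff ({0..1} \<inter> A) (dyadic_set K J)) + mu {1}"
          by (rule measure_Un_le[OF sd[OF Ab] mu_singleton_1(2)])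
        also have "\<dots> < \<epsilon>" using J by (simp add: mu_singleton_1)
        finally show "\<exists>J\<subseteq>{..<2^K}. mu (sym_diff ({0..1} \<inter> (UNIV - A)) (dyadic_set K J)) < \<epsilon>"
          by (intro exI[of _ "{..<2^K} - J"]) auto
      qed
    qed
  next
    case (union A)
    have Ab: "A i \<in> sets borel" for i using union(2) sets_borel_atMost by auto
    show ?case
    proof (intro allI impI)
      fix \<epsilon> :: real assume e: "\<epsilon> > 0"
      have sums: "(\<lambda>i. mu ({0..1} \<inter> A i)) sums mu (\<Union>i. {0..1} \<inter> A i)"
        by (rule unit_leb.finite_measure_UNION)
          (use I[OF Ab] union(1) in \<open>auto simp: disjoint_family_on_def\<close>)
      have "(\<lambda>n. mu (\<Union>i. {0..1} \<inter> A i) - (\<Sum>i<n. mu ({0..1} \<inter> A i))) \<longlonglongrightarrow> mu (\<Union>i. {0..1} \<inter> A i) - mu (\<Union>i. {0..1} \<inter> A i)"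
        using sums unfolding sums_def by (intro tendsto_intros)
      then have "\<forall>\<^sub>F n in sequentially. mu (\<Union>i. {0..1} \<inter> A i) - (\<Sum>i<n. mu ({0..1} \<inter> A i)) < \<epsilon> / 2"
        by (rule order_tendstoD) (use e in simp)
      then obtain n where n: "mu (\<Union>i. {0..1} \<inter> A i) - (\<Sum>i<n. mu ({0..1} \<inter> A i)) < \<epsilon> / 2"
        by (auto simp: eventually_sequentially)
      let ?U = "\<Union>i. {0..1} \<inter> A i" and ?V = "\<Union>i<n. {0..1} \<inter> A i"
      have UV: "?U \<in> sets unit_leb" "?V \<in> sets unit_leb" using I[OF Ab] by blast+
      have "mu ?V = (\<Sum>i<n. mu ({0..1} \<inter> A i))"
        by (rule unit_leb.finite_measure_finite_Union)
          (use I[OF Ab] union(1) in \<open>auto simp: disjoint_family_on_def\<close>)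
      moreover have "mu (?U - ?V) = mu ?U - mu ?V"
        by (rule unit_leb.finite_measure_Diff) (use UV in auto)
      ultimately have tail: "mu (?U - ?V) < \<epsilon> / 2" using n by simp
      have "\<exists>K0. \<forall>i. \<forall>K\<ge>K0 i. \<exists>J\<subseteq>{..<2^K}. mu (sym_diff ({0..1} \<inter> A i) (dyadic_set K J)) < \<epsilon> / (2 * (n + 1))"
        using union(3) e by (intro choice allI) (simp add: zero_less_divide_iff add_pos_nonneg)
      then obtain K0 where K0: "\<And>i K. K \<ge> K0 i \<Longrightarrow> \<exists>J\<subseteq>{..<2^K}. mu (sym_diff ({0..1} \<inter> A i) (dyadic_set K J)) < \<epsilon> / (2 * (n + 1))"
        by blast
      show "\<exists>K0. \<forall>K\<ge>K0. \<exists>J\<subseteq>{..<2^K}. mu (sym_diff ({0..1} \<inter> \<Union> (range A)) (dyadic_set K J)) < \<epsilon>"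
      proof (intro exI[of _ "\<Sum>i<n. K0 i"] allI impI)
        fix K assume K: "K \<ge> (\<Sum>i<n. K0 i)"
        have "K0 i \<le> K" if "i < n" for i
          using member_le_sum[of i "{..<n}" K0] that K by simp
        then have "\<forall>i\<in>{..<n}. \<exists>J\<subseteq>{..<2^K}. mu (sym_diff ({0..1} \<inter> A i) (dyadic_set K J)) < \<epsilon> / (2 * (n + 1))"
          using K0 by simp
        then obtain J where J: "\<And>i. i < n \<Longrightarrow> J i \<subseteq> {..<2^K}"
          "\<And>i. i < n \<Longrightarrow> mu (sym_diff ({0..1} \<inter> A i) (dyadic_set K (J i))) < \<epsilon> / (2 * (n + 1))"
          by (subst (asm) bchoice_iff) auto
        let ?D = "\<lambda>i. sym_diff ({0..1} \<inter> A i) (dyadic_set K (J i))"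
        have D: "?D i \<in> sets unit_leb" for i by (rule sd[OF Ab])
        have "sym_diff ({0..1} \<inter> \<Union> (range A)) (dyadic_set K (\<Union>i<n. J i)) \<subseteq> (\<Union>i<n. ?D i) \<union> (?U - ?V)"
          by (auto simp: dyadic_set_def)
        then have "mu (sym_diff ({0..1} \<inter> \<Union> (range A)) (dyadic_set K (\<Union>i<n. J i))) \<le> mu ((\<Union>i<n. ?D i) \<union> (?U - ?V))"
          by (rule unit_leb.finite_measure_mono) (use D UV in blast)
        also have "\<dots> \<le> mu (\<Union>i<n. ?D i) + mu (?U - ?V)"
          by (rule measure_Un_le) (use D UV in blast)+
        also have "mu (\<Union>i<n. ?D i) \<le> (\<Sum>i<n. mu (?D i))"
          by (rule measure_UNION_le) (use D in auto)
        also have "\<dots> \<le> (\<Sum>i<n. \<epsilon> / (2 * (n + 1)))"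
          by (rule sum_mono) (use J(2) in \<open>auto intro: less_imp_le\<close>)
        also have "\<dots> = \<epsilon> / 2 * (n / (n + 1))" by simp
        also have "\<dots> \<le> \<epsilon> / 2 * 1" using e by (intro mult_left_mono) auto
        finally have "mu (sym_diff ({0..1} \<inter> \<Union> (range A)) (dyadic_set K (\<Union>i<n. J i))) < \<epsilon>" using tail by linarith
        then show "\<exists>J\<subseteq>{..<2^K}. mu (sym_diff ({0..1} \<inter> \<Union> (range A)) (dyadic_set K J)) < \<epsilon>"
          using J(1) by (intro exI[of _ "\<Union>i<n. J i"]) auto
      qed
    qed
  qed
qed

text \<open>
  Up to \<open>1/m\<close>, the map \<open>f\<close> is the average of the indicators of the \<open>m\<close> sets where \<open>f x \<ge> l/m\<close>.
  Replacing these sets by dyadic ones gives the step function.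
\<close>

lemma mpt_step_approx:
  assumes f: "f \<in> mpt" and e: "\<epsilon> > 0"
  shows "\<exists>K\<ge>K1. \<exists>h :: nat \<Rightarrow> real. (\<integral>x. (h (block (2 ^ K) x) - f x)\<^sup>2 \<partial>unit_leb) < \<epsilon>"
proof -
  have [measurable]: "f \<in> borel_measurable unit_leb" using mptD(2)[OF f] .
  obtain m0 :: nat where m0: "2 / \<epsilon> < real m0" using reals_Archimedean2 by blast
  define m where "m = Suc m0"
  have m: "m > 0" "1 / real m < \<epsilon> / 2"
  proof -
    have "2 / \<epsilon> < real m" using m0 by (simp add: m_def)
    then show "1 / real m < \<epsilon> / 2" using e by (simp add: m_def field_simps)
  qed (simp add: m_def)
  define B where "B l = {x \<in> {0..1}. real l / m \<le> f x}" for l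
  have Bs: "B l \<in> sets unit_leb" for l
    using vimage_unit_leb[OF \<open>f \<in> borel_measurable unit_leb\<close>, of "{real l / m..}"] by (simp add: B_def)
  then have Bb: "B l \<in> sets borel" "{0..1} \<inter> B l = B l" for l by (auto simp: sets_unit_leb_iff)
  define \<gamma> where "\<gamma> = \<epsilon> / (2 * m)"
  have g: "\<gamma> > 0" using e m by (simp add: \<gamma>_def)
  have "\<exists>K0. \<forall>l. \<forall>K\<ge>K0 l. \<exists>J\<subseteq>{..<2^K}. mu (sym_diff ({0..1} \<inter> B l) (dyadic_set K J)) < \<gamma>"
    using dyadic_set_approx[OF Bb(1)] g by (intro choice allI) blast
  then obtain K0 where K0: "\<And>l K. K \<ge> K0 l \<Longrightarrow> \<exists>J\<subseteq>{..<2^K}. mu (sym_diff ({0..1} \<inter> B l) (dyadic_set K J)) < \<gamma>"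
    by blast
  define K where "K = K1 + (\<Sum>l\<in>{1..m}. K0 l)"
  have "K0 l \<le> K" if "l \<in> {1..m}" for l
    using member_le_sum[of l "{1..m}" K0] that by (simp add: K_def)
  then have "\<forall>l\<in>{1..m}. \<exists>J. mu (sym_diff ({0..1} \<inter> B l) (dyadic_set K J)) < \<gamma>"
    using K0 by blast
  then obtain J where J: "\<And>l. l \<in> {1..m} \<Longrightarrow> mu (sym_diff (B l) (dyadic_set K (J l))) < \<gamma>"
    unfolding Bb(2) by (subst (asm) bchoice_iff) blast
  define h where "h i = (\<Sum>l\<in>{1..m}. of_bool (i \<in> J l)) / real m" for i
  let ?D = "\<lambda>l. sym_diff (B l) (dyadic_set K (J l))"
  have D: "?D l \<in> sets unit_leb" for l using Bs by (intro sets.Un sets.Diff) auto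
  let ?Z = "\<Union>l\<in>{1..m}. ?D l"
  have Z: "?Z \<in> sets unit_leb" using D by blast
  have muZ: "mu ?Z < \<epsilon> / 2"
  proof -
    have "mu ?Z \<le> (\<Sum>l\<in>{1..m}. mu (?D l))" by (rule measure_UNION_le) (use D in auto)
    also have "\<dots> < (\<Sum>l\<in>{1..m}. \<gamma>)" by (rule sum_strict_mono) (use J m in auto)
    also have "\<dots> = \<epsilon> / 2" using m by (simp add: \<gamma>_def)
    finally show ?thesis .
  qed
  have h01: "0 \<le> h i" "h i \<le> 1" for i
  proof -
    show "0 \<le> h i" unfolding h_def by (intro divide_nonneg_nonneg sum_nonneg) auto
    have "(\<Sum>l\<in>{1..m}. of_bool (i \<in> J l)) \<le> (\<Sum>l\<in>{1..m}. 1 :: real)" by (rule sum_mono) simp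
    then show "h i \<le> 1" using m by (simp add: h_def)
  qed
  have f01: "0 \<le> f x" "f x \<le> 1" if "x \<in> {0..1}" for x using mpt_range[OF f that] by auto
  have pt: "(h (block (2 ^ K) x) - f x)\<^sup>2 \<le> 1 / m + indicator ?Z x" if x: "x \<in> {0..1}" "x \<noteq> 1" for x
  proof -
    let ?h = "h (block (2 ^ K) x)"
    have "\<bar>?h - f x\<bar> \<le> 1" using h01[of "block (2 ^ K) x"] f01[OF x(1)] by (auto simp: abs_le_iff)
    then have "\<bar>?h - f x\<bar> * \<bar>?h - f x\<bar> \<le> 1 * \<bar>?h - f x\<bar>" by (intro mult_right_mono) auto
    then have sq: "(?h - f x)\<^sup>2 \<le> \<bar>?h - f x\<bar>" by (simp add: power2_eq_square)
    show ?thesis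
    proof (cases "x \<in> ?Z")
      case True
      have "0 \<le> 1 / real m" by simp
      then show ?thesis using True sq \<open>\<bar>?h - f x\<bar> \<le> 1\<close> by (simp only: indicator_simps)
    next
      case False
      have "block (2 ^ K) x \<in> J l \<longleftrightarrow> real l \<le> m * f x" if "l \<in> {1..m}" for l
      proof -
        have "x \<in> B l \<longleftrightarrow> x \<in> dyadic_set K (J l)" using False that by blast
        moreover have "x \<in> dyadic_set K (J l) \<longleftrightarrow> block (2 ^ K) x \<in> J l" using x by (simp add: dyadic_set_def)
        moreover have "x \<in> B l \<longleftrightarrow> real l \<le> m * f x" using x m by (simp add: B_def field_simps)
        ultimately show ?thesis by blast
      qed
      then have "?h = (\<Sum>l\<in>{1..m}. of_bool (real l \<le> m * f x)) / real m"
        unfolding h_def by (intro arg_cong2[where f="(/)"] sum.cong) auto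
      also have "(\<Sum>l\<in>{1..m}. of_bool (real l \<le> m * f x)) = real (card ({1..m} \<inter> {l. real l \<le> m * f x}))"
        by simp
      also have "{1..m} \<inter> {l. real l \<le> m * f x} = {1..nat \<lfloor>m * f x\<rfloor>}"
      proof -
        have mf: "0 \<le> m * f x" "m * f x \<le> m * 1" using f01[OF x(1)] m by (auto intro!: mult_left_mono)
        have eq: "real l \<le> m * f x \<longleftrightarrow> l \<le> nat \<lfloor>m * f x\<rfloor>" for l
          using mf by (simp add: le_nat_iff le_floor_iff)
        have le: "nat \<lfloor>m * f x\<rfloor> \<le> m" using mf(2) by (simp add: nat_le_iff floor_le_iff)
        show ?thesis
          unfolding set_eq_iff Int_iff mem_Collect_eq atLeastAtMost_iff eq using le by (meson le_trans)
      qed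
      finally have "?h = of_int \<lfloor>m * f x\<rfloor> / m" using f01[OF x(1)] by simp
      then have "?h - f x = (of_int \<lfloor>m * f x\<rfloor> - m * f x) / m" using m by (simp add: diff_divide_distrib)
      also have "\<bar>\<dots>\<bar> \<le> 1 / m"
        unfolding abs_divide abs_of_nat by (rule divide_right_mono) linarith+
      finally show ?thesis using sq False by simp
    qed
  qed
  have [measurable]: "(\<lambda>x. h (block (2 ^ K) x)) \<in> borel_measurable unit_leb"
    by (rule measurable_compose[OF block_measurable_unit]) simp
  have intZ: "integrable unit_leb (indicator ?Z :: real \<Rightarrow> real)"
    using Z by (simp add: unit_leb.emeasure_finite less_top[symmetric] del: UN_simps)
  have "(\<integral>x. (h (block (2 ^ K) x) - f x)\<^sup>2 \<partial>unit_leb) \<le> (\<integral>x. 1 / m + indicator ?Z x \<partial>unit_leb)"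
  proof (rule integral_mono_AE)
    show "AE x in unit_leb. (h (block (2 ^ K) x) - f x)\<^sup>2 \<le> 1 / m + indicator ?Z x"
      using AE_neq_1 AE_space by eventually_elim (use pt in simp)
    show "integrable unit_leb (\<lambda>x. 1 / m + indicator ?Z x :: real)"
      by (rule Bochner_Integration.integrable_add[OF _ intZ]) simp
    show "integrable unit_leb (\<lambda>x. (h (block (2 ^ K) x) - f x)\<^sup>2)"
    proof (rule integrable_unit_leb_bounded[where C=1])
      fix x :: real assume x: "x \<in> {0..1}"
      have "\<bar>h (block (2 ^ K) x) - f x\<bar> \<le> 1" using h01[of "block (2 ^ K) x"] f01[OF x] by linarith
      then show "\<bar>(h (block (2 ^ K) x) - f x)\<^sup>2\<bar> \<le> 1" by (simp add: abs_square_le_1)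
    qed measurable
  qed
  also have "\<dots> = 1 / m + mu ?Z"
    using intZ sets.sets_into_space[OF Z] by (subst Bochner_Integration.integral_add) (simp_all add: Int_absorb2 del: UN_simps)
  also have "\<dots> < \<epsilon>" using m(2) muZ by linarith
  finally show ?thesis by (intro exI[of _ K] conjI exI[of _ h]) (simp_all add: K_def)
qed

section \<open>Approximation by interval permutations\<close>

text \<open>
  The new position of \<open>i\<close> is its rank when indices are ordered by the value of \<open>h\<close>, and
  equal values by the index.
\<close>

lemma sorting_permutation:
  fixes h :: "nat \<Rightarrow> real"
  shows "\<exists>\<pi>. \<pi> permutes {..<q} \<and> (\<forall>i<q. \<forall>j<q. h i < h j \<longrightarrow> \<pi> i < \<pi> j)"
proof -
  define less where "less i j \<longleftrightarrow> h i < h j \<or> (h i = h j \<and> i < j)" for i j :: nat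
  define rank where "rank i = card {j \<in> {..<q}. less j i}" for i
  have mono: "rank i < rank j" if "less i j" "i < q" for i j
  proof -
    have "{k \<in> {..<q}. less k i} \<subset> {k \<in> {..<q}. less k j}"
      using that by (auto simp: less_def)
    then show ?thesis unfolding rank_def by (intro psubset_card_mono) auto
  qed
  have "rank i < q" if "i < q" for i
  proof -
    have "{k \<in> {..<q}. less k i} \<subset> {..<q}" using that by (auto simp: less_def)
    then have "rank i < card {..<q}" unfolding rank_def by (intro psubset_card_mono) auto
    then show ?thesis by simp
  qed
  moreover have "inj_on rank {..<q}"
  proof (rule inj_onI)
    fix i j assume ij: "i \<in> {..<q}" "j \<in> {..<q}" "rank i = rank j"
    have "less i j \<or> less j i \<or> i = j" by (auto simp: less_def)
    then show "i = j" using mono[of i j] mono[of j i] ij by auto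
  qed
  ultimately have "bij_betw rank {..<q} {..<q}"
    by (simp add: bij_betw_def endo_inj_surj image_subset_iff)
  then have b: "bij_betw (\<lambda>i. if i < q then rank i else i) {..<q} {..<q}"
    by (subst bij_betw_cong[of _ _ rank]) auto
  show ?thesis
  proof (intro exI conjI allI impI)
    show "(\<lambda>i. if i < q then rank i else i) permutes {..<q}"
      by (rule bij_imp_permutes[OF b]) simp
    fix i j assume "i < q" "j < q" "h i < h j"
    then show "(if i < q then rank i else i) < (if j < q then rank j else j)"
      using mono[of i j] by (simp add: less_def)
  qed
qed

text \<open>
  The duality argument of optimal transport on the line. With \<open>P\<close> the sorting interval
  permutation, \<open>h\<close> is a nondecreasing function \<open>g\<close> of \<open>P x\<close>. Let \<open>G\<close> be a convex function of
  which \<open>g\<close> is a subgradient. Then \<open>h(x) (T x - P x) \<le> G(T x) - G(P x)\<close> at every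
  point except \<open>1\<close>, and the integral of the right-hand side vanishes, as both maps preserve the measure.
\<close>

lemma sorted_rearrangement_optimal:
  assumes q: "q > 0" and \<pi>: "\<pi> permutes {..<q}"
    and sorted: "\<And>i j. i < q \<Longrightarrow> j < q \<Longrightarrow> h i < h j \<Longrightarrow> \<pi> i < \<pi> j" and T: "T \<in> mpt"
  shows "(\<integral>x. h (block q x) * (T x - interval_perm q \<pi> x) \<partial>unit_leb) \<le> (0 :: real)"
proof -
  let ?P = "interval_perm q \<pi>"
  have P: "?P \<in> mpt" by (rule interval_perm_mpt[OF q \<pi>])
  note [measurable] = mptD(2)[OF T] mptD(2)[OF P]
  define g where "g k = h (inv \<pi> k)" for k
  define \<Delta> where "\<Delta> k = g (Suc k) - g k" for k
  have \<Delta>: "\<Delta> k \<ge> 0" if "k < q - 1" for k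
  proof (rule ccontr)
    assume "\<not> \<Delta> k \<ge> 0"
    then have "h (inv \<pi> (Suc k)) < h (inv \<pi> k)" by (simp add: \<Delta>_def g_def)
    moreover have "inv \<pi> (Suc k) < q" "inv \<pi> k < q"
      using permutes_in_image[OF permutes_inv[OF \<pi>]] that by auto
    ultimately have "\<pi> (inv \<pi> (Suc k)) < \<pi> (inv \<pi> k)" using sorted by blast
    then show False by (simp add: permutes_inverses[OF \<pi>])
  qed
  \<comment> \<open>\<open>g\<close> jumps by \<open>\<Delta> k\<close> at \<open>c k\<close>, and \<open>G\<close> is its antiderivative, a sum of ramps.\<close>
  define c where "c k = real (k + 1) / q" for k
  define G where "G s = g 0 * s + (\<Sum>k<q-1. \<Delta> k * max 0 (s - c k))" for s :: real
  have pt: "h (block q x) * (s - ?P x) \<le> G s - G (?P x)" if x: "0 \<le> x" "x < 1" for x s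
  proof -
    define y where "y = ?P x"
    define b where "b = block q y"
    note Pb = interval_perm_block[OF q \<pi> x]
    have y: "0 \<le> y" "y < 1" and b: "b = \<pi> (block q x)" using Pb by (auto simp: y_def b_def)
    have bq: "b < q" unfolding b_def by (rule block_less[OF q y])
    have "h (block q x) = g b" by (simp add: g_def b permutes_inverses[OF \<pi>])
    also have "g b = g 0 + (\<Sum>k<b. \<Delta> k)" by (simp add: \<Delta>_def sum_lessThan_telescope)
    also have "{..<b} = {..<q-1} \<inter> {k. k < b}" using bq by auto
    also have "sum \<Delta> ({..<q-1} \<inter> {k. k < b}) = (\<Sum>k<q-1. \<Delta> k * of_bool (k < b))"
      by (simp add: sum_mult_of_bool_eq)
    finally have "h (block q x) * (s - y) = g 0 * (s - y) + (\<Sum>k<q-1. \<Delta> k * of_bool (k < b) * (s - y))"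
      by (simp only: distrib_right sum_distrib_right)
    also have "(\<Sum>k<q-1. \<Delta> k * of_bool (k < b) * (s - y)) \<le> (\<Sum>k<q-1. \<Delta> k * (max 0 (s - c k) - max 0 (y - c k)))"
    proof (rule sum_mono)
      fix k assume k: "k \<in> {..<q-1}"
      have "of_bool (k < b) * (s - y) \<le> max 0 (s - c k) - max 0 (y - c k)"
      proof (cases "k < b")
        case True
        then have "c k \<le> real b / q" unfolding c_def by (intro divide_right_mono) auto
        then have "c k \<le> y" using block_bounds(1)[OF q y(1)] by (simp add: b_def)
        then show ?thesis using True by simp
      next
        case False
        then have "real (b + 1) / q \<le> c k" unfolding c_def by (intro divide_right_mono) auto
        then have "y \<le> c k" using block_bounds(2)[OF q y(1)] by (simp add: b_def)
        then show ?thesis using False by simp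
      qed
      then have "\<Delta> k * (of_bool (k < b) * (s - y)) \<le> \<Delta> k * (max 0 (s - c k) - max 0 (y - c k))"
        using \<Delta>[of k] k by (intro mult_left_mono) auto
      then show "\<Delta> k * of_bool (k < b) * (s - y) \<le> \<Delta> k * (max 0 (s - c k) - max 0 (y - c k))"
        by (simp only: mult.assoc)
    qed
    also have "g 0 * (s - y) + (\<Sum>k<q-1. \<Delta> k * (max 0 (s - c k) - max 0 (y - c k))) = G s - G y"
      by (simp add: G_def right_diff_distrib sum_subtractf)
    finally show ?thesis by (simp add: y_def)
  qed
  have Gm: "G \<in> borel_measurable unit_leb" unfolding G_def by measurable
  define C where "C = \<bar>g 0\<bar> + (\<Sum>k<q-1. \<bar>\<Delta> k\<bar>)"
  have GC: "\<bar>G s\<bar> \<le> C" if s: "s \<in> {0..1}" for s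
  proof -
    have "\<bar>G s\<bar> \<le> \<bar>g 0 * s\<bar> + \<bar>\<Sum>k<q-1. \<Delta> k * max 0 (s - c k)\<bar>" unfolding G_def by (rule abs_triangle_ineq)
    also have "\<dots> \<le> \<bar>g 0 * s\<bar> + (\<Sum>k<q-1. \<bar>\<Delta> k * max 0 (s - c k)\<bar>)" by (intro add_left_mono sum_abs)
    also have "\<dots> \<le> \<bar>g 0\<bar> * 1 + (\<Sum>k<q-1. \<bar>\<Delta> k\<bar> * 1)"
    proof (rule add_mono)
      show "\<bar>g 0 * s\<bar> \<le> \<bar>g 0\<bar> * 1" unfolding abs_mult using s by (intro mult_left_mono) auto
      show "(\<Sum>k<q-1. \<bar>\<Delta> k * max 0 (s - c k)\<bar>) \<le> (\<Sum>k<q-1. \<bar>\<Delta> k\<bar> * 1)"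
      proof (rule sum_mono)
        fix k
        have "0 \<le> c k" by (simp add: c_def)
        then have "\<bar>max 0 (s - c k)\<bar> \<le> 1" using s by (auto simp: max_def)
        then show "\<bar>\<Delta> k * max 0 (s - c k)\<bar> \<le> \<bar>\<Delta> k\<bar> * 1" unfolding abs_mult by (intro mult_left_mono) auto
      qed
    qed
    finally show ?thesis by (simp add: C_def)
  qed
  have Gi: "integrable unit_leb (\<lambda>x. G (f x))" if f: "f \<in> mpt" for f
    by (rule integrable_unit_leb_bounded[where C=C])
      (rule measurable_compose[OF mptD(1)[OF f] Gm], rule GC[OF mpt_range[OF f]])
  have [measurable]: "(\<lambda>x. h (block q x)) \<in> borel_measurable unit_leb"
    by (rule measurable_compose[OF block_measurable_unit]) simp
  have "(\<integral>x. h (block q x) * (T x - ?P x) \<partial>unit_leb) \<le> (\<integral>x. G (T x) - G (?P x) \<partial>unit_leb)"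
  proof (rule integral_mono_AE)
    show "integrable unit_leb (\<lambda>x. h (block q x) * (T x - ?P x))"
    proof (rule integrable_unit_leb_bounded[where C="(\<Sum>i\<le>q. \<bar>h i\<bar>) * 1"])
      fix x :: real assume x: "x \<in> {0..1}"
      have "block q x \<le> q"
      proof (cases "x = 1")
        case False
        then show ?thesis using block_less[OF q, of x] x by auto
      qed (simp add: block_def)
      then have "\<bar>h (block q x)\<bar> \<le> (\<Sum>i\<le>q. \<bar>h i\<bar>)"
        by (intro member_le_sum[where f="\<lambda>i. \<bar>h i\<bar>"]) auto
      moreover have "\<bar>T x - ?P x\<bar> \<le> 1"
        using mpt_range[OF T x] mpt_range[OF P x] by (auto simp: abs_le_iff)
      ultimately show "\<bar>h (block q x) * (T x - ?P x)\<bar> \<le> (\<Sum>i\<le>q. \<bar>h i\<bar>) * 1"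
        unfolding abs_mult by (intro mult_mono) auto
    qed measurable
    show "AE x in unit_leb. h (block q x) * (T x - ?P x) \<le> G (T x) - G (?P x)"
      using AE_neq_1 AE_space by eventually_elim (use pt in simp)
  qed (intro Bochner_Integration.integrable_diff Gi T P)
  also have "\<dots> = 0"
    using Gi[OF T] Gi[OF P] mpt_integral[OF T Gm] mpt_integral[OF P Gm] by simp
  finally show ?thesis .
qed

text \<open>
  Expanding the squares, the previous inequality says that \<open>P\<close> is at least as close to \<open>h\<close> in
  \<open>L\<^sup>2\<close> as \<open>T\<close> is, because \<open>T\<close> and \<open>P\<close> have the same norm.
\<close>

lemma mpt_perm_approx:
  assumes T: "T \<in> mpt" and e: "\<epsilon> > 0"
  shows "\<exists>K\<ge>K1. \<exists>\<pi>. \<pi> permutes {..<2 ^ K} \<and> L1_dist T (interval_perm (2 ^ K) \<pi>) < \<epsilon>"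
proof -
  obtain K h where K: "K \<ge> K1" and h: "(\<integral>x. (h (block (2 ^ K) x) - T x)\<^sup>2 \<partial>unit_leb) < \<epsilon>\<^sup>2 / 4"
    using mpt_step_approx[OF T, of "\<epsilon>\<^sup>2/4" K1] e by auto
  define q :: nat where "q = 2 ^ K"
  have q: "q > 0" by (simp add: q_def)
  obtain \<pi> where \<pi>: "\<pi> permutes {..<q}" "\<And>i j. i < q \<Longrightarrow> j < q \<Longrightarrow> h i < h j \<Longrightarrow> \<pi> i < \<pi> j"
    using sorting_permutation[of q h] by blast
  let ?P = "interval_perm q \<pi>"
  define H where "H x = h (block q x)" for x
  have P: "?P \<in> mpt" by (rule interval_perm_mpt[OF q \<pi>(1)])
  have [measurable]: "H \<in> borel_measurable unit_leb" unfolding H_def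
    by (rule measurable_compose[OF block_measurable_unit]) simp
  have HL: "H \<in> L2"
  proof (rule L2_bounded[where C="\<Sum>i\<le>q. \<bar>h i\<bar>"])
    fix x :: real assume x: "x \<in> {0..1}"
    have "block q x \<le> q"
    proof (cases "x = 1")
      case False
      then show ?thesis using block_less[OF q, of x] x by auto
    qed (simp add: block_def)
    then show "\<bar>H x\<bar> \<le> (\<Sum>i\<le>q. \<bar>h i\<bar>)"
      unfolding H_def by (intro member_le_sum[where f="\<lambda>i. \<bar>h i\<bar>"]) auto
  qed measurable
  note TL = mpt_in_L2[OF T] and PL = mpt_in_L2[OF P]
  have sqi: "integrable unit_leb (\<lambda>x. (f x)\<^sup>2)" if "f \<in> L2" for f using that by (simp add: L2_def)
  have le0: "(\<integral>x. H x * (T x - ?P x) \<partial>unit_leb) \<le> 0"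
    unfolding H_def by (rule sorted_rearrangement_optimal[OF q \<pi> T])
  have sq: "(\<integral>x. (T x)\<^sup>2 \<partial>unit_leb) = (\<integral>x. (?P x)\<^sup>2 \<partial>unit_leb)"
    using mpt_integral[OF T, of "\<lambda>x. x\<^sup>2"] mpt_integral[OF P, of "\<lambda>x. x\<^sup>2"] by simp
  have i1: "integrable unit_leb (\<lambda>x. (H x - T x)\<^sup>2)" by (intro sqi L2_diff HL TL)
  have i2: "integrable unit_leb (\<lambda>x. (?P x)\<^sup>2 - (T x)\<^sup>2)"
    by (intro Bochner_Integration.integrable_diff sqi TL PL)
  have i3: "integrable unit_leb (\<lambda>x. 2 * (H x * (T x - ?P x)))"
    by (intro integrable_mult_right L2_mult_integrable HL L2_diff TL PL)
  have "(\<integral>x. (H x - ?P x)\<^sup>2 \<partial>unit_leb) =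
      (\<integral>x. (H x - T x)\<^sup>2 + ((?P x)\<^sup>2 - (T x)\<^sup>2) + 2 * (H x * (T x - ?P x)) \<partial>unit_leb)"
    by (rule Bochner_Integration.integral_cong) (auto simp: power2_eq_square algebra_simps)
  also have "\<dots> = (\<integral>x. (H x - T x)\<^sup>2 \<partial>unit_leb) + (\<integral>x. (?P x)\<^sup>2 - (T x)\<^sup>2 \<partial>unit_leb) + (\<integral>x. 2 * (H x * (T x - ?P x)) \<partial>unit_leb)"
    using i1 i2 i3 by (simp only: Bochner_Integration.integral_add Bochner_Integration.integrable_add)
  also have "\<dots> \<le> (\<integral>x. (H x - T x)\<^sup>2 \<partial>unit_leb)"
    using le0 sq sqi[OF TL] sqi[OF PL] by simp
  finally have HP: "(\<integral>x. (H x - ?P x)\<^sup>2 \<partial>unit_leb) \<le> (\<integral>x. (H x - T x)\<^sup>2 \<partial>unit_leb)" .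
  have hT: "L2_norm (\<lambda>x. H x - T x) < \<epsilon> / 2"
  proof -
    have "(\<integral>x. (H x - T x)\<^sup>2 \<partial>unit_leb) < (\<epsilon> / 2)\<^sup>2"
      using h by (simp add: H_def q_def power_divide)
    then show ?thesis unfolding L2_norm_def using e by (intro real_less_lsqrt) auto
  qed
  have "L2_norm (\<lambda>x. T x - ?P x) \<le> L2_norm (\<lambda>x. T x - H x) + L2_norm (\<lambda>x. H x - ?P x)"
    by (rule L2_triangle_diff[OF TL HL PL])
  also have "L2_norm (\<lambda>x. T x - H x) = L2_norm (\<lambda>x. H x - T x)" by (rule L2_uminus_norm)
  also have "L2_norm (\<lambda>x. H x - ?P x) \<le> L2_norm (\<lambda>x. H x - T x)"
    unfolding L2_norm_def using HP by (rule real_sqrt_le_mono)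
  finally have "L2_norm (\<lambda>x. T x - ?P x) < \<epsilon>" using hT by linarith
  moreover have "L1_dist T ?P \<le> L2_norm (\<lambda>x. T x - ?P x)"
    unfolding L1_dist_def by (rule L1_le_L2(2)[OF L2_diff[OF TL PL]])
  ultimately have "L1_dist T ?P < \<epsilon>" by linarith
  then show ?thesis using K \<pi>(1) unfolding q_def by blast
qed

section \<open>Correlations and the weak topology\<close>

lemma mpt_funpow: "f \<in> mpt \<Longrightarrow> f ^^ m \<in> mpt"
proof (induction m)
  case 0
  then show ?case using mpt_id by (simp add: id_def)
next
  case (Suc m)
  then show ?case using mpt_comp[of f "f ^^ m"] by (simp add: o_def)
qed

lemma iter_int_mpt: "T \<in> inv_mpt \<Longrightarrow> iter_int T m \<in> mpt"
  by (simp add: iter_int_def mpt_funpow inv_mpt_imp_mpt inv_mpt_inverse_mpt)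

lemma inverse_funpow:
  assumes T: "T \<in> inv_mpt" and x: "x \<in> {0..1}"
  shows "(inv_into {0..1} T ^^ m) ((T ^^ m) x) = x"
proof (induction m)
  case (Suc m)
  have "(T ^^ m) x \<in> {0..1}" by (rule mpt_range[OF mpt_funpow[OF inv_mpt_imp_mpt[OF T]] x])
  then have "inv_into {0..1} T (T ((T ^^ m) x)) = (T ^^ m) x" by (rule inv_mptD(4)[OF T])
  then show ?case
    using Suc by (simp only: funpow_Suc_right[of m "inv_into {0..1} T"] funpow.simps(2)[of m T] o_apply)
qed simp

definition correlation :: "(real \<Rightarrow> real) \<Rightarrow> int \<Rightarrow> real set \<Rightarrow> real set \<Rightarrow> real" where
  "correlation T m A B = mu (A \<inter> pullback T m B)"

lemma pullback_sets: "T \<in> inv_mpt \<Longrightarrow> B \<in> sets unit_leb \<Longrightarrow> pullback T m B \<in> sets unit_leb"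
  unfolding pullback_def by (rule mpt_vimage(1)[OF iter_int_mpt])

text \<open>
  The preimage of \<open>A \<inter> T\<^sup>m B\<close> under the measure-preserving map \<open>T\<^sup>m\<close> is \<open>T\<^sup>-\<^sup>m A \<inter> B\<close>. This
  reduces negative exponents to positive ones.
\<close>

lemma correlation_uminus:
  assumes T: "T \<in> inv_mpt" and A: "A \<in> sets unit_leb" and B: "B \<in> sets unit_leb"
  shows "correlation T (- int m) A B = correlation T (int m) B A"
proof (cases "m = 0")
  case True
  have "A \<subseteq> {0..1}" "B \<subseteq> {0..1}" using A B by (auto simp: sets_unit_leb_iff)
  then have "A \<inter> pullback T 0 B = B \<inter> pullback T 0 A" by (auto simp: pullback_def iter_int_def)
  then show ?thesis using True by (simp add: correlation_def)
next
  case False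
  let ?X = "A \<inter> pullback T (- int m) B"
  have sub: "A \<subseteq> {0..1}" "B \<subseteq> {0..1}" using A B by (auto simp: sets_unit_leb_iff)
  have Tm: "T ^^ m \<in> mpt" by (rule mpt_funpow[OF inv_mpt_imp_mpt[OF T]])
  have X: "?X \<in> sets unit_leb" by (intro sets.Int A pullback_sets T B)
  have "{x \<in> {0..1}. (T ^^ m) x \<in> ?X} = B \<inter> pullback T (int m) A"
    using False sub mpt_range[OF Tm] inverse_funpow[OF T, of _ m]
    by (auto simp: pullback_def iter_int_def)
  then show ?thesis using mpt_vimage(2)[OF Tm X] by (simp add: correlation_def)
qed

lemma mu_le_add:
  assumes "X \<subseteq> Y \<union> Z" "Y \<in> sets unit_leb" "Z \<in> sets unit_leb"
  shows "mu X \<le> mu Y + mu Z"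
proof -
  have "mu X \<le> mu (Y \<union> Z)" by (rule unit_leb.finite_measure_mono) (use assms in auto)
  also have "\<dots> \<le> mu Y + mu Z" by (rule measure_Un_le) (use assms in auto)
  finally show ?thesis .
qed

lemma correlation_perturb_sets:
  assumes T: "T \<in> inv_mpt" and s: "A \<in> sets unit_leb" "A' \<in> sets unit_leb" "B \<in> sets unit_leb" "B' \<in> sets unit_leb"
  shows "\<bar>correlation T m A B - correlation T m A' B'\<bar> \<le> mu (sym_diff A A') + mu (sym_diff B B')"
proof -
  let ?P = "pullback T m"
  have sd: "sym_diff A A' \<in> sets unit_leb" "sym_diff B B' \<in> sets unit_leb" using s by auto
  have P: "?P B \<in> sets unit_leb" "?P B' \<in> sets unit_leb" "?P (sym_diff B B') \<in> sets unit_leb"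
    using pullback_sets[OF T] s sd by blast+
  have m: "mu (?P (sym_diff B B')) = mu (sym_diff B B')"
    unfolding pullback_def by (rule mpt_vimage(2)[OF iter_int_mpt[OF T] sd(2)])
  have "mu (A \<inter> ?P B) \<le> mu (A' \<inter> ?P B') + mu (sym_diff A A' \<union> ?P (sym_diff B B'))"
    by (rule mu_le_add) (use s sd P in \<open>auto simp: pullback_def\<close>)
  moreover have "mu (A' \<inter> ?P B') \<le> mu (A \<inter> ?P B) + mu (sym_diff A A' \<union> ?P (sym_diff B B'))"
    by (rule mu_le_add) (use s sd P in \<open>auto simp: pullback_def\<close>)
  moreover have "mu (sym_diff A A' \<union> ?P (sym_diff B B')) \<le> mu (sym_diff A A') + mu (sym_diff B B')"
    unfolding m[symmetric] by (rule measure_Un_le) (use sd P in auto)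
  ultimately show ?thesis unfolding correlation_def by linarith
qed

text \<open>
  Replace \<open>S\<close> by \<open>T\<close> in the \<open>m\<close>-fold composition one factor at a time; the factors \<open>S\<close> that remain
  do not change measures.
\<close>

lemma disagree_funpow_le:
  assumes S: "S \<in> mpt" and T: "T \<in> mpt" and B: "B \<in> sets unit_leb"
  shows "disagree (S ^^ m) (T ^^ m) B \<le> (\<Sum>b<m. disagree S T {x \<in> {0..1}. (T ^^ b) x \<in> B})"
proof (induction m)
  case (Suc m)
  let ?C = "{x \<in> {0..1}. (T ^^ m) x \<in> B}"
  have Sm: "S ^^ m \<in> mpt" and Tm: "T ^^ m \<in> mpt" using mpt_funpow S T by blast+
  have Bb: "B \<in> sets borel" using B by (simp add: sets_unit_leb_iff)
  have C: "?C \<in> sets borel" using mpt_vimage(1)[OF Tm B] by (simp add: sets_unit_leb_iff)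
  let ?D = "{x \<in> {0..1}. ((S ^^ m) x \<in> B) \<noteq> ((T ^^ m) x \<in> B)}"
  have D: "?D \<in> sets unit_leb" by (rule disagree_sets[OF mptD(2)[OF Sm] mptD(2)[OF Tm] Bb])
  have "disagree (S ^^ Suc m) (T ^^ Suc m) B \<le> mu {x \<in> {0..1}. S x \<in> ?D} + mu {x \<in> {0..1}. (S x \<in> ?C) \<noteq> (T x \<in> ?C)}"
    unfolding disagree_def
  proof (rule mu_le_add)
    show "{x \<in> {0..1}. S x \<in> ?D} \<in> sets unit_leb" by (rule mpt_vimage(1)[OF S D])
    show "{x \<in> {0..1}. (S x \<in> ?C) \<noteq> (T x \<in> ?C)} \<in> sets unit_leb"
      by (rule disagree_sets[OF mptD(2)[OF S] mptD(2)[OF T] C])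
    show "{x \<in> {0..1}. ((S ^^ Suc m) x \<in> B) \<noteq> ((T ^^ Suc m) x \<in> B)}
        \<subseteq> {x \<in> {0..1}. S x \<in> ?D} \<union> {x \<in> {0..1}. (S x \<in> ?C) \<noteq> (T x \<in> ?C)}"
    proof
      fix x assume x: "x \<in> {x \<in> {0..1}. ((S ^^ Suc m) x \<in> B) \<noteq> ((T ^^ Suc m) x \<in> B)}"
      then have "S x \<in> {0..1}" "T x \<in> {0..1}" using mpt_range[OF S] mpt_range[OF T] by blast+
      then show "x \<in> {x \<in> {0..1}. S x \<in> ?D} \<union> {x \<in> {0..1}. (S x \<in> ?C) \<noteq> (T x \<in> ?C)}"
        using x by (auto simp: funpow_swap1)
    qed
  qed
  also have "mu {x \<in> {0..1}. S x \<in> ?D} = disagree (S ^^ m) (T ^^ m) B"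
    unfolding disagree_def by (rule mpt_vimage(2)[OF S D])
  also have "mu {x \<in> {0..1}. (S x \<in> ?C) \<noteq> (T x \<in> ?C)} = disagree S T ?C" by (simp only: disagree_def)
  finally show ?case using Suc by simp
qed (simp add: disagree_def)

lemma correlation_diff_le:
  assumes S: "S \<in> inv_mpt" and T: "T \<in> inv_mpt" and A: "A \<in> sets unit_leb" and B: "B \<in> sets unit_leb"
  shows "\<bar>correlation S (int m) A B - correlation T (int m) A B\<bar> \<le> (\<Sum>b<m. disagree S T {x \<in> {0..1}. (T ^^ b) x \<in> B})"
proof -
  have Bb: "B \<in> sets borel" using B by (simp add: sets_unit_leb_iff)
  let ?D = "{x \<in> {0..1}. ((S ^^ m) x \<in> B) \<noteq> ((T ^^ m) x \<in> B)}"
  have D: "?D \<in> sets unit_leb"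
    by (rule disagree_sets[OF mptD(2) mptD(2) Bb]) (intro mpt_funpow inv_mpt_imp_mpt S T)+
  have P: "A \<inter> pullback S (int m) B \<in> sets unit_leb" "A \<inter> pullback T (int m) B \<in> sets unit_leb"
    using pullback_sets S T A B by blast+
  have "mu (A \<inter> pullback S (int m) B) \<le> mu (A \<inter> pullback T (int m) B) + mu ?D"
    by (rule mu_le_add[OF _ P(2) D]) (auto simp: pullback_def iter_int_def)
  moreover have "mu (A \<inter> pullback T (int m) B) \<le> mu (A \<inter> pullback S (int m) B) + mu ?D"
    by (rule mu_le_add[OF _ P(1) D]) (auto simp: pullback_def iter_int_def)
  moreover have "mu ?D \<le> (\<Sum>b<m. disagree S T {x \<in> {0..1}. (T ^^ b) x \<in> B})"
    using disagree_funpow_le[OF inv_mpt_imp_mpt[OF S] inv_mpt_imp_mpt[OF T] B, of m] by (simp only: disagree_def)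
  ultimately show ?thesis unfolding correlation_def by linarith
qed

lemma disagree_AE:
  assumes "S \<in> mpt" "T \<in> mpt" "AE x in unit_leb. S x = T x" "C \<in> sets borel"
  shows "disagree S T C = 0"
proof -
  have "{x \<in> {0..1}. (S x \<in> C) \<noteq> (T x \<in> C)} \<in> null_sets unit_leb"
  proof (rule AE_iff_null_sets[THEN iffD2])
    show "{x \<in> {0..1}. (S x \<in> C) \<noteq> (T x \<in> C)} \<in> sets unit_leb"
      by (rule disagree_sets) (use assms mptD(2) in auto)
    show "AE x in unit_leb. x \<notin> {x \<in> {0..1}. (S x \<in> C) \<noteq> (T x \<in> C)}"
      using assms(3) by eventually_elim simp
  qed
  then show ?thesis by (simp add: disagree_def measure_def null_setsD1)
qed

lemma correlation_AE_cong:
  assumes S: "S \<in> inv_mpt" and T: "T \<in> inv_mpt" and AE: "AE x in unit_leb. S x = T x"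
    and A: "A \<in> sets unit_leb" and B: "B \<in> sets unit_leb"
  shows "correlation S m A B = correlation T m A B"
proof -
  have pos: "correlation S (int k) A B = correlation T (int k) A B"
    if A: "A \<in> sets unit_leb" and B: "B \<in> sets unit_leb" for k A B
  proof -
    have "disagree S T {x \<in> {0..1}. (T ^^ b) x \<in> B} = 0" for b
    proof (rule disagree_AE[OF inv_mpt_imp_mpt[OF S] inv_mpt_imp_mpt[OF T] AE])
      show "{x \<in> {0..1}. (T ^^ b) x \<in> B} \<in> sets borel"
        using mpt_vimage(1)[OF mpt_funpow[OF inv_mpt_imp_mpt[OF T]] B] by (simp add: sets_unit_leb_iff)
    qed
    then show ?thesis using correlation_diff_le[OF S T A B, of k] by simp
  qed
  show ?thesis
  proof (cases "0 \<le> m")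
    case True
    then show ?thesis using pos[OF A B, of "nat m"] by simp
  next
    case False
    then show ?thesis
      using pos[OF B A, of "nat (- m)"] correlation_uminus[OF S A B, of "nat (- m)"] correlation_uminus[OF T A B, of "nat (- m)"]
      by simp
  qed
qed

lemma disagree_eq_L2:
  assumes S: "S \<in> mpt" and T: "T \<in> mpt" and C: "C \<in> sets borel"
  shows "disagree S T C = (L2_norm (\<lambda>x. indicator C (S x) - indicator C (T x)))\<^sup>2"
proof -
  let ?D = "{x \<in> {0..1}. (S x \<in> C) \<noteq> (T x \<in> C)}"
  have D: "?D \<in> sets unit_leb" by (rule disagree_sets[OF mptD(2)[OF S] mptD(2)[OF T] C])
  have "(\<integral>x. (indicator C (S x) - indicator C (T x))\<^sup>2 \<partial>unit_leb) = (\<integral>x. indicator ?D x \<partial>unit_leb :: real)"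
    by (rule Bochner_Integration.integral_cong) (auto simp: indicator_def)
  also have "\<dots> = mu ?D" using sets.sets_into_space[OF D] by (simp add: Int_absorb2)
  finally show ?thesis by (simp add: L2_norm_def disagree_def)
qed

text \<open>
  For a nonnegative exponent \<open>m\<close>, the correlations of \<open>S\<close> and \<open>T\<close> differ by at most the sum of
  the numbers \<open>disagree S T (T\<^sup>-\<^sup>b B)\<close>, \<open>b < m\<close>. Each of these is the square of the \<open>L\<^sup>2\<close> distance that
  the subbasic neighbourhoods of \<open>T\<close> control.
\<close>

lemma correlation_weak_open:
  assumes A: "A \<in> sets unit_leb" and B: "B \<in> sets unit_leb"
  shows "openin weak_topology {C \<in> Aut. \<bar>correlation (aut_rep C) m A B - c\<bar> < e}"
proof -
  have pos: "openin weak_topology {C \<in> Aut. \<bar>correlation (aut_rep C) (int k) A B - c\<bar> < e}" (is "openin _ ?V")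
    if A: "A \<in> sets unit_leb" and B: "B \<in> sets unit_leb" for k A B
  proof (subst openin_subopen, intro ballI)
    fix C assume C: "C \<in> ?V"
    define T where "T = aut_rep C"
    have T: "T \<in> inv_mpt" "aut_class T = C" using C aut_rep by (auto simp: T_def)
    \<comment> \<open>the room that is left, to be shared by the \<open>k\<close> sets \<open>T\<^sup>-\<^sup>b B\<close>\<close>
    define \<eta> where "\<eta> = e - \<bar>correlation T (int k) A B - c\<bar>"
    have eta: "\<eta> > 0" using C by (simp add: \<eta>_def T_def)
    define f :: "nat \<Rightarrow> real \<Rightarrow> real" where "f b = indicator {x \<in> {0..1}. (T ^^ b) x \<in> B}" for b
    have Cb: "{x \<in> {0..1}. (T ^^ b) x \<in> B} \<in> sets borel" for b
      using mpt_vimage(1)[OF mpt_funpow[OF inv_mpt_imp_mpt[OF T(1)]] B] by (simp add: sets_unit_leb_iff)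
    have f: "f b \<in> L2" for b
    proof (rule L2_bounded[where C=1])
      show "f b \<in> borel_measurable unit_leb" unfolding f_def
        using mpt_vimage(1)[OF mpt_funpow[OF inv_mpt_imp_mpt[OF T(1)]] B, of b] by (rule borel_measurable_indicator)
    qed (simp add: f_def indicator_def)
    define s where "s = sqrt (\<eta> / (k + 1))"
    have s: "s > 0" "s\<^sup>2 = \<eta> / (k + 1)" using eta by (simp_all add: s_def zero_less_divide_iff add_pos_nonneg)
    let ?W = "\<lambda>b. aut_class ` {S \<in> inv_mpt. L2_norm (\<lambda>x. f b (S x) - f b (T x)) < s}"
    let ?U = "(\<Inter>b\<in>{..<k}. ?W b) \<inter> topspace weak_topology"
    show "\<exists>U. openin weak_topology U \<and> C \<in> U \<and> U \<subseteq> ?V"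
    proof (intro exI[of _ ?U] conjI)
      show "openin weak_topology ?U"
      proof (rule openin_INT)
        show "openin weak_topology (?W b)" for b
          unfolding weak_topology_def
          by (rule topology_generated_by_Basis) (use f T(1) s(1) in blast)
      qed simp
      have "C \<in> ?W b" for b
        using aut_class_in_ball_iff[OF T(1) T(1) f, of b s] s(1) T(2) by (simp add: L2_norm_def)
      then show "C \<in> ?U" using C by simp
      show "?U \<subseteq> ?V"
      proof
        fix D assume D: "D \<in> ?U"
        then have DA: "D \<in> Aut" by simp
        define S where "S = aut_rep D"
        have S: "S \<in> inv_mpt" "aut_class S = D" using aut_rep[OF DA] by (auto simp: S_def)
        have "disagree S T {x \<in> {0..1}. (T ^^ b) x \<in> B} \<le> \<eta> / (k + 1)" if "b < k" for b
        proof -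
          have "L2_norm (\<lambda>x. f b (S x) - f b (T x)) < s"
            using D that aut_class_in_ball_iff[OF S(1) T(1) f, of b s] S(2) by auto
          then have "(L2_norm (\<lambda>x. f b (S x) - f b (T x)))\<^sup>2 \<le> s\<^sup>2" by (intro power_mono) auto
          then show ?thesis
            using disagree_eq_L2[OF inv_mpt_imp_mpt[OF S(1)] inv_mpt_imp_mpt[OF T(1)] Cb, of b] s(2)
            by (simp add: f_def)
        qed
        then have "(\<Sum>b<k. disagree S T {x \<in> {0..1}. (T ^^ b) x \<in> B}) \<le> (\<Sum>b<k. \<eta> / (k + 1))"
          by (intro sum_mono) auto
        also have "\<dots> = \<eta> * (k / (k + 1))" by simp
        also have "\<dots> < \<eta> * 1" using eta by (intro mult_strict_left_mono) auto
        finally have "\<bar>correlation S (int k) A B - correlation T (int k) A B\<bar> < \<eta>"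
          using correlation_diff_le[OF S(1) T(1) A B, of k] by linarith
        then have "\<bar>correlation S (int k) A B - c\<bar> < e" unfolding \<eta>_def by linarith
        then show "D \<in> ?V" using DA by (simp add: S_def)
      qed
    qed
  qed
  show ?thesis
  proof (cases "0 \<le> m")
    case True
    then show ?thesis using pos[OF A B, of "nat m"] by simp
  next
    case False
    have "correlation (aut_rep C) m A B = correlation (aut_rep C) (int (nat (- m))) B A" if "C \<in> Aut" for C
      using correlation_uminus[OF aut_rep(1)[OF that] A B, of "nat (- m)"] False by simp
    then have "{C \<in> Aut. \<bar>correlation (aut_rep C) m A B - c\<bar> < e} =
        {C \<in> Aut. \<bar>correlation (aut_rep C) (int (nat (- m))) B A - c\<bar> < e}" by auto
    then show ?thesis using pos[OF B A, of "nat (- m)"] by simp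
  qed
qed

section \<open>The mixing levels\<close>

definition dyadic_enum :: "nat \<Rightarrow> real set" where
  "dyadic_enum = from_nat_into (\<Union>K. dyadic_set K ` Pow {..<2 ^ K})"

lemma range_dyadic_enum: "range dyadic_enum = (\<Union>K. dyadic_set K ` Pow {..<2 ^ K})"
  unfolding dyadic_enum_def
proof (rule range_from_nat_into)
  show "countable (\<Union>K. dyadic_set K ` Pow {..<2 ^ K})"
    by (rule countable_UN) (auto intro: countable_finite)
  show "(\<Union>K. dyadic_set K ` Pow {..<2 ^ K}) \<noteq> {}" by blast
qed

lemma dyadic_enum_sets [simp]: "dyadic_enum a \<in> sets unit_leb"
  using range_dyadic_enum dyadic_set_in_sets by (metis (no_types, lifting) UN_E imageE rangeI)

lemma dyadic_enum_dense:
  assumes A: "A \<in> sets unit_leb" and e: "\<epsilon> > 0"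
  shows "\<exists>a. mu (sym_diff A (dyadic_enum a)) < \<epsilon>"
proof -
  have "A \<in> sets borel" "{0..1} \<inter> A = A" using A by (auto simp: sets_unit_leb_iff)
  then obtain K J where KJ: "J \<subseteq> {..<2 ^ K}" "mu (sym_diff A (dyadic_set K J)) < \<epsilon>"
    using dyadic_set_approx[of A] e by (metis order_refl)
  then have "dyadic_set K J \<in> range dyadic_enum" unfolding range_dyadic_enum by blast
  then show ?thesis using KJ(2) by auto
qed

definition mixture :: "real \<Rightarrow> real set \<Rightarrow> real set \<Rightarrow> real" where
  "mixture l A B = (1 - l) * mu (A \<inter> B) + l * mu A * mu B"

lemma mixture_perturb_sets:
  assumes l: "l \<in> {0..1}" and s: "A \<in> sets unit_leb" "A' \<in> sets unit_leb" "B \<in> sets unit_leb" "B' \<in> sets unit_leb"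
  shows "\<bar>mixture l A B - mixture l A' B'\<bar> \<le> mu (sym_diff A A') + mu (sym_diff B B')"
proof -
  let ?a = "mu (sym_diff A A')" and ?b = "mu (sym_diff B B')"
  have sd: "sym_diff A A' \<in> sets unit_leb" "sym_diff B B' \<in> sets unit_leb" using s by auto
  have "mu (A \<inter> B) \<le> mu (A' \<inter> B') + mu (sym_diff A A' \<union> sym_diff B B')"
    "mu (A' \<inter> B') \<le> mu (A \<inter> B) + mu (sym_diff A A' \<union> sym_diff B B')"
    by (rule mu_le_add; use s sd in auto)+
  moreover have "mu (sym_diff A A' \<union> sym_diff B B') \<le> ?a + ?b"
    by (rule measure_Un_le) (use sd in auto)
  ultimately have 1: "\<bar>mu (A \<inter> B) - mu (A' \<inter> B')\<bar> \<le> ?a + ?b" by linarith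
  have "mu A \<le> mu A' + ?a" "mu A' \<le> mu A + ?a" "mu B \<le> mu B' + ?b" "mu B' \<le> mu B + ?b"
    by (rule mu_le_add; use s sd in auto)+
  then have ab: "\<bar>mu A - mu A'\<bar> \<le> ?a" "\<bar>mu B - mu B'\<bar> \<le> ?b" by linarith+
  have "\<bar>(mu A - mu A') * mu B\<bar> \<le> ?a * 1" "\<bar>mu A' * (mu B - mu B')\<bar> \<le> 1 * ?b"
    unfolding abs_mult by (rule mult_mono; use ab mu_le_1 in simp)+
  then have "\<bar>(mu A - mu A') * mu B + mu A' * (mu B - mu B')\<bar> \<le> ?a + ?b"
    using abs_triangle_ineq[of "(mu A - mu A') * mu B" "mu A' * (mu B - mu B')"] by linarith
  moreover have "(mu A - mu A') * mu B + mu A' * (mu B - mu B') = mu A * mu B - mu A' * mu B'"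
    by (simp add: algebra_simps)
  ultimately have 2: "\<bar>mu A * mu B - mu A' * mu B'\<bar> \<le> ?a + ?b" by simp
  have "mixture l A B - mixture l A' B' =
      (1 - l) * (mu (A \<inter> B) - mu (A' \<inter> B')) + l * (mu A * mu B - mu A' * mu B')"
    by (simp add: mixture_def algebra_simps)
  also have "\<bar>\<dots>\<bar> \<le> (1 - l) * (?a + ?b) + l * (?a + ?b)"
    using 1 2 l by (intro order_trans[OF abs_triangle_ineq] add_mono) (auto simp: abs_mult intro!: mult_left_mono)
  also have "\<dots> = ?a + ?b" by (simp add: algebra_simps)
  finally show ?thesis .
qed

definition mixing_level :: "nat \<Rightarrow> (nat \<Rightarrow> real) \<Rightarrow> (nat \<Rightarrow> nat \<Rightarrow> int) \<Rightarrow> nat \<Rightarrow> (real \<Rightarrow> real) set set" where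
  "mixing_level N lam \<phi> k = {C \<in> Aut. \<exists>n>k. \<forall>j\<in>{1..N}. \<forall>a\<le>k. \<forall>b\<le>k.
     \<bar>correlation (aut_rep C) (\<phi> j n) (dyadic_enum a) (dyadic_enum b)
       - mixture (lam j) (dyadic_enum a) (dyadic_enum b)\<bar> < 1 / (real k + 1)}"

lemma mixing_level_open: "openin weak_topology (mixing_level N lam \<phi> k)"
proof -
  let ?V = "\<lambda>n (j, a, b). {C \<in> Aut. \<bar>correlation (aut_rep C) (\<phi> j n) (dyadic_enum a) (dyadic_enum b)
       - mixture (lam j) (dyadic_enum a) (dyadic_enum b)\<bar> < 1 / (real k + 1)}"
  have "mixing_level N lam \<phi> k = (\<Union>n\<in>{k<..}. (\<Inter>i\<in>{1..N} \<times> {..k} \<times> {..k}. ?V n i) \<inter> topspace weak_topology)"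
    by (auto simp: mixing_level_def)
  also have "openin weak_topology \<dots>"
  proof (intro openin_Union ballI, elim imageE)
    fix U n assume "U = (\<Inter>i\<in>{1..N} \<times> {..k} \<times> {..k}. ?V n i) \<inter> topspace weak_topology"
    moreover have "openin weak_topology ((\<Inter>i\<in>{1..N} \<times> {..k} \<times> {..k}. ?V n i) \<inter> topspace weak_topology)"
      by (rule openin_INT) (auto intro: correlation_weak_open)
    ultimately show "openin weak_topology U" by simp
  qed
  finally show ?thesis .
qed

lemma mixing_level_class:
  assumes T: "T \<in> inv_mpt"
  shows "aut_class T \<in> mixing_level N lam \<phi> k \<longleftrightarrow> (\<exists>n>k. \<forall>j\<in>{1..N}. \<forall>a\<le>k. \<forall>b\<le>k.
     \<bar>correlation T (\<phi> j n) (dyadic_enum a) (dyadic_enum b)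
       - mixture (lam j) (dyadic_enum a) (dyadic_enum b)\<bar> < 1 / (real k + 1))"
proof -
  have "correlation (aut_rep (aut_class T)) m (dyadic_enum a) (dyadic_enum b) =
      correlation T m (dyadic_enum a) (dyadic_enum b)" for m a b
    by (rule correlation_AE_cong[OF aut_rep(1)[OF aut_class_in_Aut[OF T]] T aut_rep_AE[OF T]]) simp_all
  then show ?thesis using aut_class_in_Aut[OF T] by (simp add: mixing_level_def)
qed

lemma mixing_along_imp_level:
  assumes T: "T \<in> inv_mpt" and mix: "mixing_along N lam \<phi> T"
  shows "aut_class T \<in> mixing_level N lam \<phi> k"
proof -
  obtain n :: "nat \<Rightarrow> nat" where n: "strict_mono_on {1..} n" "n ` {1..} \<subseteq> {1..}"
    and lim: "\<And>j A B. j \<in> {1..N} \<Longrightarrow> A \<in> sets unit_leb \<Longrightarrow> B \<in> sets unit_leb \<Longrightarrow>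
      (\<lambda>i. correlation T (\<phi> j (n i)) A B) \<longlonglongrightarrow> mixture (lam j) A B"
    using mix unfolding mixing_along_def correlation_def mixture_def by blast
  have ge: "Suc i \<le> n (Suc i)" for i
  proof (induction i)
    case 0
    then show ?case using n(2) by force
  next
    case (Suc i)
    have "n (Suc i) < n (Suc (Suc i))" by (rule strict_mono_onD[OF n(1)]) auto
    then show ?case using Suc by simp
  qed
  have "\<forall>\<^sub>F i in sequentially. \<forall>x\<in>{1..N} \<times> {..k} \<times> {..k}. case x of (j, a, b) \<Rightarrow>
      \<bar>correlation T (\<phi> j (n i)) (dyadic_enum a) (dyadic_enum b)
       - mixture (lam j) (dyadic_enum a) (dyadic_enum b)\<bar> < 1 / (real k + 1)"
  proof (intro eventually_ball_finite ballI)
    fix x assume "x \<in> {1..N} \<times> {..k} \<times> {..k}"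
    then obtain j a b where x: "x = (j, a, b)" "j \<in> {1..N}" by auto
    have "1 / (real k + 1) > 0" by (simp add: add_pos_nonneg)
    from tendstoD[OF lim[OF x(2) dyadic_enum_sets[of a] dyadic_enum_sets[of b]] this]
    show "\<forall>\<^sub>F i in sequentially. case x of (j, a, b) \<Rightarrow>
      \<bar>correlation T (\<phi> j (n i)) (dyadic_enum a) (dyadic_enum b)
       - mixture (lam j) (dyadic_enum a) (dyadic_enum b)\<bar> < 1 / (real k + 1)"
      by (simp add: x(1) dist_real_def)
  qed auto
  then obtain i0 where i0: "\<And>i. i \<ge> i0 \<Longrightarrow> \<forall>x\<in>{1..N} \<times> {..k} \<times> {..k}. case x of (j, a, b) \<Rightarrow>
      \<bar>correlation T (\<phi> j (n i)) (dyadic_enum a) (dyadic_enum b)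
       - mixture (lam j) (dyadic_enum a) (dyadic_enum b)\<bar> < 1 / (real k + 1)"
    by (auto simp: eventually_sequentially)
  define i where "i = Suc (max i0 k)"
  have "n i > k" using ge[of "max i0 k"] by (simp add: i_def)
  moreover have "i \<ge> i0" by (simp add: i_def)
  ultimately show ?thesis
    unfolding mixing_level_class[OF T] using i0[of i] by (intro exI[of _ "n i"]) auto
qed

text \<open>
  A time that serves for the level \<open>k\<close> serves for all lower levels as well, so the times can be
  chosen to be strictly increasing. Convergence for dyadic sets extends to all Borel sets since
  correlations and mixtures change by no more than the measure of the symmetric differences.
\<close>

lemma all_levels_imp_mixing_along:
  assumes T: "T \<in> inv_mpt" and lam: "\<forall>j\<in>{1..N}. lam j \<in> {0..1}"
    and lev: "\<And>k. aut_class T \<in> mixing_level N lam \<phi> k"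
  shows "mixing_along N lam \<phi> T"
proof -
  let ?P = "\<lambda>k n. \<forall>j\<in>{1..N}. \<forall>a\<le>k. \<forall>b\<le>k.
     \<bar>correlation T (\<phi> j n) (dyadic_enum a) (dyadic_enum b)
       - mixture (lam j) (dyadic_enum a) (dyadic_enum b)\<bar> < 1 / (real k + 1)"
  have "\<forall>k. \<exists>n. n > k \<and> ?P k n"
    by (intro allI) (rule lev[unfolded mixing_level_class[OF T]])
  from choice[OF this] obtain f where f0: "\<forall>k. f k > k \<and> ?P k (f k)" ..
  have f: "f k > k" "j \<in> {1..N} \<Longrightarrow> a \<le> k \<Longrightarrow> b \<le> k \<Longrightarrow>
     \<bar>correlation T (\<phi> j (f k)) (dyadic_enum a) (dyadic_enum b)
       - mixture (lam j) (dyadic_enum a) (dyadic_enum b)\<bar> < 1 / (real k + 1)" for k j a b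
    using f0[rule_format, of k] by blast+
  \<comment> \<open>Passing to a level above the previous time makes the times increase.\<close>
  define n where "n = rec_nat (f 0) (\<lambda>i m. f (max (Suc i) m))"
  have n_Suc: "n (Suc i) = f (max (Suc i) (n i))" for i by (simp add: n_def)
  have step: "n i < n (Suc i)" for i unfolding n_Suc using f(1)[of "max (Suc i) (n i)"] by simp
  then have mono: "strict_mono n" by (simp add: strict_mono_Suc_iff)
  have level: "\<exists>k\<ge>i. n i = f k" for i
  proof (cases i)
    case 0
    then show ?thesis by (auto simp: n_def)
  next
    case (Suc l)
    then show ?thesis by (intro exI[of _ "max (Suc l) (n l)"]) (simp add: n_Suc)
  qed
  have pos: "n i \<ge> 1" for i
  proof -
    obtain k where "n i = f k" using level by blast
    then show ?thesis using f(1)[of k] by simp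
  qed
  have dyadic: "(\<lambda>i. correlation T (\<phi> j (n i)) (dyadic_enum a) (dyadic_enum b)) \<longlonglongrightarrow> mixture (lam j) (dyadic_enum a) (dyadic_enum b)"
    if j: "j \<in> {1..N}" for j a b
  proof (rule LIM_zero_cancel, rule Lim_null_comparison)
    show "\<forall>\<^sub>F i in sequentially. norm (correlation T (\<phi> j (n i)) (dyadic_enum a) (dyadic_enum b) - mixture (lam j) (dyadic_enum a) (dyadic_enum b)) \<le> 1 / real (Suc i)"
      using eventually_ge_at_top[of "max a b"]
    proof eventually_elim
      case (elim i)
      obtain k where k: "k \<ge> i" "n i = f k" using level by blast
      have "\<bar>correlation T (\<phi> j (n i)) (dyadic_enum a) (dyadic_enum b) - mixture (lam j) (dyadic_enum a) (dyadic_enum b)\<bar> < 1 / (real k + 1)"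
        using f(2)[OF j, of a k b] k elim by (simp add: add.commute)
      also have "\<dots> \<le> 1 / real (Suc i)" using k(1) by (intro divide_left_mono) auto
      finally show ?case by simp
    qed
    show "(\<lambda>i. 1 / real (Suc i)) \<longlonglongrightarrow> 0" using LIMSEQ_inverse_real_of_nat by (simp add: inverse_eq_divide)
  qed
  have all: "(\<lambda>i. correlation T (\<phi> j (n i)) A B) \<longlonglongrightarrow> mixture (lam j) A B"
    if j: "j \<in> {1..N}" and A: "A \<in> sets unit_leb" and B: "B \<in> sets unit_leb" for j A B
  proof (rule tendstoI)
    fix \<epsilon> :: real assume e: "\<epsilon> > 0"
    obtain a where a: "mu (sym_diff A (dyadic_enum a)) < \<epsilon> / 6" using dyadic_enum_dense[OF A, of "\<epsilon>/6"] e by auto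
    obtain b where b: "mu (sym_diff B (dyadic_enum b)) < \<epsilon> / 6" using dyadic_enum_dense[OF B, of "\<epsilon>/6"] e by auto
    have "\<forall>\<^sub>F i in sequentially. dist (correlation T (\<phi> j (n i)) (dyadic_enum a) (dyadic_enum b)) (mixture (lam j) (dyadic_enum a) (dyadic_enum b)) < \<epsilon> / 3"
      by (rule tendstoD[OF dyadic[OF j]]) (use e in simp)
    then show "\<forall>\<^sub>F i in sequentially. dist (correlation T (\<phi> j (n i)) A B) (mixture (lam j) A B) < \<epsilon>"
    proof eventually_elim
      case (elim i)
      have "\<bar>correlation T (\<phi> j (n i)) A B - correlation T (\<phi> j (n i)) (dyadic_enum a) (dyadic_enum b)\<bar>
          \<le> mu (sym_diff A (dyadic_enum a)) + mu (sym_diff B (dyadic_enum b))"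
        by (rule correlation_perturb_sets[OF T A _ B]) simp_all
      moreover have "\<bar>mixture (lam j) A B - mixture (lam j) (dyadic_enum a) (dyadic_enum b)\<bar>
          \<le> mu (sym_diff A (dyadic_enum a)) + mu (sym_diff B (dyadic_enum b))"
        by (rule mixture_perturb_sets[OF _ A _ B]) (use lam j in simp_all)
      ultimately show ?case using elim a b unfolding dist_real_def by linarith
    qed
  qed
  show ?thesis
    unfolding mixing_along_def
  proof (intro exI[of _ n] conjI ballI)
    show "strict_mono_on {1..} n" using mono by (simp add: strict_mono_on_def strict_monoD)
    show "n ` {1..} \<subseteq> {1..}" using pos by auto
    show "(\<lambda>k. mu (A \<inter> pullback T (\<phi> j (n k)) B)) \<longlonglongrightarrow> (1 - lam j) * mu (A \<inter> B) + lam j * mu A * mu B"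
      if "j \<in> {1..N}" "A \<in> sets unit_leb" "B \<in> sets unit_leb" for j A B
      using all[OF that] unfolding correlation_def mixture_def .
  qed
qed

lemma mixing_classes_eq_Inter:
  assumes lam: "\<forall>j\<in>{1..N}. lam j \<in> {0..1}"
  shows "mixing_classes N lam \<phi> = (\<Inter>k. mixing_level N lam \<phi> k)"
proof (intro equalityI subsetI)
  fix C assume "C \<in> mixing_classes N lam \<phi>"
  then show "C \<in> (\<Inter>k. mixing_level N lam \<phi> k)"
    unfolding mixing_classes_def using mixing_along_imp_level by blast
next
  fix C assume C: "C \<in> (\<Inter>k. mixing_level N lam \<phi> k)"
  then have CA: "C \<in> Aut" by (auto simp: mixing_level_def)
  note rep = aut_rep[OF CA]
  have "mixing_along N lam \<phi> (aut_rep C)"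
    by (rule all_levels_imp_mixing_along[OF rep(1) lam]) (use C rep(2) in simp)
  then show "C \<in> mixing_classes N lam \<phi>"
    unfolding mixing_classes_def using rep by (metis (mono_tags, lifting) image_eqI mem_Collect_eq)
qed

text \<open>
  After the substitution \<open>y = S x\<close>, the distance of the inverses is the distance of
  \<open>T\<^sup>-\<^sup>1 \<circ> S\<close> from the identity \<open>T\<^sup>-\<^sup>1 \<circ> T\<close>.
\<close>

lemma two_sided_dist_cont:
  assumes T: "T \<in> inv_mpt" and e: "\<epsilon> > 0"
  shows "\<exists>\<delta>>0. \<forall>S\<in>inv_mpt. L1_dist S T < \<delta> \<longrightarrow> two_sided_dist T S < \<epsilon>"
proof -
  let ?R = "inv_into {0..1} T"
  have R: "?R \<in> mpt" and Tm: "T \<in> mpt" by (rule inv_mpt_inverse_mpt[OF T], rule inv_mpt_imp_mpt[OF T])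
  obtain \<delta> where d: "\<delta> > 0" "\<And>S. S \<in> mpt \<Longrightarrow> L1_dist S T < \<delta> \<Longrightarrow> L1_dist (\<lambda>x. ?R (S x)) (\<lambda>x. ?R (T x)) < \<epsilon> / 2"
    using mpt_comp_L1_cont[OF R Tm, of "\<epsilon>/2"] e by auto
  have "two_sided_dist T S < \<epsilon>" if S: "S \<in> inv_mpt" "L1_dist S T < min \<delta> (\<epsilon>/2)" for S
  proof -
    let ?Q = "inv_into {0..1} S"
    have Sm: "S \<in> mpt" and Q: "?Q \<in> mpt" by (rule inv_mpt_imp_mpt[OF S(1)], rule inv_mpt_inverse_mpt[OF S(1)])
    have "L1_dist ?R ?Q = L1_dist (\<lambda>x. ?R (S x)) (\<lambda>x. ?Q (S x))"
      by (rule L1_dist_comp_right[OF R Q Sm, symmetric])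
    also have "\<dots> = L1_dist (\<lambda>x. ?R (S x)) (\<lambda>x. ?R (T x))"
      unfolding L1_dist_def by (rule Bochner_Integration.integral_cong) (use inv_mptD(4)[OF S(1)] inv_mptD(4)[OF T] in auto)
    also have "\<dots> < \<epsilon> / 2" using d(2)[OF Sm] S(2) by simp
    finally show ?thesis using S(2) unfolding two_sided_dist_def by (simp add: L1_dist_commute[of S])
  qed
  then show ?thesis using d(1) e by (intro exI[of _ "min \<delta> (\<epsilon>/2)"]) auto
qed

lemma dyadic_set_refine:
  assumes "K' \<le> K"
  shows "\<exists>A\<subseteq>{..<2 ^ K}. dyadic_set K' J = dyadic_set K A"
proof (intro exI conjI)
  define c :: nat where "c = 2 ^ (K - K')"
  have c: "2 ^ K' * c = 2 ^ K" "c > 0" using assms by (simp_all add: c_def power_add[symmetric])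
  show "{i. i < 2 ^ K \<and> i div c \<in> J} \<subseteq> {..<2 ^ K}" by auto
  show "dyadic_set K' J = dyadic_set K {i. i < 2 ^ K \<and> i div c \<in> J}"
    unfolding dyadic_set_def
    using block_div[OF c(2), of _ "2 ^ K'"] block_less[of "2 ^ K"] by (auto simp: c(1))
qed

lemma interval_perm_correlation_dyadic:
  assumes c: "c > 0" and \<sigma>: "\<sigma> permutes {..<2 ^ K * c}"
  shows "correlation (interval_perm (2 ^ K * c) \<sigma>) (int m) (dyadic_set K A) (dyadic_set K B)
    = real (card {i \<in> {..<2 ^ K * c}. i div c \<in> A \<and> (\<sigma> ^^ m) i div c \<in> B}) / real (2 ^ K * c)"
proof -
  have "dyadic_set K A \<inter> pullback (interval_perm (2 ^ K * c) \<sigma>) (int m) (dyadic_set K B) =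
      {x \<in> {0..<1}. block (2 ^ K) x \<in> A \<and> (interval_perm (2 ^ K * c) \<sigma> ^^ m) x \<in> {0..<1} \<and>
       block (2 ^ K) ((interval_perm (2 ^ K * c) \<sigma> ^^ m) x) \<in> B}"
    by (auto simp: dyadic_set_def pullback_def iter_int_def)
  then show ?thesis unfolding correlation_def
    using interval_perm_correlation[OF _ c \<sigma>, of A m B] by simp
qed

text \<open>
  The two halves of the approximation: first \<open>T\<close> by a permutation of \<open>2\<^sup>K\<close> intervals,
  with \<open>K\<close> so large that the finitely many dyadic sets of the level are unions of these intervals,
  then this permutation by one that mixes.
\<close>

lemma mixing_level_dense:
  assumes lam: "\<forall>j\<in>{1..N}. lam j \<in> {0..1}" and ind: "asymp_independent N \<phi>"
    and T: "T \<in> inv_mpt" and e: "\<epsilon> > 0"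
  shows "\<exists>S\<in>inv_mpt. aut_class S \<in> mixing_level N lam \<phi> k \<and> two_sided_dist T S < \<epsilon>"
proof -
  obtain \<delta> where d: "\<delta> > 0" "\<And>S. S \<in> inv_mpt \<Longrightarrow> L1_dist S T < \<delta> \<Longrightarrow> two_sided_dist T S < \<epsilon>"
    using two_sided_dist_cont[OF T e] by blast
  have "\<exists>K J. dyadic_enum a = dyadic_set K J" for a
    using range_dyadic_enum by (metis (no_types, lifting) UN_E imageE rangeI)
  then obtain Ka Ja where KJ: "\<And>a. dyadic_enum a = dyadic_set (Ka a) (Ja a)" by metis
  obtain K0 where K0: "(1/2 :: real) ^ K0 < \<delta> / 4"
    using real_arch_pow_inv[of "\<delta>/4" "1/2"] d(1) by auto
  obtain K \<pi> where K: "K \<ge> K0 + (\<Sum>a\<le>k. Ka a)" and \<pi>: "\<pi> permutes {..<2 ^ K}"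
    and TP: "L1_dist T (interval_perm (2 ^ K) \<pi>) < \<delta> / 4"
    using mpt_perm_approx[OF inv_mpt_imp_mpt[OF T], of "\<delta>/4"] d(1) by (metis divide_pos_pos zero_less_numeral)
  define q :: nat where "q = 2 ^ K"
  have q: "q > 0" by (simp add: q_def)
  have q1: "1 / real q < \<delta> / 4"
  proof -
    have "1 / real q = (1/2) ^ K" by (simp add: q_def power_divide)
    also have "\<dots> \<le> (1/2) ^ K0" using K by (intro power_decreasing) auto
    finally show ?thesis using K0 by linarith
  qed
  have "\<exists>A\<subseteq>{..<2 ^ K}. dyadic_enum a = dyadic_set K A" if "a \<le> k" for a
  proof -
    have "Ka a \<le> (\<Sum>a\<le>k. Ka a)" using that by (intro member_le_sum) auto
    then show ?thesis using dyadic_set_refine[of "Ka a" K "Ja a"] KJ[of a] K by simp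
  qed
  then obtain X where X: "\<And>a. a \<le> k \<Longrightarrow> X a \<subseteq> {..<q}" "\<And>a. a \<le> k \<Longrightarrow> dyadic_enum a = dyadic_set K (X a)"
    unfolding q_def by metis
  define \<gamma> where "\<gamma> = min (\<delta> / 4) (1 / (2 * (real k + 1)))"
  have g: "\<gamma> > 0" "\<gamma> \<le> \<delta> / 4" "\<gamma> < 1 / (real k + 1)"
  proof -
    show "\<gamma> > 0" "\<gamma> \<le> \<delta> / 4" using d(1) by (simp_all add: \<gamma>_def)
    have "1 / (2 * (real k + 1)) < 1 / (real k + 1)" by (intro divide_strict_left_mono) auto
    then show "\<gamma> < 1 / (real k + 1)" by (simp add: \<gamma>_def min_less_iff_disj)
  qed
  obtain n c \<sigma> where n: "n > k" and c: "c > 0" and \<sigma>: "\<sigma> permutes {..<q * c}"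
    and close: "real (card {i \<in> {..<q * c}. \<sigma> i div c \<noteq> \<pi> (i div c)}) \<le> \<gamma> * real (q * c)"
    and mix0: "\<forall>j\<in>{1..N}. \<forall>A B. A \<subseteq> {..<q} \<longrightarrow> B \<subseteq> {..<q} \<longrightarrow>
       \<bar>real (card {i \<in> {..<q * c}. i div c \<in> A \<and> (\<sigma> ^^ nat \<bar>\<phi> j n\<bar>) i div c \<in> B}) / real (q * c)
        - ((1 - lam j) * (real (card (A \<inter> B)) / q) + lam j * (real (card A) / q) * (real (card B) / q))\<bar> \<le> \<gamma>"
    using finite_mixing_permutation[where lam=lam and nmin=k, OF q \<pi>[folded q_def] ind lam g(1)]
    by (elim exE conjE) (rule that, assumption+)
  note mix = mix0[rule_format]
  have qc: "q * c > 0" using q c by simp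
  define S where "S = interval_perm (q * c) \<sigma>"
  define P where "P = interval_perm q \<pi>"
  have S: "S \<in> inv_mpt" unfolding S_def by (rule interval_perm_inv_mpt[OF qc \<sigma>])
  have P: "P \<in> inv_mpt" unfolding P_def by (rule interval_perm_inv_mpt[OF q \<pi>[folded q_def]])
  have "L1_dist S P \<le> 1 / q + \<gamma>"
  proof -
    have "real (card {i \<in> {..<q * c}. \<sigma> i div c \<noteq> \<pi> (i div c)}) / real (q * c) \<le> \<gamma>"
      using close qc by (simp add: pos_divide_le_eq del: of_nat_mult)
    then show ?thesis using interval_perm_lift_close[OF q c \<pi>[folded q_def] \<sigma>] unfolding S_def P_def by linarith
  qed
  moreover have "L1_dist S T \<le> L1_dist S P + L1_dist P T"
    by (rule L1_dist_triangle[OF inv_mptD(2)[OF S] inv_mptD(2)[OF P] inv_mptD(2)[OF T]])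
  moreover have "L1_dist P T < \<delta> / 4" using TP by (simp add: P_def q_def L1_dist_commute)
  ultimately have "L1_dist S T < \<delta>" using q1 g(2) d(1) by linarith
  then have near: "two_sided_dist T S < \<epsilon>" by (rule d(2)[OF S])
  have mu_dy: "mu (dyadic_set K A) = real (card A) / q" if "A \<subseteq> {..<q}" for A
    unfolding dyadic_set_def q_def[symmetric] by (rule mu_block_set[OF q that])
  have Int: "dyadic_set K A \<inter> dyadic_set K B = dyadic_set K (A \<inter> B)" for A B
    by (auto simp: dyadic_set_def)
  have pos: "\<bar>correlation S (int (nat \<bar>\<phi> j n\<bar>)) (dyadic_set K A) (dyadic_set K B) - mixture (lam j) (dyadic_set K A) (dyadic_set K B)\<bar> < 1 / (real k + 1)"
    if j: "j \<in> {1..N}" and A: "A \<subseteq> {..<q}" and B: "B \<subseteq> {..<q}" for j A B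
  proof -
    have "correlation S (int (nat \<bar>\<phi> j n\<bar>)) (dyadic_set K A) (dyadic_set K B) =
        real (card {i \<in> {..<q * c}. i div c \<in> A \<and> (\<sigma> ^^ nat \<bar>\<phi> j n\<bar>) i div c \<in> B}) / real (q * c)"
      unfolding S_def q_def by (rule interval_perm_correlation_dyadic[OF c \<sigma>[unfolded q_def]])
    moreover have "mixture (lam j) (dyadic_set K A) (dyadic_set K B) =
        (1 - lam j) * (real (card (A \<inter> B)) / q) + lam j * (real (card A) / q) * (real (card B) / q)"
      unfolding mixture_def Int using mu_dy[OF A] mu_dy[OF B] mu_dy[of "A \<inter> B"] A by (simp add: le_infI1)
    ultimately show ?thesis using mix[OF j A B] g(3) by linarith
  qed
  have "\<bar>correlation S (\<phi> j n) (dyadic_enum a) (dyadic_enum b) - mixture (lam j) (dyadic_enum a) (dyadic_enum b)\<bar> < 1 / (real k + 1)"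
    if j: "j \<in> {1..N}" and a: "a \<le> k" and b: "b \<le> k" for j a b
  proof (cases "\<phi> j n \<ge> 0")
    case True
    then show ?thesis using pos[OF j X(1)[OF a] X(1)[OF b]] X(2) a b by simp
  next
    case False
    have "correlation S (\<phi> j n) (dyadic_enum a) (dyadic_enum b) = correlation S (int (nat \<bar>\<phi> j n\<bar>)) (dyadic_enum b) (dyadic_enum a)"
      using correlation_uminus[OF S, of "dyadic_enum a" "dyadic_enum b" "nat \<bar>\<phi> j n\<bar>"] False by simp
    moreover have "mixture (lam j) (dyadic_enum a) (dyadic_enum b) = mixture (lam j) (dyadic_enum b) (dyadic_enum a)"
      by (simp add: mixture_def Int_commute)
    ultimately show ?thesis using pos[OF j X(1)[OF b] X(1)[OF a]] X(2) a b by simp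
  qed
  then have "aut_class S \<in> mixing_level N lam \<phi> k"
    unfolding mixing_level_class[OF S] using n by (intro exI[of _ n]) (auto simp: add.commute)
  then show ?thesis using S near by blast
qed

section \<open>The theorem\<close>

theorem theorem1p2:
  fixes N :: nat and lam :: "nat \<Rightarrow> real" and \<phi> :: "nat \<Rightarrow> nat \<Rightarrow> int"
  assumes "N \<ge> 1"
    and "\<forall>j\<in>{1..N}. lam j \<in> {0..1}"
    and "asymp_independent N \<phi>"
  shows "gdelta_in weak_topology (mixing_classes N lam \<phi>) \<and>
         weak_topology closure_of (mixing_classes N lam \<phi>) = Aut"
proof
  have eq: "mixing_classes N lam \<phi> = (\<Inter>k. mixing_level N lam \<phi> k)"
    by (rule mixing_classes_eq_Inter[OF assms(2)])
  show "gdelta_in weak_topology (mixing_classes N lam \<phi>)"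
    unfolding eq by (rule gdelta_in_Inter) (auto intro: open_imp_gdelta_in mixing_level_open)
  show "weak_topology closure_of (mixing_classes N lam \<phi>) = Aut"
    unfolding eq
    by (rule weak_dense_Inter[OF mixing_level_open mixing_level_dense[OF assms(2,3)]])
qed

end
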